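(* Let $n\ge 2$ and $0\le d\le n-1$ be integers, and let $\omega_d\in\left[\frac{d+1}{n-d},+\infty\right]$. Then \[\dim_H\left(\mathbf{W}_n^d(\omega_d)^*\right)=\dim_H\left(\mathbf{W}_n^d(\omega_d)\right)=d+\frac{n+1}{1+\omega_d},\] (with $\frac{n+1}{1+\omega_d}=0$ if $\omega_d=+\infty$). In particular, this Hausdorff dimension equals $n$ if and only if $\omega_d=\frac{d+1}{n-d}$.
   Context: $\dim_H$ denotes Hausdorff dimension. For $\boldsymbol\theta\in\mathbb{R}^n$ and $0\le d\le n-1$, the ordinary exponent $\omega_d(\boldsymbol\theta)$ is the supremum of real numbers $\omega$ such that for arbitrarily large real $H$ there exists a rational affine subspace $L\subset\mathbb{R}^n$ with $\dim L=d$, $H(L)\le H$ and $H(L)\,d(\boldsymbol\theta,L)\le H^{-\omega}$; here $H(L)$ is the (Schmidt) height of the rational affine subspace $L$ and $d(\boldsymbol\theta,L)=\min_{P\in L}d(\boldsymbol\theta,P)$ is the Euclidean distance from $\boldsymbol\theta$ to $L$. (These exponents are considered for $\boldsymbol\theta$ with $1,\theta_1,\dots,\theta_n$ linearly independent over $\mathbb{Q}$.) The Diophantine sets are $\mathbf{W}_n^d(\omega_d)=\{\boldsymbol\theta\in\mathbb{R}^n:\omega_d(\boldsymbol\theta)\ge\omega_d\}$ and $\mathbf{W}_n^d(\omega_d)^*=\{\boldsymbol\theta\in\mathbb{R}^n:\omega_d(\boldsymbol\theta)=\omega_d\}$. *)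

theory Defs
  imports "HOL-Analysis.Analysis"
begin

definition diam_pow :: "real \<Rightarrow> 'a::metric_space set \<Rightarrow> real" where
  "diam_pow s U = (if U = {} then 0 else if s = 0 then 1 else diameter U powr s)"

definition hausdorff_content :: "real \<Rightarrow> real \<Rightarrow> 'a::metric_space set \<Rightarrow> ennreal" where
  "hausdorff_content s \<delta> A =
     Inf {(\<Sum>i. ennreal (diam_pow s (U i))) | U :: nat \<Rightarrow> 'a set.
            A \<subseteq> (\<Union>i. U i) \<and> (\<forall>i. bounded (U i) \<and> diameter (U i) \<le> \<delta>)}"

definition hausdorff_measure :: "real \<Rightarrow> 'a::metric_space set \<Rightarrow> ennreal" where
  "hausdorff_measure s A = (SUP \<delta>\<in>{0<..}. hausdorff_content s \<delta> A)"

definition hausdorff_dim :: "'a::metric_space set \<Rightarrow> ereal" where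
  "hausdorff_dim A = Inf {ereal s | s. 0 \<le> s \<and> hausdorff_measure s A = 0}"

definition rat_point :: "real ^ 'n \<Rightarrow> bool" where
  "rat_point p \<longleftrightarrow> (\<forall>i. p $ i \<in> \<rat>)"

definition rat_affine_subspace :: "nat \<Rightarrow> (real ^ 'n) set \<Rightarrow> bool" where
  "rat_affine_subspace d L \<longleftrightarrow>
     affine L \<and> L \<noteq> {} \<and> aff_dim L = int d \<and> L = affine hull {p \<in> L. rat_point p}"

text \<open>R^(n+1) is modelled as real \<times> R^n; integer points of it.\<close>
definition int_point :: "real \<times> (real ^ 'n) \<Rightarrow> bool" where
  "int_point y \<longleftrightarrow> fst y \<in> \<int> \<and> (\<forall>i. snd y $ i \<in> \<int>)"

definition lift_subspace :: "(real ^ 'n) set \<Rightarrow> (real \<times> (real ^ 'n)) set" where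
  "lift_subspace L = span ((\<lambda>p. (1, p)) ` L)"

definition lattice_basis ::
    "(real \<times> (real ^ 'n)) set \<Rightarrow> (nat \<Rightarrow> real \<times> (real ^ 'n)) \<Rightarrow> nat \<Rightarrow> bool" where
  "lattice_basis W v k \<longleftrightarrow>
     (\<forall>i<k. int_point (v i)) \<and> independent (v ` {..<k}) \<and> inj_on v {..<k} \<and>
     span (v ` {..<k}) = W \<and>
     (\<forall>y. y \<in> W \<and> int_point y \<longrightarrow>
          (\<exists>c. (\<forall>i<k. c i \<in> \<int>) \<and> y = (\<Sum>i<k. c i *\<^sub>R v i)))"

definition gram_det :: "(nat \<Rightarrow> 'a::real_inner) \<Rightarrow> nat \<Rightarrow> real" where
  "gram_det v k = (\<Sum>p | p permutes {..<k}. of_int (sign p) * (\<Prod>i<k. v i \<bullet> v (p i)))"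

text \<open>Schmidt height of a rational affine subspace L: the covolume of the lattice
  lift(L) \<inter> Z^(n+1), i.e. sqrt of the Gram determinant of a basis of that lattice
  (i.e. the norm of v_0 \<and> ... \<and> v_d).\<close>
definition schmidt_height :: "(real ^ 'n) set \<Rightarrow> real" where
  "schmidt_height L =
     (let k = nat (aff_dim L) + 1;
          v = (SOME v. lattice_basis (lift_subspace L) v k)
      in sqrt (gram_det v k))"

definition omega_exp :: "nat \<Rightarrow> real ^ 'n \<Rightarrow> ereal" where
  "omega_exp d \<theta> = Sup {ereal w | w.
      \<forall>H0. \<exists>H \<ge> H0. \<exists>L. rat_affine_subspace d L \<and> schmidt_height L \<le> H \<and>
                   schmidt_height L * infdist \<theta> L \<le> H powr (- w)}"

definition Q_lin_indep1 :: "real ^ 'n \<Rightarrow> bool" where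
  "Q_lin_indep1 \<theta> \<longleftrightarrow>
     (\<forall>c0 c. c0 \<in> \<rat> \<and> (\<forall>i. c i \<in> \<rat>) \<and> c0 + (\<Sum>i\<in>UNIV. c i * \<theta> $ i) = 0
            \<longrightarrow> c0 = 0 \<and> (\<forall>i. c i = 0))"

definition W_set :: "nat \<Rightarrow> ereal \<Rightarrow> (real ^ 'n) set" where
  "W_set d w = {\<theta>. Q_lin_indep1 \<theta> \<and> omega_exp d \<theta> \<ge> w}"

definition W_set_exact :: "nat \<Rightarrow> ereal \<Rightarrow> (real ^ 'n) set" where
  "W_set_exact d w = {\<theta>. Q_lin_indep1 \<theta> \<and> omega_exp d \<theta> = w}"

end

theory Submission
  imports Defs "Jordan_Normal_Form.Determinant"
begin

no_notation vec_index (infixl "$" 100)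
no_notation scalar_prod (infix "\<bullet>" 70)
hide_const (open) Matrix.orthogonal

text \<open>Write \<open>n\<close> for the dimension and \<open>w\<^sub>0 = (d + 1) / (n - d)\<close>.

  Upper bound: a rational subspace of height \<open>h\<close> has an integer basis whose product of norms is at most
  a constant times \<open>h\<close> (reduction theory), and the \<open>r\<close>-neighbourhood of a \<open>d\<close>-dimensional subspace is covered by
  about \<open>r\<close> to the power \<open>- d\<close> balls of radius \<open>r\<close>. The covering sum over all subspaces is therefore dominated by a
  sum over all \<open>(d + 1)\<close>-tuples of integer vectors, which factorises.

  Lower bound: reduction theory applied to a deformed integer lattice shows that every point is
  approximated by rational subspaces with exponent \<open>w\<^sub>0\<close>; by the upper bound this is optimal almost everywhere, hence
  almost all of a ball lies within about \<open>H\<close> to the power \<open>- (1 + w\<^sub>0)\<close> of the rational subspaces of height at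
  most \<open>H\<close>. Grids inside well separated pieces of these subspaces feed a Cantor type
  argument that bounds the Hausdorff content of a countable intersection from below. At the
  critical dimension the sets with a larger exponent are null, so the exact exponent is attained on a set
  that is not null.\<close>


section \<open>Gram determinants\<close>

text \<open>The number \<open>n + 1\<close> of the formula has two sources. In the covering sum, a
  tube of radius \<open>h powr - (1 + w)\<close> about a subspace of height \<open>h\<close> costs
  about \<open>h powr - ((1 + w) * (s - d))\<close>. Bounding \<open>h\<close> below by a product of
  norms of \<open>d + 1\<close> vectors in dimension \<open>n + 1\<close> gives a sum that converges
  once \<open>(1 + w) * (s - d) > n + 1\<close>. In the lower bound, about
  \<open>\<rho> powr - n\<close> separated pieces with \<open>(\<rho> / r) ^ d\<close> grid points
  each must outnumber \<open>r powr - s\<close>. With \<open>\<rho>\<close> near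
  \<open>m powr - (1 + w\<^sub>0)\<close> and \<open>r\<close> near \<open>m powr - (1 + w)\<close>
  this asks for \<open>(1 + w\<^sub>0) * (n - d) > (1 + w) * (s - d)\<close>, and the left side is
  \<open>n + 1\<close>.

  The obstacle is that Dirichlet's theorem leaves open whether the subspace found at parameter
  \<open>m\<close> has far smaller height and lies far away at the scale \<open>\<rho>\<close>. The
  covering bound at \<open>s = n\<close> excludes this for almost all points.

  All estimates concern covers of small total cost. Their countable subadditivity carries the step
  to the exact exponent: \<open>W_set d w\<close> is the exact set together with countably many sets
  that are null at the critical dimension.\<close>

lemma gram_det_eq_det:
  "gram_det v k = Determinant.det (mat k k (\<lambda>(i, j). v i \<bullet> v j))"
  unfolding gram_det_def Determinant.det_def
  by (simp add: atLeast0LessThan)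

text \<open>Under a linear substitution the Gram matrix changes by congruence. Row operations,
  changes of lattice basis and replaced vectors are all instances.\<close>

lemma gram_det_linear_comb:
  fixes u v :: "nat \<Rightarrow> 'a::real_inner"
  assumes "\<And>i. i < k \<Longrightarrow> u i = (\<Sum>j<k. A i j *\<^sub>R v j)"
  shows "gram_det u k = (Determinant.det (mat k k (\<lambda>(i, j). A i j)))\<^sup>2 * gram_det v k"
proof -
  let ?A = "mat k k (\<lambda>(i, j). A i j)"
  let ?G = "mat k k (\<lambda>(i, j). v i \<bullet> v j)"
  have "mat k k (\<lambda>(i, j). u i \<bullet> u j) = ?A * ?G * Matrix.transpose_mat ?A"
  proof (rule eq_matI)
    fix i j assume "i < dim_row (?A * ?G * Matrix.transpose_mat ?A)"
      and "j < dim_col (?A * ?G * Matrix.transpose_mat ?A)"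
    then have ij: "i < k" "j < k" by auto
    have "(\<Sum>l<k. A i l *\<^sub>R v l) \<bullet> (\<Sum>m<k. A j m *\<^sub>R v m)
        = (\<Sum>m<k. (\<Sum>l<k. A i l * (v l \<bullet> v m)) * A j m)"
      by (simp add: inner_sum_left inner_sum_right sum_distrib_left sum_distrib_right ac_simps)
    then show "index_mat (mat k k (\<lambda>(i, j). u i \<bullet> u j)) (i, j)
        = index_mat (?A * ?G * Matrix.transpose_mat ?A) (i, j)"
      using ij assms by (simp add: scalar_prod_def atLeast0LessThan)
  qed auto
  moreover have "Determinant.det (?A * ?G * Matrix.transpose_mat ?A)
      = Determinant.det ?A * Determinant.det ?G * Determinant.det ?A"
    by (subst Determinant.det_mult[where n = k], auto)
       (subst Determinant.det_mult[where n = k], auto simp: Determinant.det_transpose[where n = k])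
  ultimately show ?thesis
    by (simp add: gram_det_eq_det power2_eq_square)
qed

text \<open>Projection along \<open>b\<close> onto its orthogonal complement. For
  \<open>b = 0\<close> the quotient is 0 by convention, so the map is the identity and remains
  linear and contracting.\<close>

definition perp :: "'a::real_inner \<Rightarrow> 'a \<Rightarrow> 'a" where
  "perp b x = x - ((x \<bullet> b) / (b \<bullet> b)) *\<^sub>R b"

lemma perp_inner [simp]: "perp b x \<bullet> b = 0" "b \<bullet> perp b x = 0"
  by (cases "b = 0"; simp add: perp_def inner_diff_left inner_diff_right inner_commute)+

lemma perp_add: "perp b (x + y) = perp b x + perp b y"
  by (simp add: perp_def inner_add_left add_divide_distrib algebra_simps)

lemma perp_scale: "perp b (c *\<^sub>R x) = c *\<^sub>R perp b x"
  by (simp add: perp_def algebra_simps)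

lemma linear_perp: "linear (perp b)"
  by (rule linearI) (simp_all add: perp_add perp_scale)

lemma norm_perp_le: "norm (perp b x) \<le> norm x"
proof -
  have *: "(p + t *\<^sub>R b) \<bullet> (p + t *\<^sub>R b) = p \<bullet> p + t\<^sup>2 * (b \<bullet> b)"
    if "p \<bullet> b = 0" "b \<bullet> p = 0" for p t
    using that by (simp add: inner_add_left inner_add_right power2_eq_square)
  have "x = perp b x + ((x \<bullet> b) / (b \<bullet> b)) *\<^sub>R b" by (simp add: perp_def)
  then have "x \<bullet> x = perp b x \<bullet> perp b x + ((x \<bullet> b) / (b \<bullet> b))\<^sup>2 * (b \<bullet> b)"
    using *[of "perp b x" "(x \<bullet> b) / (b \<bullet> b)"] by simp
  then have "perp b x \<bullet> perp b x \<le> x \<bullet> x" by simp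
  then show ?thesis by (simp add: norm_eq_sqrt_inner)
qed

text \<open>A permutation that moves \<open>k\<close> contributes the factor
  \<open>u k \<bullet> u (p k) = 0\<close>, so the Leibniz sum collapses to the permutations that
  fix \<open>k\<close>.\<close>

lemma gram_det_Suc_orthogonal:
  assumes "\<And>i. i < k \<Longrightarrow> u k \<bullet> u i = 0"
  shows "gram_det u (Suc k) = (u k \<bullet> u k) * gram_det u k"
proof -
  let ?f = "\<lambda>p. real_of_int (sign p) * (\<Prod>i<Suc k. u i \<bullet> u (p i))"
  have sub: "{p. p permutes {..<k}} \<subseteq> {p. p permutes {..<Suc k}}"
    by (auto intro: permutes_subset)
  have "gram_det u (Suc k) = (\<Sum>p | p permutes {..<Suc k}. ?f p)"
    by (simp add: gram_det_def)
  also have "\<dots> = (\<Sum>p | p permutes {..<k}. ?f p)"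
  proof (rule sum.mono_neutral_right[OF finite_permutations sub])
    show "\<forall>p\<in>{p. p permutes {..<Suc k}} - {p. p permutes {..<k}}. ?f p = 0"
    proof
      fix p assume p: "p \<in> {p. p permutes {..<Suc k}} - {p. p permutes {..<k}}"
      have "p k \<noteq> k"
      proof
        assume "p k = k"
        then have "p permutes {..<k}"
          using p permutes_superset[of p "{..<Suc k}" "{..<k}"] by (auto simp: less_Suc_eq)
        with p show False by simp
      qed
      moreover have "p k < Suc k" using p permutes_in_image[of p "{..<Suc k}" k] by auto
      ultimately have "u k \<bullet> u (p k) = 0" using assms by simp
      then show "?f p = 0" by simp
    qed
  qed simp
  also have "\<dots> = (\<Sum>p | p permutes {..<k}. (u k \<bullet> u k) * (real_of_int (sign p) * (\<Prod>i<k. u i \<bullet> u (p i))))"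
  proof (rule sum.cong[OF refl])
    fix p assume "p \<in> {p. p permutes {..<k}}"
    then have "p k = k" by (simp add: permutes_not_in)
    then show "?f p = (u k \<bullet> u k) * (real_of_int (sign p) * (\<Prod>i<k. u i \<bullet> u (p i)))"
      by simp
  qed
  finally show ?thesis by (simp add: gram_det_def sum_distrib_left)
qed

lemma gram_det_cong: "(\<And>i. i < k \<Longrightarrow> u i = v i) \<Longrightarrow> gram_det u k = gram_det v k"
  unfolding gram_det_def
proof (intro sum.cong arg_cong2[where f = "(*)"] prod.cong refl)
  fix p i assume "\<And>i. i < k \<Longrightarrow> u i = v i" "p \<in> {p. p permutes {..<k}}" "i \<in> {..<k}"
  moreover from this have "p i < k" using permutes_in_image[of p "{..<k}" i] by auto
  ultimately show "u i \<bullet> u (p i) = v i \<bullet> v (p i)" by simp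
qed

text \<open>Subtracting multiples of \<open>v k\<close> from the other vectors is a unitriangular
  substitution, after which \<open>v k\<close> is orthogonal to them. The inductions on the number
  of vectors below split off the last one in this way.\<close>

lemma gram_det_Suc:
  fixes v :: "nat \<Rightarrow> 'a::real_inner"
  shows "gram_det v (Suc k) = (v k \<bullet> v k) * gram_det (\<lambda>i. perp (v k) (v i)) k"
proof -
  define u where "u i = (if i < k then perp (v k) (v i) else v i)" for i
  define A where "A i j = (if j = i then 1 else if j = k then (v i \<bullet> v k) / (v k \<bullet> v k) else 0)" for i j :: nat
  let ?A = "mat (Suc k) (Suc k) (\<lambda>(i, j). A i j)"
  have "v i = (\<Sum>j<Suc k. A i j *\<^sub>R u j)" if "i < Suc k" for i
  proof (cases "i = k")
    case True
    then show ?thesis by (simp add: A_def u_def)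
  next
    case False
    then have "i < k" using that by simp
    then have "(\<Sum>j<k. A i j *\<^sub>R u j) = (\<Sum>j<k. (if j = i then u j else 0))"
      by (intro sum.cong) (auto simp: A_def)
    then show ?thesis using \<open>i < k\<close> by (simp add: A_def u_def perp_def)
  qed
  then have "gram_det v (Suc k) = (Determinant.det ?A)\<^sup>2 * gram_det u (Suc k)"
    by (rule gram_det_linear_comb)
  moreover have "Determinant.det ?A = 1"
  proof -
    have "upper_triangular ?A" by (auto simp: upper_triangular_def A_def)
    then have "Determinant.det ?A = prod_list (diag_mat ?A)"
      by (rule det_upper_triangular[where n = "Suc k"]) simp
    also have "diag_mat ?A = map (\<lambda>i. 1) [0..<Suc k]"
      unfolding diag_mat_def by (intro map_cong) (auto simp: A_def)
    also have "prod_list \<dots> = 1" by (induction k) auto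
    finally show ?thesis .
  qed
  moreover have "gram_det u (Suc k) = (u k \<bullet> u k) * gram_det u k"
    by (rule gram_det_Suc_orthogonal) (simp add: u_def)
  moreover have "gram_det u k = gram_det (\<lambda>i. perp (v k) (v i)) k"
    by (rule gram_det_cong) (simp add: u_def)
  ultimately show ?thesis by (simp add: u_def)
qed

lemma gram_det_0 [simp]: "gram_det v 0 = 1"
  by (simp add: gram_det_def)

lemma gram_det_nonneg: "0 \<le> gram_det v k"
  by (induction k arbitrary: v) (auto simp: gram_det_Suc)

text \<open>Hadamard's inequality; it holds because projections shorten vectors.\<close>

lemma gram_det_le: "gram_det v k \<le> (\<Prod>i<k. (norm (v i))\<^sup>2)"
proof (induction k arbitrary: v)
  case (Suc k)
  have "gram_det (\<lambda>i. perp (v k) (v i)) k \<le> (\<Prod>i<k. (norm (v i))\<^sup>2)"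
    by (rule order_trans[OF Suc.IH]) (auto intro!: prod_mono power_mono norm_perp_le)
  then show ?case
    by (simp add: gram_det_Suc mult.commute dot_square_norm mult_left_mono)
qed simp

text \<open>Families rather than sets: a repeated vector makes a family dependent but vanishes in
  its image, which is why \<open>inj_on\<close> appears in
  \<open>lin_indep_iff_independent\<close>.\<close>

definition lin_indep :: "(nat \<Rightarrow> 'a::real_vector) \<Rightarrow> nat \<Rightarrow> bool" where
  "lin_indep v k \<longleftrightarrow> (\<forall>c. (\<Sum>i<k. c i *\<^sub>R v i) = 0 \<longrightarrow> (\<forall>i<k. c i = 0))"

lemma lin_indepD: "lin_indep v k \<Longrightarrow> (\<Sum>i<k. c i *\<^sub>R v i) = 0 \<Longrightarrow> i < k \<Longrightarrow> c i = 0"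
  by (auto simp: lin_indep_def)

lemma lin_indep_unique:
  "lin_indep v k \<Longrightarrow> (\<Sum>i<k. c i *\<^sub>R v i) = (\<Sum>i<k. e i *\<^sub>R v i) \<Longrightarrow> i < k \<Longrightarrow> c i = e i"
  using lin_indepD[of v k "\<lambda>i. c i - e i" i] by (simp add: scaleR_diff_left sum_subtractf)

lemma lin_indep_perp:
  assumes "lin_indep v (Suc k)"
  shows "lin_indep (\<lambda>i. perp (v k) (v i)) k"
  unfolding lin_indep_def
proof (intro allI impI)
  fix c i assume c: "(\<Sum>i<k. c i *\<^sub>R perp (v k) (v i)) = 0" and i: "i < k"
  define t where "t = (\<Sum>i<k. c i * ((v i \<bullet> v k) / (v k \<bullet> v k)))"
  have "(\<Sum>i<k. c i *\<^sub>R v i) - t *\<^sub>R v k = 0"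
    using c by (simp add: perp_def scaleR_diff_right sum_subtractf t_def scaleR_sum_left)
  then have "(\<Sum>i<Suc k. (c(k := - t)) i *\<^sub>R v i) = 0"
    by simp
  then have "(c(k := - t)) i = 0"
    using assms i lin_indepD[of v "Suc k" _ i] by (metis less_Suc_eq)
  then show "c i = 0" using i by simp
qed

lemma lin_indep_nonzero:
  assumes "lin_indep v k" "i < k" shows "v i \<noteq> 0"
proof
  assume "v i = 0"
  then have "(\<Sum>j<k. (if j = i then 1 else 0) *\<^sub>R v j) = 0"
    by (intro sum.neutral) auto
  then show False using lin_indepD[OF assms(1) _ assms(2), of "\<lambda>j. if j = i then 1 else 0"] by simp
qed

lemma gram_det_pos: "lin_indep v k \<Longrightarrow> 0 < gram_det v k"
proof (induction k arbitrary: v)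
  case (Suc k)
  then show ?case
    using lin_indep_perp[OF Suc.prems] lin_indep_nonzero[OF Suc.prems, of k]
    by (simp add: gram_det_Suc)
qed simp

lemma lin_indep_iff_independent:
  "lin_indep v k \<longleftrightarrow> independent (v ` {..<k}) \<and> inj_on v {..<k}"
proof (intro iffI conjI)
  assume l: "lin_indep v k"
  show inj: "inj_on v {..<k}"
  proof (rule inj_onI, rule ccontr)
    fix i j assume ij: "i \<in> {..<k}" "j \<in> {..<k}" "v i = v j" "i \<noteq> j"
    have "(\<Sum>l<k. ((if l = i then 1 else 0) - (if l = j then 1 else 0)) *\<^sub>R v l) = 0"
      using ij by (simp add: scaleR_diff_left sum_subtractf if_distrib[where f = "\<lambda>x. x *\<^sub>R _"] cong: if_cong)
    from lin_indepD[OF l this, of i] ij show False by simp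
  qed
  show "independent (v ` {..<k})"
  proof (rule independent_if_scalars_zero)
    fix f x assume f: "(\<Sum>x\<in>v ` {..<k}. f x *\<^sub>R x) = 0" and x: "x \<in> v ` {..<k}"
    then have "(\<Sum>i<k. f (v i) *\<^sub>R v i) = 0"
      by (simp add: sum.reindex[OF inj])
    then show "f x = 0" using lin_indepD[OF l, of "\<lambda>i. f (v i)"] x by auto
  qed simp
next
  assume a: "independent (v ` {..<k}) \<and> inj_on v {..<k}"
  show "lin_indep v k"
    unfolding lin_indep_def
  proof (intro allI impI)
    fix c i assume c: "(\<Sum>i<k. c i *\<^sub>R v i) = 0" and i: "i < k"
    define f where "f x = c (the_inv_into {..<k} v x)" for x
    have "(\<Sum>x\<in>v ` {..<k}. f x *\<^sub>R x) = (\<Sum>i<k. c i *\<^sub>R v i)"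
      using a by (simp add: sum.reindex f_def the_inv_into_f_f)
    then have "f (v i) = 0"
      using independentD[of "v ` {..<k}" "v ` {..<k}" f "v i"] a c i by auto
    then show "c i = 0" using a i by (simp add: f_def the_inv_into_f_f)
  qed
qed

section \<open>Reduced lattice bases\<close>

definition zspan :: "(nat \<Rightarrow> 'a::real_vector) \<Rightarrow> nat \<Rightarrow> 'a set" where
  "zspan v k = {y. \<exists>c :: nat \<Rightarrow> int. y = (\<Sum>i<k. of_int (c i) *\<^sub>R v i)}"

lemma zspanI: "y = (\<Sum>i<k. of_int (c i) *\<^sub>R v i) \<Longrightarrow> y \<in> zspan v k"
  by (auto simp: zspan_def)

lemma zspanE:
  assumes "y \<in> zspan v k"
  obtains c :: "nat \<Rightarrow> int" where "y = (\<Sum>i<k. of_int (c i) *\<^sub>R v i)"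
  using assms by (auto simp: zspan_def)

lemma zspan_base:
  assumes "i < k" shows "v i \<in> zspan v k"
proof (rule zspanI[where c = "\<lambda>j. if j = i then 1 else 0"])
  show "v i = (\<Sum>j<k. of_int (if j = i then 1 else 0) *\<^sub>R v j)"
    using assms by (simp add: if_distrib[where f = "\<lambda>x. of_int x *\<^sub>R _"] cong: if_cong)
qed

lemma zspan_0: "0 \<in> zspan v k"
  by (rule zspanI[where c = "\<lambda>_. 0"]) simp

lemma zspan_add: "x \<in> zspan v k \<Longrightarrow> y \<in> zspan v k \<Longrightarrow> x + y \<in> zspan v k"
proof (elim zspanE)
  fix c e assume "x = (\<Sum>i<k. of_int (c i) *\<^sub>R v i)" "y = (\<Sum>i<k. of_int (e i) *\<^sub>R v i)"
  then show ?thesis by (intro zspanI[where c = "\<lambda>i. c i + e i"]) (simp add: scaleR_add_left sum.distrib)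
qed

lemma zspan_scale: "x \<in> zspan v k \<Longrightarrow> of_int m *\<^sub>R x \<in> zspan v k"
proof (elim zspanE)
  fix c assume "x = (\<Sum>i<k. of_int (c i) *\<^sub>R v i)"
  then show ?thesis by (intro zspanI[where c = "\<lambda>i. m * c i"]) (simp add: scaleR_sum_right)
qed

lemma zspan_diff: "x \<in> zspan v k \<Longrightarrow> y \<in> zspan v k \<Longrightarrow> x - y \<in> zspan v k"
  using zspan_add[of x v k "of_int (- 1) *\<^sub>R y"] zspan_scale[of y v k "- 1"] by simp

lemma zspan_sum: "(\<And>i. i \<in> I \<Longrightarrow> f i \<in> zspan v k) \<Longrightarrow> (\<Sum>i\<in>I. f i) \<in> zspan v k"
  by (induction I rule: infinite_finite_induct) (auto intro: zspan_0 zspan_add)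

lemma zspan_subset: "(\<And>i. i < l \<Longrightarrow> u i \<in> zspan v k) \<Longrightarrow> zspan u l \<subseteq> zspan v k"
  by (auto elim!: zspanE intro!: zspan_sum zspan_scale)

lemma zspan_subset_span: "zspan v k \<subseteq> span (v ` {..<k})"
  by (auto elim!: zspanE intro!: span_sum intro: span_scale span_base)

text \<open>The \<open>u i\<close> span a space of dimension at least \<open>k\<close>, and
  \<open>k\<close> vectors can do so only if they are distinct and independent.\<close>

lemma zspan_lin_indep:
  fixes u v :: "nat \<Rightarrow> 'a::euclidean_space"
  assumes v: "lin_indep v k" and eq: "zspan u k = zspan v k"
  shows "lin_indep u k"
proof -
  have "v ` {..<k} \<subseteq> span (u ` {..<k})"
    using zspan_base[of _ k v] eq zspan_subset_span[of u k] by auto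
  then have "dim (v ` {..<k}) \<le> dim (u ` {..<k})"
    by (metis dim_span dim_subset)
  moreover have "dim (v ` {..<k}) = k"
    using v by (simp add: lin_indep_iff_independent dim_eq_card_independent card_image)
  moreover have "dim (u ` {..<k}) \<le> card (u ` {..<k})" "card (u ` {..<k}) \<le> k"
    using dim_le_card'[of "u ` {..<k}"] card_image_le[of "{..<k}" u] by auto
  ultimately have c: "card (u ` {..<k}) = k" "dim (u ` {..<k}) = card (u ` {..<k})" by auto
  then have "independent (u ` {..<k})"
    by (intro card_le_dim_spanning[where V = "u ` {..<k}"]) (auto intro: span_base)
  moreover have "inj_on u {..<k}" using c by (intro eq_card_imp_inj_on) auto
  ultimately show ?thesis by (simp add: lin_indep_iff_independent)
qed

text \<open>The two transition matrices are integral and inverse to each other, so their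
  determinants are 1 or -1. This makes the height independent of the lattice basis.\<close>

lemma gram_det_zspan:
  fixes u v :: "nat \<Rightarrow> 'a::real_inner"
  assumes v: "lin_indep v k" and eq: "zspan u k = zspan v k"
  shows "gram_det u k = gram_det v k"
proof -
  have "\<exists>c :: nat \<Rightarrow> int. u i = (\<Sum>j<k. of_int (c j) *\<^sub>R v j)" if "i < k" for i
    using zspan_base[OF that, of u] eq by (auto elim: zspanE)
  then obtain A :: "nat \<Rightarrow> nat \<Rightarrow> int" where A: "\<And>i. i < k \<Longrightarrow> u i = (\<Sum>j<k. of_int (A i j) *\<^sub>R v j)"
    by metis
  have "\<exists>c :: nat \<Rightarrow> int. v i = (\<Sum>j<k. of_int (c j) *\<^sub>R u j)" if "i < k" for i
    using zspan_base[OF that, of v] eq by (auto elim: zspanE)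
  then obtain B :: "nat \<Rightarrow> nat \<Rightarrow> int" where B: "\<And>i. i < k \<Longrightarrow> v i = (\<Sum>j<k. of_int (B i j) *\<^sub>R u j)"
    by metis
  let ?A = "mat k k (\<lambda>(i, j). A i j)" and ?B = "mat k k (\<lambda>(i, j). B i j)"
  have BA: "(\<Sum>j<k. B i j * A j l) = (if i = l then 1 else 0)" if il: "i < k" "l < k" for i l
  proof -
    have "(\<Sum>l<k. of_int (if i = l then 1 else 0) *\<^sub>R v l) = v i"
      using il by (simp add: if_distrib[where f = "\<lambda>x. of_int x *\<^sub>R _"] cong: if_cong)
    also have "v i = (\<Sum>j<k. of_int (B i j) *\<^sub>R (\<Sum>l<k. of_int (A j l) *\<^sub>R v l))"
      using B[OF il(1)] A by simp
    also have "\<dots> = (\<Sum>j<k. \<Sum>l<k. (of_int (B i j) * of_int (A j l)) *\<^sub>R v l)"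
      by (simp add: scaleR_sum_right)
    also have "\<dots> = (\<Sum>l<k. \<Sum>j<k. (of_int (B i j) * of_int (A j l)) *\<^sub>R v l)"
      by (rule sum.swap)
    also have "\<dots> = (\<Sum>l<k. of_int (\<Sum>j<k. B i j * A j l) *\<^sub>R v l)"
      by (simp add: scaleR_sum_left)
    finally have "real_of_int (if i = l then 1 else 0) = of_int (\<Sum>j<k. B i j * A j l)"
      by (rule lin_indep_unique[OF v _ il(2)])
    then show ?thesis by (simp only: of_int_eq_iff)
  qed
  have "?B * ?A = 1\<^sub>m k"
    by (rule eq_matI) (auto simp: scalar_prod_def BA atLeast0LessThan)
  then have "Determinant.det ?B * Determinant.det ?A = 1"
    by (metis Determinant.det_mult Determinant.det_one mat_carrier)
  then have "Determinant.det ?A = 1 \<or> Determinant.det ?A = - 1"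
    by (metis zmult_eq_1_iff mult.commute)
  then have d: "(of_int (Determinant.det ?A) :: real)\<^sup>2 = 1" by auto
  have "mat k k (\<lambda>(i, j). of_int (A i j)) = map_mat (of_int :: int \<Rightarrow> real) ?A"
    by (rule eq_matI) auto
  then have "Determinant.det (mat k k (\<lambda>(i, j). of_int (A i j) :: real)) = of_int (Determinant.det ?A)"
    by simp
  then show ?thesis
    using gram_det_linear_comb[of k u "\<lambda>i j. of_int (A i j)" v, OF A] d by simp
qed

text \<open>The coordinate functionals of the basis are bounded and integral on the lattice, and one
  of them is nonzero at any given nonzero lattice vector.\<close>

lemma zspan_discrete:
  fixes v :: "nat \<Rightarrow> 'a::euclidean_space"
  assumes v: "lin_indep v k"
  obtains \<delta> where "\<delta> > 0" "\<And>y. y \<in> zspan v k \<Longrightarrow> y \<noteq> 0 \<Longrightarrow> \<delta> \<le> norm y"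
proof -
  have ind: "independent (v ` {..<k})" and inj: "inj_on v {..<k}"
    using v by (auto simp: lin_indep_iff_independent)
  have "\<exists>f K. linear f \<and> K > 0 \<and> (\<forall>x. \<bar>f x\<bar> \<le> K * norm x) \<and> (\<forall>j<k. f (v j) = (if j = i then 1 else 0 :: real))"
    if "i < k" for i
  proof -
    obtain f :: "'a \<Rightarrow> real" where f: "linear f" "\<And>x. x \<in> v ` {..<k} \<Longrightarrow> f x = (if x = v i then 1 else 0)"
      using linear_independent_extend[OF ind, of "\<lambda>x. if x = v i then 1 else 0"] by auto
    obtain K where "K > 0" "\<And>x. norm (f x) \<le> K * norm x"
      using linear_bounded_pos[OF f(1)] by blast
    then show ?thesis using f that inj by (intro exI[of _ f] exI[of _ K]) (auto simp: inj_on_eq_iff)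
  qed
  then obtain f K where fK: "\<And>i. i < k \<Longrightarrow> linear (f i)" "\<And>i. i < k \<Longrightarrow> K i > 0"
    "\<And>i x. i < k \<Longrightarrow> \<bar>f i x\<bar> \<le> K i * norm x"
    "\<And>i j. i < k \<Longrightarrow> j < k \<Longrightarrow> f i (v j) = (if j = i then 1 else 0 :: real)"
    by metis
  define M where "M = (\<Sum>i<k. K i) + 1"
  have Kpos: "(\<Sum>i<k. K i) \<ge> 0" using fK(2) by (intro sum_nonneg) (auto intro: less_imp_le)
  show thesis
  proof (rule that[of "1 / M"])
    show "1 / M > 0" using Kpos by (simp add: M_def)
    fix y assume "y \<in> zspan v k" "y \<noteq> 0"
    then obtain c :: "nat \<Rightarrow> int" where c: "y = (\<Sum>i<k. of_int (c i) *\<^sub>R v i)" by (auto elim: zspanE)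
    with \<open>y \<noteq> 0\<close> obtain i where i: "i < k" "c i \<noteq> 0"
      by (metis (no_types, lifting) lessThan_iff of_int_0 scaleR_zero_left sum.neutral)
    have "f i y = (\<Sum>j<k. of_int (c j) * f i (v j))"
      using fK(1)[OF i(1)] by (simp add: c linear_sum linear_scale)
    also have "\<dots> = (\<Sum>j<k. if j = i then of_int (c j) else 0)"
      using fK(4)[OF i(1)] by (intro sum.cong) auto
    also have "\<dots> = of_int (c i)" using i by simp
    finally have "1 \<le> \<bar>f i y\<bar>" using i(2) by simp
    also have "\<dots> \<le> K i * norm y" using fK(3) i by blast
    also have "\<dots> \<le> M * norm y"
    proof (rule mult_right_mono)
      have "K i \<le> (\<Sum>i<k. K i)"
        using i(1) fK(2) by (intro member_le_sum) (auto intro: less_imp_le)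
      then show "K i \<le> M" by (simp add: M_def)
    qed simp
    finally show "1 / M \<le> norm y" using Kpos by (simp add: M_def field_simps)
  qed
qed

lemma zspan_transpose:
  assumes "i < k" "j < k"
  shows "zspan (u \<circ> Transposition.transpose i j) k = zspan u k"
proof -
  have le: "zspan (u \<circ> Transposition.transpose i j) k \<subseteq> zspan u k" for u :: "nat \<Rightarrow> 'a"
    using assms by (intro zspan_subset) (auto simp: Transposition.transpose_def intro!: zspan_base)
  have "(u \<circ> Transposition.transpose i j) \<circ> Transposition.transpose i j = u"
    by (simp add: fun_eq_iff)
  with le[of u] le[of "u \<circ> Transposition.transpose i j"] show ?thesis by simp
qed

text \<open>A basis whose last vector is nearly as short as possible is reduced by projecting along that
  vector, reducing the projection and lifting back with rounding.\<close>
lemma reduced_basis: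
  "\<exists>C>0. \<forall>v :: nat \<Rightarrow> 'a::euclidean_space. lin_indep v k \<longrightarrow>
     (\<exists>u. lin_indep u k \<and> zspan u k = zspan v k \<and> (\<Prod>i<k. (norm (u i))\<^sup>2) \<le> C * gram_det v k)"
proof (induction k)
  case 0
  show ?case by (intro exI[of _ 1]) auto
next
  case (Suc k)
  then obtain C where C: "C > 0" and IH: "\<And>v :: nat \<Rightarrow> 'a. lin_indep v k \<Longrightarrow>
     \<exists>u. lin_indep u k \<and> zspan u k = zspan v k \<and> (\<Prod>i<k. (norm (u i))\<^sup>2) \<le> C * gram_det v k"
    by blast
  show ?case
  proof (intro exI[of _ "2 ^ k * C"] conjI allI impI)
    show "0 < 2 ^ k * C" using C by simp
    fix v :: "nat \<Rightarrow> 'a" assume v: "lin_indep v (Suc k)"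
    define N where "N = {norm (u k) | u. zspan u (Suc k) = zspan v (Suc k)}"
    have vN: "norm (v k) \<in> N" by (auto simp: N_def)
    obtain \<delta> where \<delta>: "\<delta> > 0" "\<And>y. y \<in> zspan v (Suc k) \<Longrightarrow> y \<noteq> 0 \<Longrightarrow> \<delta> \<le> norm y"
      using zspan_discrete[OF v] by metis
    have \<delta>N: "\<delta> \<le> x" if "x \<in> N" for x
    proof -
      from that obtain u where u: "x = norm (u k)" "zspan u (Suc k) = zspan v (Suc k)" by (auto simp: N_def)
      then have "u k \<noteq> 0" using lin_indep_nonzero[OF zspan_lin_indep[OF v u(2)], of k] by simp
      then show ?thesis using \<delta>(2)[of "u k"] zspan_base[of k "Suc k" u] u by simp
    qed
    then have Inf_le: "Inf N \<le> x" if "x \<in> N" for x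
      by (intro cInf_lower that bdd_belowI[of _ \<delta>])
    have "\<delta> \<le> Inf N" using vN \<delta>N by (intro cInf_greatest) auto
    with \<delta>(1) have "0 < Inf N" by simp
    \<comment> \<open>A last vector within the factor \<open>sqrt 2\<close> of the infimum suffices:
      the square 2 times the squared rounding error \<open>1 / 4\<close> leaves
      \<open>1 / 2\<close>, which \<open>bound\<close> absorbs.\<close>
    then have "Inf N < sqrt 2 * Inf N" by simp
    then obtain x where "x \<in> N" "x < sqrt 2 * Inf N"
      using cInf_lessD[of N] vN by blast
    then obtain u where u: "zspan u (Suc k) = zspan v (Suc k)" "norm (u k) < sqrt 2 * Inf N"
      by (auto simp: N_def)
    define b where "b = u k"
    have short: "(norm b)\<^sup>2 \<le> 2 * (norm (u' k))\<^sup>2" if "zspan u' (Suc k) = zspan v (Suc k)" for u'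
    proof -
      have "norm b \<le> sqrt 2 * norm (u' k)"
        using u(2) Inf_le[of "norm (u' k)"] that unfolding b_def N_def
        by (smt (verit, ccfv_SIG) mem_Collect_eq mult_left_mono real_sqrt_ge_0_iff)
      then have "(norm b)\<^sup>2 \<le> (sqrt 2 * norm (u' k))\<^sup>2" by (intro power_mono) auto
      then show ?thesis by (simp add: power_mult_distrib)
    qed
    have ul: "lin_indep u (Suc k)" by (rule zspan_lin_indep[OF v u(1)])
    then have b0: "b \<noteq> 0" using lin_indep_nonzero[of u "Suc k" k] by (simp add: b_def)
    obtain w' where w': "lin_indep w' k" "zspan w' k = zspan (\<lambda>i. perp b (u i)) k"
      "(\<Prod>i<k. (norm (w' i))\<^sup>2) \<le> C * gram_det (\<lambda>i. perp b (u i)) k"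
      using IH[OF lin_indep_perp[OF ul]] by (auto simp: b_def)
    have "\<exists>c :: nat \<Rightarrow> int. w' i = (\<Sum>j<k. of_int (c j) *\<^sub>R perp b (u j))" if "i < k" for i
      using zspan_base[OF that, of w'] w'(2) by (auto elim: zspanE)
    then obtain A :: "nat \<Rightarrow> nat \<Rightarrow> int" where A: "\<And>i. i < k \<Longrightarrow> w' i = (\<Sum>j<k. of_int (A i j) *\<^sub>R perp b (u j))"
      by metis
    define x where "x i = (\<Sum>j<k. of_int (A i j) *\<^sub>R u j)" for i
    \<comment> \<open>The lift \<open>x i\<close> of \<open>w' i\<close> may be shifted by integer
      multiples of \<open>b\<close>; rounding leaves a component along \<open>b\<close> of at most
      half the length of \<open>b\<close>.\<close>
    define w where "w i = (if i < k then x i - of_int (round ((x i \<bullet> b) / (b \<bullet> b))) *\<^sub>R b else b)" for i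
    have px: "perp b (x i) = w' i" if "i < k" for i
      using A[OF that] by (simp add: x_def linear_sum[OF linear_perp] perp_scale)
    have pb: "perp b b = 0" using b0 by (simp add: perp_def)
    have pw: "perp b (w i) = w' i" if "i < k" for i
      using that px[OF that] pb by (simp add: w_def linear_diff[OF linear_perp] perp_scale)
    have wu: "w i \<in> zspan u (Suc k)" if "i < Suc k" for i
      using that unfolding w_def x_def b_def
      by (auto intro!: zspan_diff zspan_sum zspan_scale zspan_base)
    have uw: "u j \<in> zspan w (Suc k)" if j: "j < Suc k" for j
    proof (cases "j = k")
      case True
      then show ?thesis using zspan_base[of k "Suc k" w] by (simp add: w_def b_def)
    next
      case False
      with j have j: "j < k" by simp
      have "perp b (u j) \<in> zspan w' k" using zspan_base[OF j, of "\<lambda>i. perp b (u i)"] w'(2) by simp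
      then obtain B :: "nat \<Rightarrow> int" where B: "perp b (u j) = (\<Sum>i<k. of_int (B i) *\<^sub>R w' i)"
        by (auto elim: zspanE)
      define y where "y = u j - (\<Sum>i<k. of_int (B i) *\<^sub>R w i)"
      have "perp b y = 0"
        by (simp add: y_def linear_diff[OF linear_perp] linear_sum[OF linear_perp] perp_scale B pw)
      then have y: "y = ((y \<bullet> b) / (b \<bullet> b)) *\<^sub>R b" by (simp add: perp_def)
      have "y \<in> zspan u (Suc k)"
        using j unfolding y_def by (intro zspan_diff zspan_sum zspan_scale wu zspan_base) auto
      then obtain e :: "nat \<Rightarrow> int" where e: "y = (\<Sum>l<Suc k. of_int (e l) *\<^sub>R u l)" by (auto elim: zspanE)
      define \<tau> where "\<tau> = (y \<bullet> b) / (b \<bullet> b)"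
      \<comment> \<open>\<open>y\<close> is a lattice vector parallel to \<open>b = u k\<close>, so
        comparing coefficients shows that the real factor \<open>\<tau>\<close> is an
        integer.\<close>
      have "(\<Sum>l<Suc k. of_int (e l) *\<^sub>R u l) = (\<Sum>l<Suc k. (if l = k then \<tau> else 0) *\<^sub>R u l)"
        unfolding e[symmetric] using y unfolding \<tau>_def[symmetric] by (simp add: b_def)
      from lin_indep_unique[OF ul this, of k] have "y = of_int (e k) *\<^sub>R b"
        using y by (simp add: \<tau>_def)
      then have "y \<in> zspan w (Suc k)"
        using zspan_scale[OF zspan_base[of k "Suc k" w], of "e k"] by (simp add: w_def)
      moreover have "(\<Sum>i<k. of_int (B i) *\<^sub>R w i) \<in> zspan w (Suc k)"
        by (intro zspan_sum zspan_scale zspan_base) auto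
      ultimately have "y + (\<Sum>i<k. of_int (B i) *\<^sub>R w i) \<in> zspan w (Suc k)" by (rule zspan_add)
      then show ?thesis by (simp add: y_def)
    qed
    have eq: "zspan w (Suc k) = zspan v (Suc k)"
      using zspan_subset[of "Suc k" w u "Suc k", OF wu] zspan_subset[of "Suc k" u w "Suc k", OF uw] u(1) by simp
    have bound: "(norm (w i))\<^sup>2 \<le> 2 * (norm (w' i))\<^sup>2" if i: "i < k" for i
    proof -
      \<comment> \<open>Moving \<open>w i\<close> to the last position gives another basis of the
        same lattice, so \<open>w i\<close> competes with \<open>b\<close> and cannot be much
        shorter.\<close>
      have "(norm b)\<^sup>2 \<le> 2 * (norm ((w \<circ> Transposition.transpose i k) k))\<^sup>2"
        using i eq zspan_transpose[of i "Suc k" k w]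
        by (intro short[of "w \<circ> Transposition.transpose i k"]) simp
      then have bw: "(norm b)\<^sup>2 \<le> 2 * (norm (w i))\<^sup>2" by simp
      define t where "t = (x i \<bullet> b) / (b \<bullet> b) - of_int (round ((x i \<bullet> b) / (b \<bullet> b)))"
      have t: "\<bar>t\<bar> \<le> 1 / 2" unfolding t_def
        using of_int_round_abs_le[of "(x i \<bullet> b) / (b \<bullet> b)"] by (simp add: abs_minus_commute)
      have "w i = w' i + t *\<^sub>R b"
        using i px[OF i] by (simp add: w_def t_def perp_def algebra_simps)
      moreover have "w' i \<bullet> b = 0" "b \<bullet> w' i = 0" using px[OF i] perp_inner by metis+
      ultimately have "(norm (w i))\<^sup>2 = (norm (w' i))\<^sup>2 + t\<^sup>2 * (norm b)\<^sup>2"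
        unfolding power2_norm_eq_inner by (simp add: inner_add_left inner_add_right power2_eq_square)
      moreover have "t\<^sup>2 \<le> (1/2)\<^sup>2" using t by (metis abs_le_square_iff abs_of_nonneg zero_le_divide_1_iff zero_le_numeral)
      then have "t\<^sup>2 * (norm b)\<^sup>2 \<le> (1/4) * (norm b)\<^sup>2" by (intro mult_right_mono) (auto simp: power2_eq_square)
      ultimately show ?thesis using bw by simp
    qed
    have "(\<Prod>i<Suc k. (norm (w i))\<^sup>2) = (\<Prod>i<k. (norm (w i))\<^sup>2) * (norm b)\<^sup>2"
      by (simp add: w_def)
    also have "\<dots> \<le> (\<Prod>i<k. 2 * (norm (w' i))\<^sup>2) * (norm b)\<^sup>2"
      using bound by (intro mult_right_mono prod_mono) auto
    also have "\<dots> = 2 ^ k * (norm b)\<^sup>2 * (\<Prod>i<k. (norm (w' i))\<^sup>2)" by (simp add: prod.distrib)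
    also have "\<dots> \<le> 2 ^ k * (norm b)\<^sup>2 * (C * gram_det (\<lambda>i. perp b (u i)) k)"
      using w'(3) by (intro mult_left_mono) auto
    also have "\<dots> = 2 ^ k * C * gram_det u (Suc k)"
      by (simp add: gram_det_Suc b_def dot_square_norm)
    also have "gram_det u (Suc k) = gram_det v (Suc k)" by (rule gram_det_zspan[OF v u(1)])
    finally have "(\<Prod>i<Suc k. (norm (w i))\<^sup>2) \<le> 2 ^ k * C * gram_det v (Suc k)" .
    then show "\<exists>w. lin_indep w (Suc k) \<and> zspan w (Suc k) = zspan v (Suc k)
        \<and> (\<Prod>i<Suc k. (norm (w i))\<^sup>2) \<le> 2 ^ k * C * gram_det v (Suc k)"
      using eq zspan_lin_indep[OF v eq] by blast
  qed
qed

section \<open>Null sets for Hausdorff measures\<close>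

text \<open>The diameters are not restricted: for \<open>s > 0\<close> a small total cost already
  makes every set of the cover small. Hence arbitrarily cheap covers amount to Hausdorff measure
  0.\<close>

definition hcover :: "real \<Rightarrow> 'a::metric_space set \<Rightarrow> real \<Rightarrow> bool" where
  "hcover s A c \<longleftrightarrow> (\<exists>U :: nat \<Rightarrow> 'a set. A \<subseteq> (\<Union>i. U i) \<and> (\<forall>i. bounded (U i)) \<and>
     (\<Sum>i. ennreal (diam_pow s (U i))) \<le> ennreal c)"

definition hnull :: "real \<Rightarrow> 'a::metric_space set \<Rightarrow> bool" where
  "hnull s A \<longleftrightarrow> (\<forall>c>0. hcover s A c)"

lemma diam_pow_nonneg: "0 \<le> diam_pow s U"
  by (simp add: diam_pow_def)

lemma diam_pow_pos: "0 < s \<Longrightarrow> diam_pow s U = diameter U powr s"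
  by (simp add: diam_pow_def)

lemma hcover_subset: "hcover s B c \<Longrightarrow> A \<subseteq> B \<Longrightarrow> hcover s A c"
  unfolding hcover_def by blast

lemma hnull_subset: "hnull s B \<Longrightarrow> A \<subseteq> B \<Longrightarrow> hnull s A"
  unfolding hnull_def using hcover_subset by blast

text \<open>For diameters at most 1 a larger exponent lowers the cost. At \<open>t = 0\<close> a
  nonempty set costs 1, so a total cost below 1 leaves only empty sets.\<close>

lemma hausdorff_measure_0_imp_hnull:
  assumes "hausdorff_measure t A = 0" "0 \<le> t" "t \<le> s" "0 < s"
  shows "hnull s A"
  unfolding hnull_def
proof (intro allI impI)
  fix c :: real assume c: "c > 0"
  have "hausdorff_content t 1 A = 0"
    using assms(1) SUP_upper[of 1 "{0<..}" "\<lambda>\<delta>. hausdorff_content t \<delta> A"]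
    unfolding hausdorff_measure_def by simp
  also have "0 < ennreal (min c (1/2))" using c by simp
  finally obtain U :: "nat \<Rightarrow> 'a set" where U: "A \<subseteq> (\<Union>i. U i)" "\<forall>i. bounded (U i) \<and> diameter (U i) \<le> 1"
    "(\<Sum>i. ennreal (diam_pow t (U i))) < ennreal (min c (1/2))"
    unfolding hausdorff_content_def Inf_less_iff by auto
  have small: "diam_pow t (U i) < 1" for i
  proof -
    have "ennreal (diam_pow t (U i)) \<le> (\<Sum>i. ennreal (diam_pow t (U i)))"
      using sum_le_suminf[of "\<lambda>i. ennreal (diam_pow t (U i))" "{i}"] by simp
    also have "\<dots> < ennreal 1" using U(3) by (rule order_less_le_trans) (intro ennreal_leI, simp)
    finally show ?thesis by (simp add: ennreal_less_iff diam_pow_nonneg)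
  qed
  have "diam_pow s (U i) \<le> diam_pow t (U i)" for i
  proof (cases "U i = {}")
    case False
    then have "t \<noteq> 0" using small[of i] by (auto simp: diam_pow_def)
    with assms have t: "t > 0" by simp
    have "diameter (U i) powr s \<le> diameter (U i) powr t"
    proof (cases "diameter (U i) = 0")
      case False
      then have "0 < diameter (U i)" using U(2) diameter_ge_0[of "U i"] by auto
      then show ?thesis using U(2) assms(3) by (intro powr_mono') auto
    qed simp
    then show ?thesis using t assms by (simp add: diam_pow_pos)
  qed (simp add: diam_pow_def)
  then have "(\<Sum>i. ennreal (diam_pow s (U i))) \<le> (\<Sum>i. ennreal (diam_pow t (U i)))"
    by (intro suminf_le) (auto intro: ennreal_leI)
  also have "\<dots> \<le> ennreal c" using U(3) by (intro less_imp_le) (rule order_less_le_trans, assumption, intro ennreal_leI, simp)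
  finally show "hcover s A c" unfolding hcover_def using U by blast
qed

lemma hnull_imp_hausdorff_measure_0:
  assumes "0 < s" "hnull s A"
  shows "hausdorff_measure s A = 0"
proof -
  have le: "hausdorff_content s \<delta> A \<le> ennreal e" if \<delta>: "\<delta> > 0" and e: "0 < e" for \<delta> e
  proof -
    \<comment> \<open>The second bound limits the cost of each single set to
      \<open>\<delta> powr s\<close>, which forces its diameter to be at most
      \<open>\<delta>\<close>.\<close>
    define c where "c = min e (\<delta> powr s)"
    have "c > 0" using e \<delta> by (simp add: c_def)
    then obtain U :: "nat \<Rightarrow> 'a set" where U: "A \<subseteq> (\<Union>i. U i)" "\<forall>i. bounded (U i)"
      "(\<Sum>i. ennreal (diam_pow s (U i))) \<le> ennreal c"
      using assms(2) unfolding hnull_def hcover_def by blast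
    have "diameter (U i) \<le> \<delta>" for i
    proof -
      have "ennreal (diam_pow s (U i)) \<le> (\<Sum>i. ennreal (diam_pow s (U i)))"
        using sum_le_suminf[of "\<lambda>i. ennreal (diam_pow s (U i))" "{i}"] by simp
      also have "\<dots> \<le> ennreal (\<delta> powr s)" using U(3) by (rule order_trans) (intro ennreal_leI, simp add: c_def)
      finally have "diameter (U i) powr s \<le> \<delta> powr s" using assms by (simp add: diam_pow_pos)
      moreover have "\<delta> powr s < diameter (U i) powr s" if "\<delta> < diameter (U i)"
        using that assms \<delta> by (intro powr_less_mono2) auto
      ultimately show ?thesis by linarith
    qed
    then have "hausdorff_content s \<delta> A \<le> (\<Sum>i. ennreal (diam_pow s (U i)))"
      unfolding hausdorff_content_def using U by (intro Inf_lower) blast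
    also have "\<dots> \<le> ennreal e" using U(3) by (rule order_trans) (intro ennreal_leI, simp add: c_def)
    finally show ?thesis .
  qed
  have "hausdorff_content s \<delta> A \<le> 0" if "\<delta> > 0" for \<delta>
    by (rule ennreal_le_epsilon) (use le[OF that] in simp)
  then show ?thesis unfolding hausdorff_measure_def by (auto intro!: antisym SUP_least)
qed

lemma hausdorff_dim_le:
  assumes "0 \<le> s" "\<And>t. s < t \<Longrightarrow> hnull t A"
  shows "hausdorff_dim A \<le> ereal s"
proof (rule ereal_le_epsilon2)
  fix e :: real assume "0 < e"
  then have "hausdorff_measure (s + e) A = 0"
    using assms by (intro hnull_imp_hausdorff_measure_0) auto
  then show "hausdorff_dim A \<le> ereal s + ereal e"
    unfolding hausdorff_dim_def using assms \<open>0 < e\<close> by (auto intro!: Inf_lower)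
qed

lemma hausdorff_dim_ge:
  assumes "0 < s" "\<not> hnull s A"
  shows "ereal s \<le> hausdorff_dim A"
  unfolding hausdorff_dim_def
proof (rule Inf_greatest, clarify)
  fix t :: real assume "0 \<le> t" "hausdorff_measure t A = 0"
  then show "ereal s \<le> ereal t"
    using hausdorff_measure_0_imp_hnull[of t A s] assms by (cases "t \<le> s") auto
qed

lemma hausdorff_dim_nonneg: "0 \<le> hausdorff_dim A"
  unfolding hausdorff_dim_def by (auto intro!: Inf_greatest)

lemma hausdorff_dim_mono:
  assumes "A \<subseteq> B" shows "hausdorff_dim A \<le> hausdorff_dim B"
proof -
  have "hausdorff_content s \<delta> A \<le> hausdorff_content s \<delta> B" for s \<delta>
    unfolding hausdorff_content_def using assms by (intro Inf_superset_mono) blast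
  then have le: "hausdorff_measure s A \<le> hausdorff_measure s B" for s
    unfolding hausdorff_measure_def by (intro SUP_mono) auto
  have "hausdorff_measure s B = 0 \<Longrightarrow> hausdorff_measure s A = 0" for s
    using le[of s] by simp
  then show ?thesis unfolding hausdorff_dim_def by (intro Inf_superset_mono) auto
qed

lemma hcover_UN:
  fixes A :: "nat \<Rightarrow> 'a::metric_space set"
  assumes "\<And>i. hcover s (A i) (c i)" "\<And>i. 0 \<le> c i" "\<And>n. (\<Sum>i<n. c i) \<le> M"
  shows "hcover s (\<Union>i. A i) M"
proof -
  obtain U :: "nat \<Rightarrow> nat \<Rightarrow> 'a set" where U: "\<And>i. A i \<subseteq> (\<Union>j. U i j)" "\<And>i j. bounded (U i j)"
      "\<And>i. (\<Sum>j. ennreal (diam_pow s (U i j))) \<le> ennreal (c i)"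
    using assms(1) unfolding hcover_def by metis
  define V where "V n = (case prod_decode n of (i, j) \<Rightarrow> U i j)" for n
  have "(\<Union>i. A i) \<subseteq> (\<Union>n. V n)"
  proof
    fix x assume "x \<in> (\<Union>i. A i)"
    then obtain i j where "x \<in> U i j" using U(1) by blast
    then have "x \<in> V (prod_encode (i, j))" by (simp add: V_def)
    then show "x \<in> (\<Union>n. V n)" by blast
  qed
  moreover have "bounded (V n)" for n using U(2) by (simp add: V_def split: prod.split)
  moreover have "(\<Sum>n. ennreal (diam_pow s (V n))) \<le> ennreal M"
  proof -
    have "(\<Sum>n. ennreal (diam_pow s (V n))) = (\<Sum>n. (\<lambda>(i, j). ennreal (diam_pow s (U i j))) (prod_decode n))"
      by (simp add: V_def case_prod_unfold)
    also have "\<dots> = (\<Sum>i. \<Sum>j. ennreal (diam_pow s (U i j)))"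
      by (rule suminf_ennreal_2dimen) simp
    also have "\<dots> \<le> (\<Sum>i. ennreal (c i))" using U(3) by (intro suminf_le) auto
    also have "\<dots> \<le> ennreal M"
      using assms(2,3) by (intro suminf_le_const) (auto simp: sum_ennreal intro: ennreal_leI)
    finally show ?thesis .
  qed
  ultimately show ?thesis unfolding hcover_def by blast
qed

lemma hnull_UN:
  fixes A :: "nat \<Rightarrow> 'a::metric_space set"
  assumes "\<And>i. hnull s (A i)"
  shows "hnull s (\<Union>i. A i)"
  unfolding hnull_def
proof (intro allI impI)
  fix c :: real assume c: "c > 0"
  show "hcover s (\<Union>i. A i) c"
  proof (rule hcover_UN[where c = "\<lambda>i. c * (1/2) ^ Suc i"])
    show "(\<Sum>i<n. c * (1/2) ^ Suc i) \<le> c" for n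
    proof -
      have "(\<Sum>i<n. c * (1/2) ^ Suc i) = c * (1 - (1/2) ^ n)"
        by (induction n) (auto simp: algebra_simps)
      then show ?thesis using c by (simp add: mult_left_le)
    qed
  qed (use assms c in \<open>auto simp: hnull_def\<close>)
qed

lemma hnull_Un: "hnull s A \<Longrightarrow> hnull s B \<Longrightarrow> hnull s (A \<union> B)"
  using hnull_UN[of s "\<lambda>i. if i = 0 then A else B"]
  by (rule hnull_subset) (auto split: if_splits)

lemma hcover_finite:
  assumes "finite \<C>" "A \<subseteq> \<Union>\<C>" "\<And>U. U \<in> \<C> \<Longrightarrow> bounded U \<and> diameter U \<le> r" "0 < s"
  shows "hcover s A (card \<C> * r powr s)"
proof (cases "\<C> = {}")
  case True
  then show ?thesis using assms
    unfolding hcover_def by (intro exI[of _ "\<lambda>_. {}"]) (auto simp: diam_pow_def)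
next
  case False
  have r0: "r \<ge> 0" using False assms(3) diameter_ge_0 by (metis ex_in_conv order_trans)
  obtain e where e: "bij_betw e {..<card \<C>} \<C>"
    using ex_bij_betw_nat_finite[OF assms(1)] by (auto simp: atLeast0LessThan)
  define U where "U i = (if i < card \<C> then e i else {})" for i
  have U: "bounded (U i)" for i using e assms(3) by (auto simp: U_def bij_betw_def)
  have "A \<subseteq> (\<Union>i. U i)"
  proof
    fix x assume "x \<in> A"
    then obtain V where V: "V \<in> \<C>" "x \<in> V" using assms(2) by blast
    then obtain i where "i < card \<C>" "e i = V" using e by (metis bij_betw_def imageE lessThan_iff)
    then have "x \<in> U i" using V by (simp add: U_def)
    then show "x \<in> (\<Union>i. U i)" by blast
  qed
  moreover have "(\<Sum>i. ennreal (diam_pow s (U i))) \<le> ennreal (card \<C> * r powr s)"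
  proof -
    have "(\<Sum>i. ennreal (diam_pow s (U i))) = (\<Sum>i<card \<C>. ennreal (diam_pow s (U i)))"
      by (rule suminf_finite) (auto simp: U_def diam_pow_def)
    also have "\<dots> \<le> (\<Sum>i<card \<C>. ennreal (r powr s))"
    proof (rule sum_mono, rule ennreal_leI)
      fix i assume "i \<in> {..<card \<C>}"
      then have "U i \<in> \<C>" using e by (auto simp: U_def bij_betw_def)
      then show "diam_pow s (U i) \<le> r powr s"
        using assms(3,4) diameter_ge_0[OF U] by (simp add: diam_pow_pos powr_mono2)
    qed
    also have "\<dots> = ennreal (card \<C> * r powr s)"
      by (simp add: ennreal_mult ennreal_of_nat_eq_real_of_nat)
    finally show ?thesis .
  qed
  ultimately show ?thesis using U unfolding hcover_def by blast
qed

text \<open>Hausdorff-Cantelli lemma: a point in infinitely many \<open>N i\<close> lies in one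
  whose index avoids any given finite set, so the tails of the series bound the cost. The index set
  is left general because integer tuples will serve as indices.\<close>

lemma hnull_limsup:
  fixes N :: "'i \<Rightarrow> 'a::metric_space set"
  assumes I: "countable I" and cov: "\<And>i. i \<in> I \<Longrightarrow> hcover s (N i) (c i)" and c0: "\<And>i. i \<in> I \<Longrightarrow> 0 \<le> c i"
    and summ: "c summable_on I"
    and A: "\<And>x. x \<in> A \<Longrightarrow> infinite {i \<in> I. x \<in> N i}"
  shows "hnull s A"
  unfolding hnull_def
proof (intro allI impI)
  fix \<epsilon> :: real assume "\<epsilon> > 0"
  obtain S where "(c has_sum S) I" using summ by (auto simp: summable_on_def)
  then obtain F where F: "finite F" "F \<subseteq> I" "\<And>G. finite G \<Longrightarrow> F \<subseteq> G \<Longrightarrow> G \<subseteq> I \<Longrightarrow> dist (sum c G) S < \<epsilon> / 2"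
    unfolding has_sum_def using \<open>\<epsilon> > 0\<close> tendstoD[of "sum c" S "finite_subsets_at_top I" "\<epsilon> / 2"]
    by (auto simp: eventually_finite_subsets_at_top)
  have tail: "sum c G \<le> \<epsilon>" if "finite G" "G \<subseteq> I - F" for G
  proof -
    have "sum c (F \<union> G) = sum c F + sum c G"
      using that F by (intro sum.union_disjoint) auto
    moreover have "dist (sum c (F \<union> G)) S < \<epsilon> / 2" "dist (sum c F) S < \<epsilon> / 2"
      using that F(1,2) by (auto intro!: F(3)[of F] F(3)[of "F \<union> G"] simp del: less_divide_eq_numeral1)
    ultimately show ?thesis unfolding dist_real_def by linarith
  qed
  define J where "J = to_nat_on I ` (I - F)"
  define e where "e = from_nat_into I"
  define N' where "N' n = (if n \<in> J then N (e n) else {})" for n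
  define c' where "c' n = (if n \<in> J then c (e n) else 0)" for n
  have fromJ: "e n \<in> I - F" "to_nat_on I (e n) = n" if "n \<in> J" for n
    using that I by (auto simp: J_def e_def)
  have empty: "hcover s ({} :: 'a set) 0"
    unfolding hcover_def by (intro exI[of _ "\<lambda>_. {}"]) (auto simp: diam_pow_def)
  have "hcover s (\<Union>n. N' n) \<epsilon>"
  proof (rule hcover_UN[where c = c'])
    show "hcover s (N' n) (c' n)" for n
      using fromJ[of n] cov empty by (auto simp: N'_def c'_def)
    show "0 \<le> c' n" for n using fromJ[of n] c0 by (auto simp: c'_def)
    show "(\<Sum>n<m. c' n) \<le> \<epsilon>" for m
    proof -
      have "(\<Sum>n<m. c' n) = (\<Sum>n\<in>{..<m} \<inter> J. c (e n))"
        by (simp add: c'_def sum.inter_restrict)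
      also have "\<dots> = sum c (e ` ({..<m} \<inter> J))"
      proof -
        have "inj_on e ({..<m} \<inter> J)"
          by (rule inj_on_inverseI[where g = "to_nat_on I"]) (simp add: fromJ(2))
        then show ?thesis by (simp add: sum.reindex)
      qed
      also have "\<dots> \<le> \<epsilon>" using fromJ(1) by (intro tail) auto
      finally show ?thesis .
    qed
  qed
  moreover have "A \<subseteq> (\<Union>n. N' n)"
  proof
    fix x assume "x \<in> A"
    then have "infinite ({i \<in> I. x \<in> N i} - F)" using A F(1) by simp
    then have "{i \<in> I. x \<in> N i} - F \<noteq> {}" by (metis finite.emptyI)
    then obtain i where "i \<in> I - F" "x \<in> N i" by blast
    then have "x \<in> N' (to_nat_on I i)" using I by (auto simp: N'_def J_def e_def)
    then show "x \<in> (\<Union>n. N' n)" by blast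
  qed
  ultimately show "hcover s A \<epsilon>" by (rule hcover_subset)
qed

text \<open>A bounded set lies in a ball whose radius is its diameter, so volume is at most a
  constant times the cost.\<close>

lemma hnull_imp_negligible:
  fixes A :: "'a::euclidean_space set"
  assumes "hnull (real DIM('a)) A"
  shows "negligible A"
  unfolding negligible_outer
proof (intro allI impI)
  fix e :: real assume e: "e > 0"
  let ?s = "real DIM('a)" and ?v = "unit_ball_vol (real DIM('a))"
  have v: "?v > 0" by simp
  then have v0: "?v \<noteq> 0" by linarith
  have "e / (2 * ?v) > 0" using e v by simp
  then obtain U :: "nat \<Rightarrow> 'a set" where U: "A \<subseteq> (\<Union>i. U i)" "\<And>i. bounded (U i)"
      "(\<Sum>i. ennreal (diam_pow ?s (U i))) \<le> ennreal (e / (2 * ?v))"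
    using assms unfolding hnull_def hcover_def by blast
  define x where "x i = (SOME y. y \<in> U i)" for i
  define T where "T i = cball (x i) (diameter (U i))" for i
  have UT: "U i \<subseteq> T i" for i
  proof
    fix y assume y: "y \<in> U i"
    then have "x i \<in> U i" unfolding x_def by (rule someI)
    then show "y \<in> T i" using y U(2) by (auto simp: T_def intro: diameter_bounded_bound)
  qed
  have T: "emeasure lebesgue (T i) = ennreal ?v * ennreal (diam_pow ?s (U i))" for i
    using diameter_ge_0[OF U(2), of i] v
    by (simp add: T_def emeasure_cball diam_pow_pos powr_realpow' ennreal_mult)
  have "emeasure lebesgue (\<Union>i. T i) \<le> (\<Sum>i. emeasure lebesgue (T i))"
    by (rule emeasure_subadditive_countably) (auto simp: T_def)
  also have "\<dots> = ennreal ?v * (\<Sum>i. ennreal (diam_pow ?s (U i)))"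
    by (simp add: T)
  also have "\<dots> \<le> ennreal ?v * ennreal (e / (2 * ?v))" using U(3) by (intro mult_left_mono) auto
  also have "\<dots> = ennreal (e / 2)" using v0 e by (simp flip: ennreal_mult)
  finally have le: "emeasure lebesgue (\<Union>i. T i) \<le> ennreal (e / 2)" .
  have m: "(\<Union>i. T i) \<in> sets lebesgue" by (auto simp: T_def)
  have "(\<Union>i. T i) \<in> lmeasurable"
    using le m by (intro fmeasurableI) (auto simp: ennreal_less_top intro: order_le_less_trans)
  moreover have "measure lebesgue (\<Union>i. T i) < e"
    using e measure_eq_emeasure_eq_ennreal enn2real_mono[OF le] by (simp add: measure_def)
  ultimately show "\<exists>T. A \<subseteq> T \<and> T \<in> lmeasurable \<and> measure lebesgue T < e"
    using U(1) UT by (intro exI[of _ "\<Union>i. T i"]) blast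
qed

section \<open>A lower bound for the Hausdorff content of a countable intersection\<close>

text \<open>Given a cover of the intersection with small total cost, call a ball cheap if the members of
  the cover that meet it cost little compared with the ball itself. Double counting shows that among
  the balls provided by the hypothesis inside a cheap ball there is again a cheap one; the nested
  sequence obtained in this way shrinks to a point of the intersection that the cover misses.\<close>
lemma Inter_not_hnull:
  fixes F :: "nat \<Rightarrow> 'a::complete_space set" and C :: real
  assumes s: "0 < s" and C: "1 \<le> C"
    and step: "\<And>j x R. 0 < R \<Longrightarrow> R \<le> 1 \<Longrightarrow> \<exists>r S. 0 < r \<and> r \<le> R / 2 \<and> finite S \<and>
      (\<forall>p\<in>S. cball p r \<subseteq> cball x R \<inter> F j) \<and>
      (\<forall>U u. bounded U \<longrightarrow> diameter U \<le> u \<longrightarrow> u < r \<longrightarrow> card {p\<in>S. cball p r \<inter> U \<noteq> {}} \<le> 1) \<and>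
      (\<forall>U u. bounded U \<longrightarrow> diameter U \<le> u \<longrightarrow> r \<le> u \<longrightarrow> u \<le> R \<longrightarrow>
         card {p\<in>S. cball p r \<inter> U \<noteq> {}} \<le> C * card S * (u / R) powr s) \<and>
      4 * (R / r) powr s \<le> card S"
  shows "\<not> hnull s (\<Inter>j. F j)"
proof
  assume null: "hnull s (\<Inter>j. F j)"
  \<comment> \<open>With this \<open>c\<close> the quantity \<open>K\<close> below satisfies
    \<open>R powr s * K = card S * r powr s / 4\<close>. The hypothesis on \<open>card S\<close>
    bounds \<open>R powr s\<close> by the same quarter, so the double count is
    contradictory.\<close>
  define c where "c = 1 / (4 * C)"
  have c: "0 < c" "c \<le> 1 / 4" using C by (auto simp: c_def field_simps)
  obtain U :: "nat \<Rightarrow> 'a set" where U: "(\<Inter>j. F j) \<subseteq> (\<Union>i. U i)" "\<And>i. bounded (U i)"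
    and Usum: "(\<Sum>i. ennreal (diam_pow s (U i))) \<le> ennreal (c / 4)"
    using null c unfolding hnull_def hcover_def by (metis divide_pos_pos zero_less_numeral)
  \<comment> \<open>Every cost is inflated by a positive amount, so that \<open>u i\<close> is
    positive even if \<open>U i\<close> has diameter 0. The inflation totals \<open>c / 4\<close>
    and keeps the sum below \<open>c\<close>.\<close>
  define a where "a i = diameter (U i) powr s + c / 4 * (1 / 2) ^ Suc i" for i
  define u where "u i = a i powr (1 / s)" for i
  have apos: "0 < a i" for i using c by (simp add: a_def add_nonneg_pos)
  then have a0: "0 \<le> a i" for i by (simp add: less_imp_le)
  have dsum: "summable (\<lambda>i. diameter (U i) powr s)" "(\<Sum>i. diameter (U i) powr s) \<le> c / 4"
  proof -
    have Usum': "(\<Sum>i. ennreal (diameter (U i) powr s)) \<le> ennreal (c / 4)"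
      using Usum s by (simp add: diam_pow_pos)
    then show sm: "summable (\<lambda>i. diameter (U i) powr s)"
      by (intro summable_suminf_not_top) (auto simp: top_unique)
    have "ennreal (\<Sum>i. diameter (U i) powr s) = (\<Sum>i. ennreal (diameter (U i) powr s))"
      using sm by (intro suminf_ennreal2[symmetric]) auto
    with Usum' have "ennreal (\<Sum>i. diameter (U i) powr s) \<le> ennreal (c / 4)" by simp
    then show "(\<Sum>i. diameter (U i) powr s) \<le> c / 4" using c by (subst (asm) ennreal_le_iff) auto
  qed
  have "(\<lambda>i. c / 4 * (1 / 2) ^ Suc i) sums (c / 4 * 1)"
    by (intro sums_mult power_half_series)
  then have "(\<lambda>i. a i) sums ((\<Sum>i. diameter (U i) powr s) + c / 4 * 1)"
    unfolding a_def by (intro sums_add summable_sums dsum)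
  then have asum: "summable a" "suminf a < c"
    using dsum(2) c by (auto simp: sums_iff)
  have ua: "u i powr s = a i" "0 < u i" for i
    using apos[of i] s by (auto simp: u_def powr_powr)
  have du: "diameter (U i) \<le> u i" for i
  proof -
    have "diameter (U i) powr s \<le> u i powr s" using ua(1)[of i] c by (simp add: a_def)
    moreover have "u i powr s < diameter (U i) powr s" if "u i < diameter (U i)"
      using that s ua(2)[of i] by (intro powr_less_mono2) auto
    ultimately show ?thesis by linarith
  qed
  define hit where "hit x R i = (cball x R \<inter> U i \<noteq> {})" for x R i
  define cost where "cost x R = (\<Sum>i. if hit x R i then a i else 0)" for x R
  define cheap where "cheap x R \<longleftrightarrow> 0 < R \<and> R \<le> 1 \<and> cost x R < c * R powr s" for x R
  have hsum: "summable (\<lambda>i. if P i then a i else 0)" for P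
    by (rule summable_comparison_test'[OF asum(1), of 0]) (simp add: a0)
  have term_le: "a i \<le> cost x R" if "hit x R i" for x R i
    using sum_le_suminf[OF hsum[of "hit x R"], of "{i}"] that a0
    by (simp add: cost_def)
  have child: "\<exists>p r. cheap p r \<and> r \<le> R / 2 \<and> cball p r \<subseteq> cball x R \<inter> F j" if ch: "cheap x R" for x R j
  proof (rule ccontr)
    assume none: "\<nexists>p r. cheap p r \<and> r \<le> R / 2 \<and> cball p r \<subseteq> cball x R \<inter> F j"
    have R: "0 < R" "R \<le> 1" "cost x R < c * R powr s" using ch by (auto simp: cheap_def)
    obtain r S where r: "0 < r" "r \<le> R / 2" and S: "finite S" "\<And>p. p \<in> S \<Longrightarrow> cball p r \<subseteq> cball x R \<inter> F j"
      and small: "\<And>U u. bounded U \<Longrightarrow> diameter U \<le> u \<Longrightarrow> u < r \<Longrightarrow> card {p\<in>S. cball p r \<inter> U \<noteq> {}} \<le> 1"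
      and big: "\<And>U u. bounded U \<Longrightarrow> diameter U \<le> u \<Longrightarrow> r \<le> u \<Longrightarrow> u \<le> R \<Longrightarrow>
         card {p\<in>S. cball p r \<inter> U \<noteq> {}} \<le> C * card S * (u / R) powr s"
      and many: "4 * (R / r) powr s \<le> card S"
      by (rule exE[OF step[OF R(1,2), of x j]], elim exE conjE, rule that) (assumption | simp)+
    \<comment> \<open>A single set of cost at least \<open>c * r powr s\<close> already makes each
      small ball that it meets expensive. Truncating there keeps the product of hit count and weight
      linear in \<open>a i\<close>.\<close>
    define m where "m i = min (a i) (c * r powr s)" for i
    define K where "K = c * r powr s * C * card S / R powr s"
    have m0: "0 \<le> m i" "m i \<le> a i" for i using apos[of i] c by (auto simp: m_def)
    have msum: "summable (\<lambda>i. if P i then m i else 0)" for P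
      by (rule summable_comparison_test'[OF asum(1), of 0]) (simp add: a0 m0)
    have K0: "0 \<le> K" using c C by (simp add: K_def)
    have ge: "c * r powr s \<le> (\<Sum>i. if hit p r i then m i else 0)" if p: "p \<in> S" for p
    proof (cases "\<exists>i. hit p r i \<and> c * r powr s \<le> a i")
      case True
      then obtain i where "hit p r i" "c * r powr s \<le> a i" by blast
      then show ?thesis
        using sum_le_suminf[OF msum[of "hit p r"], of "{i}"] m0(1) by (auto simp: m_def)
    next
      case False
      then have "(\<lambda>i. if hit p r i then m i else 0) = (\<lambda>i. if hit p r i then a i else 0)"
        by (auto simp: m_def fun_eq_iff)
      moreover have "\<not> cheap p r" using none p S(2) r(2) by blast
      ultimately show ?thesis using r R by (auto simp: cheap_def cost_def)
    qed
    define h where "h i = real (card {p\<in>S. hit p r i})" for i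
    have hm: "(\<Sum>p\<in>S. if hit p r i then m i else 0) = h i * m i" for i
      using S(1) by (simp add: h_def sum.If_cases Int_def)
    have "card S * (c * r powr s) \<le> (\<Sum>p\<in>S. \<Sum>i. if hit p r i then m i else 0)"
      using sum_mono[of S "\<lambda>_. c * r powr s"] ge by simp
    also have "\<dots> = (\<Sum>i. \<Sum>p\<in>S. if hit p r i then m i else 0)"
      by (intro suminf_sum[symmetric] msum)
    also have "\<dots> = (\<Sum>i. h i * m i)" by (simp add: hm)
    also have "\<dots> \<le> (\<Sum>i. (if hit x R i then a i else 0) * (1 + K))"
    proof (rule suminf_le)
      show "summable (\<lambda>i. h i * m i)"
        unfolding hm[symmetric] by (intro summable_sum msum)
      show "summable (\<lambda>i. (if hit x R i then a i else 0) * (1 + K))"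
        by (intro summable_mult2 hsum)
      fix i
      show "h i * m i \<le> (if hit x R i then a i else 0) * (1 + K)"
      proof (cases "hit x R i")
        case False
        then have "{p\<in>S. hit p r i} = {}" using S(2) by (auto simp: hit_def)
        then have "h i = 0" unfolding h_def by (simp only: card.empty of_nat_0)
        then show ?thesis using False by simp
      next
        case True
        \<comment> \<open>A cheap ball is met only by sets of size at most \<open>R\<close>, the
          range covered by the spreading hypothesis.\<close>
        have "a i < c * R powr s" using term_le[OF True] R(3) by simp
        also have "\<dots> \<le> R powr s" using c by (simp add: mult_left_le_one_le)
        finally have "u i powr s < R powr s" using ua(1)[of i] by simp
        moreover have "R powr s \<le> u i powr s" if "R < u i"
          using that R(1) s by (intro powr_mono2) auto
        ultimately have uR: "u i \<le> R" by linarith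
        show ?thesis
        proof (cases "u i < r")
          case lt: True
          have "h i \<le> 1"
            using small[OF U(2) du lt] by (simp add: h_def hit_def)
          then have "h i * m i \<le> 1 * a i" using m0[of i] by (intro mult_mono) (auto simp: h_def)
          also have "\<dots> \<le> a i * (1 + K)" using apos[of i] K0 by (simp add: mult_le_cancel_left1)
          finally show ?thesis using True by simp
        next
          case False
          then have "h i \<le> C * card S * (u i / R) powr s"
            using big[OF U(2) du _ uR] by (simp add: h_def hit_def)
          also have "(u i / R) powr s = a i / R powr s"
            using ua[of i] R(1) by (simp add: powr_divide)
          finally have "h i * m i \<le> (C * card S * (a i / R powr s)) * (c * r powr s)"
            using m0[of i] apos[of i] C c by (intro mult_mono) (auto simp: m_def)
          also have "\<dots> = a i * K" by (simp add: K_def)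
          also have "\<dots> \<le> a i * (1 + K)" using apos[of i] by simp
          finally show ?thesis using True by simp
        qed
      qed
    qed
    also have "\<dots> = cost x R * (1 + K)"
      unfolding cost_def by (rule suminf_mult2[symmetric, OF hsum])
    also have "\<dots> < (c * R powr s) * (1 + K)"
      using R(3) K0 by (intro mult_strict_right_mono) auto
    also have "\<dots> = c * (R powr s + card S * r powr s / 4)"
      using R(1) C by (simp add: K_def c_def field_simps)
    finally have "c * (card S * r powr s) < c * (R powr s + card S * r powr s / 4)"
      by (simp add: ac_simps)
    then have "card S * r powr s < R powr s + card S * r powr s / 4"
      using c by (simp only: mult_less_cancel_left_pos)
    moreover have "4 * R powr s \<le> card S * r powr s"
      using many r(1) R(1) by (simp add: powr_divide field_simps)
    moreover have "0 < R powr s" using R(1) by simp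
    ultimately show False by linarith
  qed
  have start: "cheap x 1" for x
  proof -
    have "cost x 1 \<le> suminf a" unfolding cost_def
      by (intro suminf_le hsum asum) (simp add: a0)
    then show ?thesis using asum(2) by (simp add: cheap_def)
  qed
  have "\<exists>f. \<forall>n. cheap (fst (f n)) (snd (f n)) \<and>
     (snd (f (Suc n)) \<le> snd (f n) / 2 \<and>
          cball (fst (f (Suc n))) (snd (f (Suc n))) \<subseteq> cball (fst (f n)) (snd (f n)) \<inter> F n)"
  proof (rule dependent_nat_choice)
    show "\<exists>x. cheap (fst x) (snd x)" using start by (intro exI[of _ "(undefined, 1)"]) simp
    fix x n assume "cheap (fst x) (snd x)"
    from child[OF this, of n] obtain p r where "cheap p r" "r \<le> snd x / 2"
      "cball p r \<subseteq> cball (fst x) (snd x) \<inter> F n" by blast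
    then show "\<exists>y. cheap (fst y) (snd y) \<and> snd y \<le> snd x / 2 \<and>
        cball (fst y) (snd y) \<subseteq> cball (fst x) (snd x) \<inter> F n"
      by (intro exI[of _ "(p, r)"]) simp
  qed
  then obtain f where f': "\<And>n. cheap (fst (f n)) (snd (f n)) \<and>
     (snd (f (Suc n)) \<le> snd (f n) / 2 \<and>
          cball (fst (f (Suc n))) (snd (f (Suc n))) \<subseteq> cball (fst (f n)) (snd (f n)) \<inter> F n)"
    by (elim exE, intro that) (erule spec)
  note f = f'[THEN conjunct1] f'[THEN conjunct2, THEN conjunct1] f'[THEN conjunct2, THEN conjunct2]
  define B where "B n = cball (fst (f n)) (snd (f n))" for n
  have rad: "0 < snd (f n)" "snd (f n) \<le> (1 / 2) ^ n" for n
  proof -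
    show "0 < snd (f n)" for n using f(1)[of n] by (simp add: cheap_def)
    show "snd (f n) \<le> (1 / 2) ^ n"
    proof (induction n)
      case 0 then show ?case using f(1)[of 0] by (simp add: cheap_def)
    next
      case (Suc n) then show ?case using f(2)[of n] by simp
    qed
  qed
  have lim: "(\<lambda>n. (1 / 2 :: real) ^ n) \<longlonglongrightarrow> 0" by (intro LIMSEQ_power_zero) simp
  have "\<exists>x. \<forall>n. x \<in> B n"
  proof (rule decreasing_closed_nest)
    show "closed (B n)" "B n \<noteq> {}" for n using rad(1)[of n] by (auto simp: B_def)
    show "B n \<subseteq> B m" if "m \<le> n" for m n
      using that by (rule lift_Suc_antimono_le[of B, rotated]) (use f(3) in \<open>simp add: B_def\<close>)
    fix e :: real assume "0 < e"
    then have "\<forall>\<^sub>F n in sequentially. (1 / 2) ^ n < e / 2"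
      by (intro order_tendstoD(2)[OF lim]) simp
    then obtain n where n: "(1 / 2) ^ n < e / 2" by (auto simp: eventually_sequentially)
    show "\<exists>n. \<forall>x\<in>B n. \<forall>y\<in>B n. dist x y < e"
    proof (intro exI[of _ n] ballI)
      fix x y assume "x \<in> B n" "y \<in> B n"
      then have "dist x y \<le> 2 * snd (f n)"
        using dist_triangle[of x y "fst (f n)"] by (simp add: B_def dist_commute)
      then show "dist x y < e" using rad(2)[of n] n by linarith
    qed
  qed blast
  then obtain x where x: "\<And>n. x \<in> B n" by blast
  have "x \<in> F n" for n using x[of "Suc n"] f(3)[of n] by (auto simp: B_def)
  then have "x \<in> (\<Inter>j. F j)" by simp
  then obtain i where i: "x \<in> U i" using U(1) by blast
  \<comment> \<open>A cheap ball cannot meet a set that is larger than the ball, yet the balls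
    around \<open>x\<close> all meet \<open>U i\<close> and eventually become smaller than
    \<open>u i\<close>.\<close>
  have "\<forall>\<^sub>F n in sequentially. (1 / 2) ^ n < u i"
    using ua(2) by (intro order_tendstoD(2)[OF lim])
  then obtain n where n: "(1 / 2) ^ n < u i" by (auto simp: eventually_sequentially)
  have "hit (fst (f n)) (snd (f n)) i" using x[of n] i by (auto simp: hit_def B_def)
  then have "a i \<le> cost (fst (f n)) (snd (f n))" by (rule term_le)
  also have "\<dots> < c * snd (f n) powr s" using f(1)[of n] by (simp add: cheap_def)
  also have "\<dots> \<le> snd (f n) powr s" using c by (simp add: mult_left_le_one_le)
  also have "\<dots> \<le> u i powr s" using rad[of n] n s by (intro powr_mono2) auto
  also have "\<dots> = a i" by (rule ua(1))
  finally show False by simp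
qed

section \<open>Integer bases and heights of rational subspaces\<close>

lemma int_point_add: "int_point x \<Longrightarrow> int_point y \<Longrightarrow> int_point (x + y)"
  by (simp add: int_point_def)

lemma int_point_diff: "int_point x \<Longrightarrow> int_point y \<Longrightarrow> int_point (x - y)"
  by (simp add: int_point_def)

lemma int_point_scale: "int_point x \<Longrightarrow> a \<in> \<int> \<Longrightarrow> int_point (a *\<^sub>R x)"
  by (simp add: int_point_def)

lemma int_point_0: "int_point 0"
  by (simp add: int_point_def)

lemma int_point_sum: "(\<And>i. i \<in> I \<Longrightarrow> int_point (f i)) \<Longrightarrow> int_point (\<Sum>i\<in>I. f i)"
  by (induction I rule: infinite_finite_induct) (auto intro: int_point_0 int_point_add)

lemma int_point_inner:
  assumes "int_point x" "int_point y"
  shows "x \<bullet> y \<in> \<int>"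
  using assms by (auto simp: int_point_def inner_prod_def inner_vec_def intro!: Ints_add Ints_mult Ints_sum)

lemma gram_det_Ints:
  assumes "\<And>i. i < k \<Longrightarrow> int_point (v i)"
  shows "gram_det v k \<in> \<int>"
  unfolding gram_det_def
proof (intro Ints_sum Ints_mult Ints_prod)
  fix p i assume "p \<in> {p. p permutes {..<k}}" "i \<in> {..<k}"
  then have "i < k" "p i < k" using permutes_in_image[of p "{..<k}" i] by auto
  then show "v i \<bullet> v (p i) \<in> \<int>" by (intro int_point_inner assms)
qed auto

lemma gram_det_ge_1:
  assumes "\<And>i. i < k \<Longrightarrow> int_point (v i)" "lin_indep v k"
  shows "1 \<le> gram_det v k"
proof -
  have "gram_det v k \<in> \<int>" using assms(1) by (rule gram_det_Ints)
  then obtain m where "gram_det v k = of_int m" by (rule Ints_cases)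
  then show ?thesis using gram_det_pos[OF assms(2)] by simp
qed

lemma in_span_lin_indep:
  assumes "lin_indep v k" "y \<in> span (v ` {..<k})"
  obtains c where "y = (\<Sum>i<k. c i *\<^sub>R v i)"
proof -
  have inj: "inj_on v {..<k}" using assms(1) by (simp add: lin_indep_iff_independent)
  obtain u where "y = (\<Sum>x\<in>v ` {..<k}. u x *\<^sub>R x)"
    using assms(2) span_finite[of "v ` {..<k}"] by auto
  then have "y = (\<Sum>i<k. u (v i) *\<^sub>R v i)" by (simp add: sum.reindex[OF inj])
  then show thesis by (rule that)
qed

lemma Ints_fun:
  fixes c :: "nat \<Rightarrow> real"
  assumes "\<And>i. i < k \<Longrightarrow> c i \<in> \<int>"
  obtains e :: "nat \<Rightarrow> int" where "\<And>i. i < k \<Longrightarrow> c i = of_int (e i)"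
proof
  fix i assume "i < k"
  then show "c i = of_int \<lfloor>c i\<rfloor>" using assms by (auto elim!: Ints_cases)
qed

lemma zspan_int_point: "(\<And>i. i < k \<Longrightarrow> int_point (v i)) \<Longrightarrow> y \<in> zspan v k \<Longrightarrow> int_point y"
  by (auto simp: zspan_def intro!: int_point_sum int_point_scale)

lemma lattice_basis_iff:
  "lattice_basis W v k \<longleftrightarrow> (\<forall>i<k. int_point (v i)) \<and> lin_indep v k \<and> span (v ` {..<k}) = W \<and>
     zspan v k = {y \<in> W. int_point y}"
proof -
  have 1: "zspan v k \<subseteq> {y \<in> span (v ` {..<k}). int_point y}" if "\<forall>i<k. int_point (v i)"
    using that zspan_subset_span[of v k] zspan_int_point[where k = k and v = v] by blast
  have 2: "(\<exists>c. (\<forall>i<k. c i \<in> \<int>) \<and> y = (\<Sum>i<k. c i *\<^sub>R v i)) \<longleftrightarrow> y \<in> zspan v k" for y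
  proof
    assume "\<exists>c. (\<forall>i<k. c i \<in> \<int>) \<and> y = (\<Sum>i<k. c i *\<^sub>R v i)"
    then obtain c where c: "\<And>i. i < k \<Longrightarrow> c i \<in> \<int>" "y = (\<Sum>i<k. c i *\<^sub>R v i)" by blast
    from Ints_fun[of k c, OF c(1)] obtain e :: "nat \<Rightarrow> int" where "\<And>i. i < k \<Longrightarrow> c i = of_int (e i)" by blast
    then show "y \<in> zspan v k" using c(2) by (intro zspanI[where c = e]) simp
  next
    assume "y \<in> zspan v k"
    then obtain e :: "nat \<Rightarrow> int" where "y = (\<Sum>i<k. of_int (e i) *\<^sub>R v i)" by (auto elim: zspanE)
    then show "\<exists>c. (\<forall>i<k. c i \<in> \<int>) \<and> y = (\<Sum>i<k. c i *\<^sub>R v i)"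
      by (intro exI[of _ "\<lambda>i. of_int (e i)"]) simp
  qed
  show ?thesis
    unfolding lattice_basis_def lin_indep_iff_independent 2 using 1 by blast
qed

lemma lattice_basis_gram_unique:
  assumes "lattice_basis W v k" "lattice_basis W u k"
  shows "gram_det u k = gram_det v k"
  using assms by (intro gram_det_zspan) (auto simp: lattice_basis_iff)

lemma replace_last_gram:
  fixes u :: "nat \<Rightarrow> 'a::real_inner"
  assumes u: "lin_indep u (Suc m)" and c: "c m \<noteq> 0"
  defines "u' \<equiv> u(m := (\<Sum>j<Suc m. c j *\<^sub>R u j))"
  shows "lin_indep u' (Suc m)" "gram_det u' (Suc m) = (c m)\<^sup>2 * gram_det u (Suc m)"
proof -
  show "lin_indep u' (Suc m)"
    unfolding lin_indep_def
  proof (intro allI impI)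
    fix e i assume e: "(\<Sum>i<Suc m. e i *\<^sub>R u' i) = 0" and i: "i < Suc m"
    have "(\<Sum>i<Suc m. (if i = m then e m * c m else e i + e m * c i) *\<^sub>R u i)
        = (\<Sum>i<m. e i *\<^sub>R u i) + e m *\<^sub>R (\<Sum>j<Suc m. c j *\<^sub>R u j)"
      by (simp add: scaleR_add_left scaleR_add_right sum.distrib scaleR_sum_right)
    also have "\<dots> = (\<Sum>i<Suc m. e i *\<^sub>R u' i)" by (simp add: u'_def)
    finally have z: "(if i = m then e m * c m else e i + e m * c i) = 0" if "i < Suc m" for i
      using lin_indepD[OF u _ that, of "\<lambda>i. if i = m then e m * c m else e i + e m * c i"] e by simp
    have "e m = 0" using z[of m] c by simp
    then show "e i = 0" using z[OF i] by (auto split: if_splits)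
  qed
  define A where "A i j = (if i = m then c j else if i = j then 1 else 0)" for i j :: nat
  let ?A = "mat (Suc m) (Suc m) (\<lambda>(i, j). A i j)"
  have "Determinant.det ?A = prod_list (diag_mat ?A)"
    by (rule det_lower_triangular[where n = "Suc m"]) (auto simp: A_def)
  also have "diag_mat ?A = map (\<lambda>i. 1) [0..<m] @ [c m]"
    unfolding diag_mat_def by (auto simp: A_def)
  also have "prod_list (map (\<lambda>i. 1) [0..<m]) = (1 :: real)" by (induction m) auto
  then have "prod_list (map (\<lambda>i. 1) [0..<m] @ [c m]) = c m" by simp
  finally have det: "Determinant.det ?A = c m" .
  have "u' i = (\<Sum>j<Suc m. A i j *\<^sub>R u j)" if "i < Suc m" for i
  proof (cases "i = m")
    case False
    then have "(\<Sum>j<m. A i j *\<^sub>R u j) = (\<Sum>j<m. if j = i then u j else 0)"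
      by (intro sum.cong) (auto simp: A_def)
    then show ?thesis using False that by (simp add: A_def u'_def)
  qed (simp add: A_def u'_def)
  from gram_det_linear_comb[of "Suc m" u' A u, OF this] det
  show "gram_det u' (Suc m) = (c m)\<^sup>2 * gram_det u (Suc m)" by simp
qed

text \<open>Take integer vectors of least Gram determinant: an integer point with a fractional coordinate would
  allow a smaller one.\<close>
lemma lattice_basis_exists:
  fixes v0 :: "nat \<Rightarrow> real \<times> (real ^ 'n::finite)"
  assumes "lin_indep v0 k" "\<And>i. i < k \<Longrightarrow> int_point (v0 i)" "span (v0 ` {..<k}) = W"
  obtains v where "lattice_basis W v k"
proof -
  define P where "P v \<longleftrightarrow> lin_indep v k \<and> (\<forall>i<k. int_point (v i)) \<and> span (v ` {..<k}) = W"
    for v :: "nat \<Rightarrow> real \<times> (real ^ 'n)"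
  have "P v0" using assms by (simp add: P_def)
  \<comment> \<open>Gram determinants of independent integer vectors are positive integers, so
    rounding to \<open>nat\<close> loses nothing and a least value exists.\<close>
  then obtain v where v: "P v" and vmin: "\<And>u. P u \<Longrightarrow> nat \<lfloor>gram_det v k\<rfloor> \<le> nat \<lfloor>gram_det u k\<rfloor>"
    using ex_has_least_nat[of P v0 "\<lambda>v. nat \<lfloor>gram_det v k\<rfloor>"] by blast
  have gmin: "gram_det v k \<le> gram_det u k" if u: "P u" for u
  proof -
    have "gram_det v k \<in> \<int>" "gram_det u k \<in> \<int>" "0 < gram_det v k" "0 < gram_det u k"
      using u v by (auto simp: P_def intro: gram_det_Ints gram_det_pos)
    then show ?thesis using vmin[OF u] by (auto elim!: Ints_cases)
  qed
  have dimW: "dim W = k"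
    using v by (metis P_def lin_indep_iff_independent dim_span dim_eq_card_independent card_image card_lessThan)
  have "y \<in> zspan v k" if y: "y \<in> W" "int_point y" for y
  proof -
    obtain c where c: "y = (\<Sum>i<k. c i *\<^sub>R v i)"
      using in_span_lin_indep[of v k y] v y by (auto simp: P_def)
    have "c i \<in> \<int>" if i: "i < k" for i
    proof (rule ccontr)
      assume nint: "c i \<notin> \<int>"
      obtain m where m: "k = Suc m" using i by (cases k) auto
      define \<tau> where "\<tau> = Transposition.transpose i m"
      have \<tau>: "\<tau> j < k" if "j < k" for j using that i m by (auto simp: \<tau>_def Transposition.transpose_def)
      have \<tau>\<tau>: "\<tau> (\<tau> j) = j" for j by (simp add: \<tau>_def)
      define u where "u = v \<circ> \<tau>"
      \<comment> \<open>Removing the integer parts of all coefficients of \<open>y\<close> leaves an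
        integer point of \<open>W\<close>. Put in the last place, it multiplies the Gram determinant
        by the square of a fractional part strictly between 0 and 1.\<close>
      define e where "e j = frac (c (\<tau> j))" for j
      define u' where "u' = u(m := (\<Sum>j<Suc m. e j *\<^sub>R u j))"
      have zu: "zspan u k = zspan v k" using i m by (simp add: u_def \<tau>_def zspan_transpose)
      have ul: "lin_indep u k" by (rule zspan_lin_indep[OF _ zu]) (use v in \<open>simp add: P_def\<close>)
      have em: "e m = frac (c i)" by (simp add: e_def \<tau>_def)
      have e01: "0 < e m" "e m < 1" using nint em by (auto simp: frac_gt_0_iff frac_lt_1)
      have u'l: "lin_indep u' k" and gram: "gram_det u' k = (e m)\<^sup>2 * gram_det u k"
        using replace_last_gram[of u m e] ul e01 m by (simp_all add: u'_def)
      have "bij_betw \<tau> {..<Suc m} {..<Suc m}"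
        using \<tau> \<tau>\<tau> m by (intro bij_betwI[where g = \<tau>]) auto
      then have reidx: "(\<Sum>j<Suc m. g (\<tau> j)) = (\<Sum>j<Suc m. g j)" for g :: "nat \<Rightarrow> real \<times> (real ^ 'n)"
        by (rule sum.reindex_bij_betw)
      have "(\<Sum>j<Suc m. e j *\<^sub>R u j) = (\<Sum>j<Suc m. frac (c j) *\<^sub>R v j)"
        unfolding e_def u_def o_def by (rule reidx)
      also have "\<dots> = y - (\<Sum>j<Suc m. of_int \<lfloor>c j\<rfloor> *\<^sub>R v j)"
        unfolding c m frac_def scaleR_diff_left sum_subtractf ..
      finally have last: "(\<Sum>j<Suc m. e j *\<^sub>R u j) = y - (\<Sum>j<Suc m. of_int \<lfloor>c j\<rfloor> *\<^sub>R v j)" .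
      have vint: "int_point (v j)" "v j \<in> W" if "j < k" for j
        using v that by (auto simp: P_def intro: span_base)
      have subW: "subspace W" using v by (auto simp: P_def)
      have u'int: "int_point (u' j)" if "j < k" for j
        using vint \<tau>[OF that] y m unfolding u'_def last
        by (auto simp: u_def simp del: sum.lessThan_Suc intro!: int_point_diff int_point_sum int_point_scale)
      have u'W: "u' j \<in> W" if "j < k" for j
        using vint \<tau>[OF that] y m unfolding u'_def last
        by (auto simp: u_def simp del: sum.lessThan_Suc intro!: subspace_diff subspace_sum subspace_scale subW)
      have "span (u' ` {..<k}) = W"
      proof (rule subspace_dim_equal)
        show "span (u' ` {..<k}) \<subseteq> W" using u'W subW by (intro span_minimal) auto
        have "dim (span (u' ` {..<k})) = k"
          using u'l by (metis lin_indep_iff_independent dim_span dim_eq_card_independent card_image card_lessThan)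
        then show "dim W \<le> dim (span (u' ` {..<k}))" using dimW by simp
      qed (use subW in auto)
      then have "P u'" using u'l u'int by (simp add: P_def)
      from gmin[OF this] have "gram_det u k \<le> (e m)\<^sup>2 * gram_det u k"
        using gram gram_det_zspan[OF _ zu] v by (simp add: P_def)
      moreover have "(e m)\<^sup>2 < 1" using e01 by (simp add: abs_square_less_1)
      moreover have "0 < gram_det u k" using ul by (rule gram_det_pos)
      ultimately show False by (simp add: mult_le_cancel_right1)
    qed
    from Ints_fun[of k c, OF this] obtain e :: "nat \<Rightarrow> int" where "\<And>i. i < k \<Longrightarrow> c i = of_int (e i)" by blast
    then show ?thesis using c by (intro zspanI[where c = e]) simp
  qed
  moreover have "int_point y \<and> y \<in> W" if "y \<in> zspan v k" for y
    using that v zspan_subset_span[of v k]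
      zspan_int_point[where k = k and v = v and y = y] by (auto simp: P_def)
  ultimately have "lattice_basis W v k" using v by (auto simp: lattice_basis_iff P_def)
  then show thesis by (rule that)
qed

section \<open>Affine subspaces and their linear lifts\<close>

definition slice :: "(real \<times> 'a::real_vector) set \<Rightarrow> 'a set" where
  "slice W = {p. (1, p) \<in> W}"

lemma affine_slice:
  assumes "subspace W" shows "affine (slice W)"
  unfolding affine_def slice_def
proof (clarify)
  fix x y :: 'a and u v :: real
  assume "(1, x) \<in> W" "(1, y) \<in> W" "u + v = 1"
  moreover from this have "(1 :: real, u *\<^sub>R x + v *\<^sub>R y) = u *\<^sub>R (1, x) + v *\<^sub>R (1, y)" by simp
  ultimately show "(1, u *\<^sub>R x + v *\<^sub>R y) \<in> W"
    using assms by (simp only: subspace_add subspace_scale)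
qed

text \<open>In a linear combination of vectors \<open>(1, q)\<close> with first coordinate 1 the
  coefficients sum to 1, so it is an affine combination.\<close>

lemma slice_lift_subspace:
  fixes L :: "(real ^ 'n::finite) set"
  assumes "affine L"
  shows "slice (lift_subspace L) = L"
proof
  show "L \<subseteq> slice (lift_subspace L)" by (auto simp: slice_def lift_subspace_def intro: span_base)
  show "slice (lift_subspace L) \<subseteq> L"
  proof
    fix p assume "p \<in> slice (lift_subspace L)"
    then obtain t r where t: "finite t" "t \<subseteq> Pair 1 ` L" "(1 :: real, p) = (\<Sum>a\<in>t. r a *\<^sub>R a)"
      by (auto simp: slice_def lift_subspace_def span_explicit)
    define S where "S = snd ` t"
    have tS: "t = Pair 1 ` S" using t(2) by (force simp: S_def)
    have inj: "inj_on (Pair (1 :: real)) S" by (auto intro: inj_onI)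
    have S: "finite S" "S \<subseteq> L" using t(1,2) by (auto simp: S_def)
    have e: "(1 :: real, p) = (\<Sum>q\<in>S. r (1, q) *\<^sub>R (1, q))" using t(3) by (simp add: tS sum.reindex[OF inj])
    have 1: "(\<Sum>q\<in>S. r (1, q)) = 1" using arg_cong[OF e, of fst] by (simp add: fst_sum)
    have 2: "p = (\<Sum>q\<in>S. r (1, q) *\<^sub>R q)" using arg_cong[OF e, of snd] by (simp add: snd_sum)
    have "S \<noteq> {}" using 1 by auto
    then have "p \<in> affine hull L" unfolding affine_hull_explicit
      using S 1 2 by (intro CollectI exI[of _ S] exI[of _ "\<lambda>q. r (1, q)"]) auto
    then show "p \<in> L" using assms by (metis affine_hull_eq)
  qed
qed

text \<open>The lift consists of the direction space, placed in the hyperplane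
  \<open>fst = 0\<close>, and one further vector \<open>(1, a)\<close> outside that
  hyperplane.\<close>

lemma dim_lift_subspace:
  fixes L :: "(real ^ 'n::finite) set"
  assumes "L \<noteq> {}"
  shows "int (dim (lift_subspace L)) = aff_dim L + 1"
proof -
  obtain a where a: "a \<in> L" using assms by blast
  define D where "D = (+) (- a) ` L"
  have aff: "aff_dim L = int (dim D)"
    unfolding D_def using a by (intro aff_dim_eq_dim hull_inc)
  have lin: "linear (Pair (0 :: real) :: real ^ 'n \<Rightarrow> _)" by (intro linearI) auto
  have "lift_subspace L = span (insert (1, a) (Pair 0 ` D))"
  proof
    show "lift_subspace L \<subseteq> span (insert (1, a) (Pair 0 ` D))"
      unfolding lift_subspace_def
    proof (intro span_minimal image_subsetI)
      fix p assume "p \<in> L"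
      then have "(0, p - a) \<in> Pair 0 ` D" by (auto simp: D_def)
      then have "(1, a) + (0, p - a) \<in> span (insert (1 :: real, a) (Pair 0 ` D))"
        by (intro span_add span_base) auto
      then show "(1 :: real, p) \<in> span (insert (1, a) (Pair 0 ` D))" by simp
    qed auto
    show "span (insert (1, a) (Pair 0 ` D)) \<subseteq> lift_subspace L"
      unfolding lift_subspace_def
    proof (intro span_minimal insert_subsetI image_subsetI)
      show "(1 :: real, a) \<in> span (Pair 1 ` L)" using a by (intro span_base) auto
      fix q assume "q \<in> D"
      then obtain p where p: "p \<in> L" "q = p - a" by (auto simp: D_def)
      moreover have "(1 :: real, p) - (1, a) \<in> span (Pair 1 ` L)"
        using p a by (intro span_diff span_base) auto
      ultimately show "(0 :: real, q) \<in> span (Pair 1 ` L)" by simp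
    qed auto
  qed
  moreover have "(1 :: real, a) \<notin> span (Pair 0 ` D)"
  proof
    assume "(1 :: real, a) \<in> span (Pair 0 ` D)"
    moreover have "span (Pair 0 ` D) \<subseteq> {x. fst x = (0 :: real)}"
      by (intro span_minimal) (auto intro!: subspaceI)
    ultimately show False by auto
  qed
  ultimately have "dim (lift_subspace L) = dim (Pair (0 :: real) ` D) + 1"
    by (simp add: dim_insert)
  also have "dim (Pair (0 :: real) ` D) = dim D"
    using lin by (intro dim_image_eq) (auto intro: inj_onI)
  finally show ?thesis using aff by simp
qed

text \<open>The vector \<open>v i0\<close> shows that the span does not lie at infinity. Adding it
  to the basis vectors with first coordinate 0 lets all of them be scaled to rational points, which
  still generate the span.\<close>

lemma rat_affine_subspace_slice:
  fixes v :: "nat \<Rightarrow> real \<times> (real ^ 'n::finite)"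
  assumes v: "lin_indep v (Suc d)" "\<And>i. i < Suc d \<Longrightarrow> int_point (v i)"
    and i0: "i0 < Suc d" "fst (v i0) \<noteq> 0"
  defines "W \<equiv> span (v ` {..<Suc d})"
  shows "rat_affine_subspace d (slice W)" "lift_subspace (slice W) = W"
proof -
  have subW: "subspace W" by (simp add: W_def)
  have aff: "affine (slice W)" using subW by (rule affine_slice)
  define w where "w i = (if fst (v i) = 0 then v i0 + v i else v i)" for i
  have w0: "fst (w i) \<noteq> 0" if "i < Suc d" for i using i0 by (simp add: w_def)
  have wint: "int_point (w i)" if "i < Suc d" for i
    using v(2) i0 that by (auto simp: w_def intro: int_point_add)
  have wW: "w i \<in> W" if "i < Suc d" for i
    using i0 that by (auto simp: w_def W_def intro!: span_add intro: span_base)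
  define q where "q i = (1 / fst (w i)) *\<^sub>R snd (w i)" for i
  have wq: "w i = fst (w i) *\<^sub>R (1, q i)" if "i < Suc d" for i
    using w0[OF that] by (simp add: q_def prod_eq_iff)
  have q1: "(1, q i) = (1 / fst (w i)) *\<^sub>R w i" if "i < Suc d" for i
    using w0[OF that] by (simp add: q_def prod_eq_iff)
  have qW: "q i \<in> slice W" if "i < Suc d" for i
    unfolding slice_def q1[OF that] mem_Collect_eq using wW[OF that] by (rule subspace_scale[OF subW])
  have qrat: "rat_point (q i)" if "i < Suc d" for i
    using wint[OF that] by (auto simp: q_def rat_point_def int_point_def Ints_subset_Rats[THEN subsetD])
  define Q where "Q = {p \<in> slice W. rat_point p}"
  have qQ: "q i \<in> Q" if "i < Suc d" for i using that qW qrat by (simp add: Q_def)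
  have span_le: "W \<subseteq> lift_subspace X" if "Q \<subseteq> X" for X
    unfolding W_def
  proof (intro span_minimal image_subsetI)
    have wX: "w i \<in> lift_subspace X" if "i < Suc d" for i
      unfolding lift_subspace_def
      by (subst wq[OF that], rule span_scale, rule span_base) (use qQ[OF that] \<open>Q \<subseteq> X\<close> in auto)
    fix i assume "i \<in> {..<Suc d}"
    then have i: "i < Suc d" by simp
    show "v i \<in> lift_subspace X"
    proof (cases "fst (v i) = 0")
      case True
      have "w i0 = v i0" using i0 by (simp add: w_def)
      then have "v i = w i - w i0" using True by (simp add: w_def)
      then show ?thesis using wX[OF i] wX[OF i0(1)] by (simp add: lift_subspace_def span_diff)
    qed (use wX[OF i] in \<open>simp add: w_def\<close>)
  qed (simp add: lift_subspace_def)
  show lift: "lift_subspace (slice W) = W"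
  proof
    show "lift_subspace (slice W) \<subseteq> W"
      unfolding lift_subspace_def using subW by (intro span_minimal) (auto simp: slice_def)
  qed (rule span_le, simp add: Q_def)
  have ne: "slice W \<noteq> {}" using qW[of 0] by auto
  have "dim W = Suc d"
    using v(1) by (simp add: W_def lin_indep_iff_independent dim_eq_card_independent card_image)
  then have "aff_dim (slice W) = int d" using dim_lift_subspace[OF ne] lift by simp
  moreover have "slice W = affine hull Q"
  proof
    have "W \<subseteq> lift_subspace (affine hull Q)" by (rule span_le) (rule hull_subset)
    then have "slice W \<subseteq> slice (lift_subspace (affine hull Q))" by (auto simp: slice_def)
    then show "slice W \<subseteq> affine hull Q" by (simp add: slice_lift_subspace)
    show "affine hull Q \<subseteq> slice W" using aff by (intro hull_minimal) (auto simp: Q_def)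
  qed
  ultimately show "rat_affine_subspace d (slice W)"
    unfolding rat_affine_subspace_def Q_def using aff ne by (intro conjI)
qed

lemma rat_point_scale:
  fixes p :: "real ^ 'n::finite"
  assumes "rat_point p"
  obtains m :: int where "m > 0" "int_point (of_int m *\<^sub>R (1, p))"
proof -
  have "\<exists>m :: int. m > 0 \<and> of_int m * p $ i \<in> \<int>" for i
  proof -
    have "p $ i \<in> \<rat>" using assms by (simp add: rat_point_def)
    then obtain a b where ab: "b > 0" "p $ i = of_int a / of_int b"
      by (metis Rats_cases')
    then have "of_int b * p $ i = of_int a" by simp
    then show ?thesis using ab by (intro exI[of _ b]) simp
  qed
  then obtain m :: "'n \<Rightarrow> int" where m: "\<And>i. m i > 0" "\<And>i. of_int (m i) * p $ i \<in> \<int>" by metis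
  show thesis
  proof (rule that)
    show "prod m UNIV > 0" using m by (intro prod_pos) auto
    have "of_int (prod m UNIV) * p $ i \<in> \<int>" for i
    proof -
      have "prod m UNIV = m i * prod m (UNIV - {i})" by (intro prod.remove) auto
      then have "of_int (prod m UNIV) * p $ i = (of_int (m i) * p $ i) * of_int (prod m (UNIV - {i}))"
        by simp
      then show ?thesis using m(2)[of i] by (simp only: Ints_mult Ints_of_int)
    qed
    moreover have "of_int (prod m UNIV) \<in> (\<int> :: real set)" by (rule Ints_of_int)
    ultimately show "int_point (of_int (prod m UNIV) *\<^sub>R (1, p))"
      by (simp add: int_point_def del: of_int_prod)
  qed
qed

text \<open>The height refers to a basis picked by \<open>SOME\<close>; all lattice bases of the
  same space have equal Gram determinants.\<close>

lemma schmidt_height_lattice_basis: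
  fixes L :: "(real ^ 'n::finite) set"
  assumes "aff_dim L = int d" "lattice_basis (lift_subspace L) v (Suc d)"
  shows "schmidt_height L = sqrt (gram_det v (Suc d))"
proof -
  have "nat (aff_dim L) + 1 = Suc d" using assms(1) by simp
  moreover have "lattice_basis (lift_subspace L) (SOME v. lattice_basis (lift_subspace L) v (Suc d)) (Suc d)"
    by (rule someI[of "\<lambda>v. lattice_basis (lift_subspace L) v (Suc d)", OF assms(2)])
  ultimately show ?thesis
    using lattice_basis_gram_unique[OF assms(2)] by (simp add: schmidt_height_def Let_def)
qed

text \<open>The rational points of \<open>L\<close> span the lift. A basis chosen among their lifts
  becomes integral after clearing denominators, and \<open>lattice_basis_exists\<close> turns it
  into a basis of all integer points.\<close>

lemma rat_affine_subspace_lattice_basis: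
  fixes L :: "(real ^ 'n::finite) set"
  assumes "rat_affine_subspace d L"
  obtains v where "lattice_basis (lift_subspace L) v (Suc d)" "schmidt_height L = sqrt (gram_det v (Suc d))"
proof -
  define Q where "Q = {p \<in> L. rat_point p}"
  have L: "affine L" "L \<noteq> {}" "aff_dim L = int d" "L = affine hull Q"
    using assms by (auto simp: rat_affine_subspace_def Q_def)
  have dim: "dim (lift_subspace L) = Suc d" using dim_lift_subspace[OF L(2)] L(3) by simp
  have eq: "lift_subspace L = lift_subspace Q"
  proof
    have "Q \<subseteq> slice (lift_subspace Q)" by (auto simp: slice_def lift_subspace_def intro: span_base)
    then have "L \<subseteq> slice (lift_subspace Q)"
      unfolding L(4) by (intro hull_minimal affine_slice) (auto simp: lift_subspace_def)
    then show "lift_subspace L \<subseteq> lift_subspace Q"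
      unfolding lift_subspace_def[of L] by (intro span_minimal) (auto simp: slice_def lift_subspace_def)
    show "lift_subspace Q \<subseteq> lift_subspace L"
      unfolding lift_subspace_def by (intro span_mono) (auto simp: Q_def)
  qed
  obtain B :: "(real \<times> (real ^ 'n)) set" where B: "B \<subseteq> Pair 1 ` Q" "independent B" "Pair 1 ` Q \<subseteq> span B" "card B = dim (Pair (1 :: real) ` Q)"
    by (rule basis_exists[of "Pair (1 :: real) ` Q"])
  have "span B = lift_subspace Q"
    unfolding lift_subspace_def using B(1,3) by (intro antisym span_mono span_minimal) auto
  then have spanB: "span B = lift_subspace L" by (simp add: eq)
  have cardB: "card B = Suc d"
    using dim dim_eq_card_independent[OF B(2)] by (simp flip: spanB)
  then have "finite B" using card.infinite by fastforce
  then obtain e where e: "bij_betw e {..<Suc d} B"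
    using ex_bij_betw_nat_finite[of B] cardB by (auto simp: atLeast0LessThan)
  have "\<exists>m :: int. m > 0 \<and> int_point (of_int m *\<^sub>R e i)" if "i < Suc d" for i
  proof -
    have "e i \<in> Pair 1 ` Q" using e B(1) that by (auto simp: bij_betw_def)
    then obtain p where "e i = (1, p)" "rat_point p" by (auto simp: Q_def)
    then show ?thesis using rat_point_scale[of p] by metis
  qed
  then obtain m :: "nat \<Rightarrow> int" where m: "\<And>i. i < Suc d \<Longrightarrow> m i > 0"
    "\<And>i. i < Suc d \<Longrightarrow> int_point (of_int (m i) *\<^sub>R e i)" by metis
  define u where "u i = of_int (m i) *\<^sub>R e i" for i
  have el: "lin_indep e (Suc d)" using e B(2) by (simp add: lin_indep_iff_independent bij_betw_def)
  have "lin_indep u (Suc d)"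
    unfolding lin_indep_def
  proof (intro allI impI)
    fix c i assume "(\<Sum>i<Suc d. c i *\<^sub>R u i) = 0" and i: "i < Suc d"
    then have "(\<Sum>i<Suc d. (c i * of_int (m i)) *\<^sub>R e i) = 0" by (simp add: u_def)
    from lin_indepD[OF el this i] m(1)[OF i] show "c i = 0" by simp
  qed
  moreover have "span (u ` {..<Suc d}) = lift_subspace L"
  proof
    show "span (u ` {..<Suc d}) \<subseteq> lift_subspace L"
      unfolding spanB[symmetric]
    proof (intro span_minimal image_subsetI)
      fix i assume "i \<in> {..<Suc d}"
      then have "e i \<in> B" using e by (auto simp: bij_betw_def)
      then show "u i \<in> span B" by (simp add: u_def span_scale span_base)
    qed simp
    show "lift_subspace L \<subseteq> span (u ` {..<Suc d})"
      unfolding spanB[symmetric]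
    proof (intro span_minimal subsetI)
      fix b assume "b \<in> B"
      then obtain i where i: "i < Suc d" "b = e i" using e by (auto simp: bij_betw_def)
      have "u i \<in> span (u ` {..<Suc d})" using i(1) by (intro span_base) auto
      then have "(1 / of_int (m i)) *\<^sub>R u i \<in> span (u ` {..<Suc d})" by (rule span_scale)
      then show "b \<in> span (u ` {..<Suc d})" using i(2) m(1)[OF i(1)] by (simp add: u_def)
    qed simp
  qed
  moreover have "int_point (u i)" if "i < Suc d" for i using m(2)[OF that] by (simp add: u_def)
  ultimately obtain v where v: "lattice_basis (lift_subspace L) v (Suc d)"
    using lattice_basis_exists[of u "Suc d" "lift_subspace L"] by blast
  show thesis by (rule that[OF v schmidt_height_lattice_basis[OF L(3) v]])
qed

lemma schmidt_height_ge_1: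
  fixes L :: "(real ^ 'n::finite) set"
  assumes "rat_affine_subspace d L" shows "1 \<le> schmidt_height L"
proof -
  obtain v where v: "lattice_basis (lift_subspace L) v (Suc d)" "schmidt_height L = sqrt (gram_det v (Suc d))"
    using rat_affine_subspace_lattice_basis[OF assms] .
  then have "1 \<le> gram_det v (Suc d)"
    by (intro gram_det_ge_1) (auto simp: lattice_basis_iff)
  then show ?thesis using v(2) by simp
qed

lemma closed_rat_affine_subspace:
  fixes L :: "(real ^ 'n::finite) set"
  assumes "rat_affine_subspace d L" shows "closed L" "L \<noteq> {}"
proof -
  have "affine L" and ne: "L \<noteq> {}" using assms unfolding rat_affine_subspace_def by blast+
  then have "affine hull L = L" by (simp only: affine_hull_eq)
  then show "closed L" using closed_affine_hull[of L] by (simp only:)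
  show "L \<noteq> {}" by (rule ne)
qed

section \<open>Dirichlet's theorem for rational affine subspaces\<close>

text \<open>Drop the largest factor repeatedly. If it is at least 1 the product does not grow, and
  otherwise all factors are below 1 and every subproduct is at most 1.\<close>

lemma subset_prod_le:
  fixes f :: "'i \<Rightarrow> real"
  assumes "finite J" "m \<le> card J" "\<And>j. j \<in> J \<Longrightarrow> 0 \<le> f j"
  shows "\<exists>I\<subseteq>J. card I = m \<and> prod f I \<le> max 1 (prod f J)"
  using assms
proof (induction "card J - m" arbitrary: J)
  case 0
  then show ?case by (intro exI[of _ J]) auto
next
  case (Suc l)
  then have "J \<noteq> {}" by auto
  then have "Max (f ` J) \<in> f ` J" using Suc.prems by (intro Max_in) auto
  then obtain x where x: "x \<in> J" "f x = Max (f ` J)" by auto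
  have fx: "f j \<le> f x" if "j \<in> J" for j using x that Suc.prems by simp
  let ?K = "J - {x}"
  have card: "card ?K = card J - 1" using x Suc.prems by simp
  have "\<exists>I\<subseteq>?K. card I = m \<and> prod f I \<le> max 1 (prod f ?K)"
  proof (rule Suc.hyps(1))
    show "l = card ?K - m" "m \<le> card ?K" using Suc.hyps(2) card by auto
  qed (use Suc.prems in auto)
  then obtain I where I: "I \<subseteq> ?K" "card I = m" "prod f I \<le> max 1 (prod f ?K)" by blast
  have "prod f ?K \<le> max 1 (prod f J)"
  proof (cases "1 \<le> f x")
    case True
    have "prod f ?K \<le> f x * prod f ?K"
      using True Suc.prems prod_nonneg[of ?K f] by (simp add: mult_le_cancel_right1)
    also have "\<dots> = prod f J" using x Suc.prems by (simp add: prod.remove)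
    finally show ?thesis by simp
  next
    case False
    then have "f j \<le> 1" if "j \<in> J" for j using fx[OF that] by linarith
    then have "prod f ?K \<le> 1" using Suc.prems by (intro prod_le_1) auto
    then show ?thesis by simp
  qed
  with I(3) have "prod f I \<le> max 1 (prod f J)" by linarith
  with I(1,2) show ?case by blast
qed

lemma subfamily_sum:
  fixes v :: "nat \<Rightarrow> 'a::real_vector"
  assumes "inj_on g {..<k}" "g ` {..<k} \<subseteq> {..<N}"
  shows "(\<Sum>j<k. a j *\<^sub>R v (g j)) =
    (\<Sum>i<N. (if i \<in> g ` {..<k} then a (the_inv_into {..<k} g i) else 0) *\<^sub>R v i)"
proof -
  have "(\<Sum>i<N. (if i \<in> g ` {..<k} then a (the_inv_into {..<k} g i) else 0) *\<^sub>R v i)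
      = (\<Sum>i\<in>g ` {..<k}. a (the_inv_into {..<k} g i) *\<^sub>R v i)"
    using assms(2) by (intro sum.mono_neutral_cong_right) auto
  also have "\<dots> = (\<Sum>j<k. a j *\<^sub>R v (g j))"
    using assms(1) by (simp add: sum.reindex the_inv_into_f_f)
  finally show ?thesis by simp
qed

lemma lin_indep_subfamily:
  assumes "lin_indep v N" "inj_on g {..<k}" "g ` {..<k} \<subseteq> {..<N}"
  shows "lin_indep (v \<circ> g) k"
  unfolding lin_indep_def
proof (intro allI impI)
  fix a i assume "(\<Sum>j<k. a j *\<^sub>R (v \<circ> g) j) = 0" and i: "i < k"
  then have "(\<Sum>i<N. (if i \<in> g ` {..<k} then a (the_inv_into {..<k} g i) else 0) *\<^sub>R v i) = 0"
    using subfamily_sum[OF assms(2,3), of a v] by simp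
  from lin_indepD[OF assms(1) this, of "g i"] show "a i = 0"
    using i assms(2,3) by (auto simp: the_inv_into_f_f split: if_splits)
qed

text \<open>Part of a lattice basis is primitive: by uniqueness of coefficients, a lattice point in
  its real span already has integer coefficients there.\<close>

lemma zspan_subfamily:
  assumes "lin_indep v N" "inj_on g {..<k}" "g ` {..<k} \<subseteq> {..<N}"
    and y: "y \<in> zspan v N" "y \<in> span ((v \<circ> g) ` {..<k})"
  shows "y \<in> zspan (v \<circ> g) k"
proof -
  obtain c :: "nat \<Rightarrow> int" where c: "y = (\<Sum>i<N. of_int (c i) *\<^sub>R v i)" using y(1) by (rule zspanE)
  obtain a where a: "y = (\<Sum>i<k. a i *\<^sub>R (v \<circ> g) i)"
    using in_span_lin_indep[OF lin_indep_subfamily[OF assms(1-3)] y(2)] .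
  have "(\<Sum>i<N. (if i \<in> g ` {..<k} then a (the_inv_into {..<k} g i) else 0) *\<^sub>R v i)
      = (\<Sum>i<N. of_int (c i) *\<^sub>R v i)"
    using subfamily_sum[OF assms(2,3), of a v] a c by simp
  from lin_indep_unique[OF assms(1) this]
  have "(if i \<in> g ` {..<k} then a (the_inv_into {..<k} g i) else 0) = of_int (c i)" if "i < N" for i
    using that .
  then have "a j = of_int (c (g j))" if "j < k" for j
    using that assms(2,3) by (metis image_eqI image_subset_iff lessThan_iff the_inv_into_f_f)
  then show ?thesis using a by (intro zspanI[where c = "c \<circ> g"]) simp
qed

lemma zspan_linear_image:
  assumes "linear S"
  shows "zspan (S \<circ> u) k = S ` zspan u k"
  using assms by (auto simp: zspan_def linear_sum linear_scale) (auto simp: image_iff linear_sum linear_scale)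

lemma lin_indep_linear_image:
  assumes "linear S" "inj S" "lin_indep u k"
  shows "lin_indep (S \<circ> u) k"
  unfolding lin_indep_def
proof (intro allI impI)
  fix c i assume c: "(\<Sum>i<k. c i *\<^sub>R (S \<circ> u) i) = 0" and i: "i < k"
  have "S (\<Sum>i<k. c i *\<^sub>R u i) = S 0"
    using c assms(1) by (simp add: linear_sum linear_scale linear_0)
  then have "(\<Sum>i<k. c i *\<^sub>R u i) = 0" using assms(2) by (simp add: inj_eq)
  then show "c i = 0" using lin_indepD[OF assms(3)] i by blast
qed

lemma perp_diff_scale: "perp b (x - t *\<^sub>R b) = perp b x"
  by (cases "b = 0") (simp_all add: perp_def inner_diff_left diff_divide_distrib algebra_simps)

text \<open>The projection along \<open>v d\<close> does not see multiples of \<open>v d\<close>, so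
  the \<open>t j\<close> are free. They will be chosen to cancel the large component common to all
  the vectors.\<close>

lemma gram_det_Suc_le:
  fixes v :: "nat \<Rightarrow> 'a::real_inner"
  shows "gram_det v (Suc d) \<le> (norm (v d))\<^sup>2 * (\<Prod>j<d. (norm (v j - t j *\<^sub>R v d))\<^sup>2)"
proof -
  have "gram_det (\<lambda>i. perp (v d) (v i)) d \<le> (\<Prod>j<d. (norm (perp (v d) (v j)))\<^sup>2)"
    by (rule gram_det_le)
  also have "\<dots> \<le> (\<Prod>j<d. (norm (v j - t j *\<^sub>R v d))\<^sup>2)"
    using norm_perp_le[of "v d" "v j - t j *\<^sub>R v d" for j]
    by (intro prod_mono) (auto simp: perp_diff_scale intro: power_mono)
  finally show ?thesis by (simp add: gram_det_Suc dot_square_norm mult_left_mono)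
qed

text \<open>The vector \<open>(1, 0)\<close> has the last index so that
  \<open>replace_last_gram\<close> can exchange it for a vector corresponding to
  \<open>(1, \<theta>)\<close>.\<close>

lemma integer_lattice_basis:
  fixes f :: "nat \<Rightarrow> 'n::finite"
  assumes f: "bij_betw f {..<n} UNIV"
  defines "b \<equiv> \<lambda>i. if i < n then (0, axis (f i) 1) else (1 :: real, 0 :: real ^ 'n)"
  shows "lin_indep b (Suc n)" "zspan b (Suc n) = {y. int_point y}"
proof -
  have sum_b: "(\<Sum>i<Suc n. c i *\<^sub>R b i) = (c n, \<chi> j. c (the_inv_into {..<n} f j))" for c
  proof -
    have "(\<Sum>i<n. c i * axis (f i) 1 $ j) = c (the_inv_into {..<n} f j)" for j
    proof -
      have j: "the_inv_into {..<n} f j < n" "f (the_inv_into {..<n} f j) = j"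
        using f the_inv_into_into[of f "{..<n}" j "{..<n}"] f_the_inv_into_f[of f "{..<n}" j]
        by (auto simp: bij_betw_def)
      have "(\<Sum>i<n. c i * axis (f i) 1 $ j) = (\<Sum>i<n. if i = the_inv_into {..<n} f j then c i else 0)"
        using f j(2) by (intro sum.cong) (auto simp: axis_def bij_betw_def the_inv_into_f_f)
      then show ?thesis using j(1) by simp
    qed
    then show ?thesis by (simp add: b_def prod_eq_iff fst_sum snd_sum Finite_Cartesian_Product.vec_eq_iff)
  qed
  have finv: "c (the_inv_into {..<n} f (f i)) = c i" if "i < n" for c :: "nat \<Rightarrow> real" and i
    using f that by (simp add: bij_betw_def the_inv_into_f_f)
  show "lin_indep b (Suc n)"
    unfolding lin_indep_def
  proof (intro allI impI)
    fix c i assume "(\<Sum>i<Suc n. c i *\<^sub>R b i) = 0" and i: "i < Suc n"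
    then have c: "c n = 0" "\<And>j. c (the_inv_into {..<n} f j) = 0"
      unfolding sum_b by (auto simp: prod_eq_iff Finite_Cartesian_Product.vec_eq_iff)
    then show "c i = 0" using i finv[of i c] by (cases "i = n") auto
  qed
  show "zspan b (Suc n) = {y. int_point y}"
  proof (intro equalityI subsetI CollectI)
    fix y assume "y \<in> zspan b (Suc n)"
    then show "int_point y"
      by (rule zspan_int_point[rotated]) (auto simp: b_def int_point_def axis_def)
  next
    fix y :: "real \<times> (real ^ 'n)" assume "y \<in> {y. int_point y}"
    then have y: "fst y \<in> \<int>" "\<And>j. snd y $ j \<in> \<int>" by (auto simp: int_point_def)
    define c where "c i = (if i < n then \<lfloor>snd y $ f i\<rfloor> else \<lfloor>fst y\<rfloor>)" for i
    have "of_int (c (the_inv_into {..<n} f j)) = snd y $ j" for j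
      using f the_inv_into_into[of f "{..<n}" j "{..<n}"] f_the_inv_into_f[of f "{..<n}" j] y(2)[of j]
      by (auto simp: bij_betw_def c_def elim: Ints_cases)
    moreover have "of_int (c n) = fst y" using y(1) by (auto simp: c_def elim: Ints_cases)
    ultimately have "y = (\<Sum>i<Suc n. of_int (c i) *\<^sub>R b i)"
      unfolding sum_b by (simp add: prod_eq_iff Finite_Cartesian_Product.vec_eq_iff)
    then show "y \<in> zspan b (Suc n)" by (rule zspanI)
  qed
qed

text \<open>Minkowski reduction of the image of the integer lattice under the map that contracts the first
  coordinate by the factor \<open>y ^ n\<close> and stretches the distance to the line through \<open>(1, \<theta>)\<close> by \<open>y\<close>:
  the \<open>d + 1\<close> shortest basis vectors span the subspace that is sought.\<close>
lemma short_integer_vectors: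
  fixes \<theta> :: "real ^ 'n::finite"
  assumes d: "d < CARD('n)"
  shows "\<exists>C\<ge>1. \<forall>y>0. \<exists>v w. lattice_basis (span (v ` {..<Suc d})) v (Suc d)
    \<and> (\<forall>i<Suc d. w i \<noteq> 0) \<and> (\<Prod>i<Suc d. norm (w i)) \<le> C
    \<and> (\<forall>i<Suc d. v i = (y ^ CARD('n) * fst (w i), (1 / y) *\<^sub>R snd (w i) + (y ^ CARD('n) * fst (w i)) *\<^sub>R \<theta>))
    \<and> (\<forall>i<Suc d. \<bar>fst (w i)\<bar> * norm (w d) \<le> \<bar>fst (w d)\<bar> * norm (w i))"
proof -
  define n where "n = CARD('n)"
  obtain C0 where C0: "C0 > 0" and red: "\<And>v :: nat \<Rightarrow> real \<times> (real ^ 'n). lin_indep v (Suc n) \<Longrightarrow>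
     \<exists>u. lin_indep u (Suc n) \<and> zspan u (Suc n) = zspan v (Suc n) \<and>
       (\<Prod>i<Suc n. (norm (u i))\<^sup>2) \<le> C0 * gram_det v (Suc n)"
    using reduced_basis[of "Suc n", where 'a = "real \<times> (real ^ 'n)"] by blast
  obtain f :: "nat \<Rightarrow> 'n" where f: "bij_betw f {..<n} UNIV"
    using ex_bij_betw_nat_finite[of "UNIV :: 'n set"] by (auto simp: n_def atLeast0LessThan)
  define b where "b = (\<lambda>i. if i < n then (0, axis (f i) 1) else (1 :: real, 0 :: real ^ 'n))"
  note b = integer_lattice_basis[OF f, folded b_def]
  have main: "\<exists>v w. lattice_basis (span (v ` {..<Suc d})) v (Suc d)
    \<and> (\<forall>i<Suc d. w i \<noteq> 0) \<and> (\<Prod>i<Suc d. norm (w i)) \<le> max 1 C0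
    \<and> (\<forall>i<Suc d. v i = (y ^ n * fst (w i), (1 / y) *\<^sub>R snd (w i) + (y ^ n * fst (w i)) *\<^sub>R \<theta>))
    \<and> (\<forall>i<Suc d. \<bar>fst (w i)\<bar> * norm (w d) \<le> \<bar>fst (w d)\<bar> * norm (w i))" if y: "y > 0" for y
  proof -
    \<comment> \<open>\<open>T\<close> preserves volume, since \<open>1 / y ^ n\<close> in the first
      coordinate balances the factor \<open>y\<close> in the \<open>n\<close> others;
      \<open>S\<close> is its inverse and carries short vectors back to integer points.\<close>
    define T where "T x = (fst x / y ^ n, y *\<^sub>R (snd x - fst x *\<^sub>R \<theta>))" for x :: "real \<times> (real ^ 'n)"
    define S where "S x = (y ^ n * fst x, (1 / y) *\<^sub>R snd x + (y ^ n * fst x) *\<^sub>R \<theta>)" for x :: "real \<times> (real ^ 'n)"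
    have lin: "linear T" "linear S"
      by (auto intro!: linearI simp: T_def S_def algebra_simps add_divide_distrib)
    have ST: "S (T x) = x" and TS: "T (S x) = x" for x
      using y by (simp_all add: S_def T_def prod_eq_iff scaleR_diff_right)
    have injT: "inj T" and injS: "inj S" using ST TS by (metis injI)+
    define e where "e = T \<circ> b"
    have e: "lin_indep e (Suc n)" unfolding e_def using lin(1) injT b(1) by (rule lin_indep_linear_image)
    have gram: "gram_det e (Suc n) \<le> 1"
    proof -
      \<comment> \<open>These coefficients, with 1 in the last place, express
        \<open>(1, \<theta>)\<close>, whose image under \<open>T\<close> is
        \<open>(1 / y ^ n, 0)\<close>. The other images have length \<open>y\<close>, so Hadamard's
        inequality bounds the Gram determinant by 1.\<close>
      define c where "c i = (if i < n then \<theta> $ f i else 1)" for i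
      define e' where "e' = e(n := (\<Sum>j<Suc n. c j *\<^sub>R e j))"
      have "(\<Sum>j<Suc n. c j *\<^sub>R e j) = T (\<Sum>j<Suc n. c j *\<^sub>R b j)"
        using lin(1) by (simp add: e_def linear_sum linear_scale linear_add)
      also have "(\<Sum>j<Suc n. c j *\<^sub>R b j) = (1, \<theta>)"
      proof -
        have "(\<Sum>j<n. \<theta> $ f j *\<^sub>R axis (f j) 1) = (\<Sum>i\<in>UNIV. \<theta> $ i *\<^sub>R axis i (1 :: real))"
          using f by (rule sum.reindex_bij_betw)
        also have "\<dots> = \<theta>" using basis_expansion[of \<theta>] by (simp add: scalar_mult_eq_scaleR)
        finally show ?thesis by (simp add: c_def b_def prod_eq_iff fst_sum snd_sum)
      qed
      finally have last: "e' n = (1 / y ^ n, 0)" by (simp add: e'_def T_def)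
      have ei: "norm (e' i) = y" if "i < n" for i
        using that y by (simp add: e'_def e_def b_def T_def norm_Pair)
      have "gram_det e (Suc n) = gram_det e' (Suc n)"
        using replace_last_gram(2)[OF e, of c] by (simp add: e'_def c_def)
      also have "\<dots> \<le> (\<Prod>i<Suc n. (norm (e' i))\<^sup>2)" by (rule gram_det_le)
      also have "\<dots> = (\<Prod>i<n. y\<^sup>2) * (1 / y ^ n)\<^sup>2"
        using last ei y by (simp add: norm_Pair)
      also have "\<dots> = 1" using y by (simp add: power_divide flip: power_mult) (simp add: mult.commute)
      finally show ?thesis .
    qed
    obtain u where u: "lin_indep u (Suc n)" "zspan u (Suc n) = zspan e (Suc n)"
      "(\<Prod>i<Suc n. (norm (u i))\<^sup>2) \<le> C0 * gram_det e (Suc n)"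
      using red[OF e] by blast
    have "(\<Prod>i<Suc n. (norm (u i))\<^sup>2) \<le> C0"
      using u(3) gram C0 by (smt (verit) mult_left_le)
    moreover obtain J where J: "J \<subseteq> {..<Suc n}" "card J = Suc d"
      "(\<Prod>i\<in>J. (norm (u i))\<^sup>2) \<le> max 1 (\<Prod>i<Suc n. (norm (u i))\<^sup>2)"
      using subset_prod_le[of "{..<Suc n}" "Suc d" "\<lambda>i. (norm (u i))\<^sup>2"] d by (auto simp: n_def)
    ultimately have PJ: "(\<Prod>i\<in>J. (norm (u i))\<^sup>2) \<le> max 1 C0" by linarith
    have finJ: "finite J" using J(1) finite_subset by blast
    then obtain g0 where g0: "bij_betw g0 {..<Suc d} J"
      using ex_bij_betw_nat_finite[of J] J(2) by (auto simp: atLeast0LessThan)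
    \<comment> \<open>The vector of steepest slope towards the first coordinate is moved to index
      \<open>d\<close>. Multiples of it no longer than the other vectors then clear the first
      coordinates of those.\<close>
    define r where "r i = \<bar>fst (u (g0 i))\<bar> / norm (u (g0 i))" for i
    have "Max (r ` {..<Suc d}) \<in> r ` {..<Suc d}" by (intro Max_in) auto
    then obtain i0 where i0: "i0 < Suc d" "r i0 = Max (r ` {..<Suc d})" by auto
    then have rmax: "r i \<le> r i0" if "i < Suc d" for i using that by simp
    define g where "g = g0 \<circ> Transposition.transpose i0 d"
    have \<tau>: "Transposition.transpose i0 d i < Suc d" if "i < Suc d" for i
      using i0 that by (auto simp: Transposition.transpose_def)
    have "bij_betw (Transposition.transpose i0 d) {..<Suc d} {..<Suc d}"
      using \<tau> by (intro bij_betwI[where g = "Transposition.transpose i0 d"]) auto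
    then have g: "bij_betw g {..<Suc d} J" unfolding g_def using g0 by (rule bij_betw_trans)
    have ginj: "inj_on g {..<Suc d}" "g ` {..<Suc d} \<subseteq> {..<Suc n}"
      using g J(1) by (auto simp: bij_betw_def)
    define w where "w = u \<circ> g"
    define v where "v = (S \<circ> u) \<circ> g"
    have wd: "w d = u (g0 i0)" by (simp add: w_def g_def)
    have wi: "w i = u (g0 (Transposition.transpose i0 d i))" for i by (simp add: w_def g_def)
    have w0: "w i \<noteq> 0" if "i < Suc d" for i
      using lin_indep_nonzero[OF lin_indep_subfamily[OF u(1) ginj] that] by (simp add: w_def)
    have Su: "lin_indep (S \<circ> u) (Suc n)" "zspan (S \<circ> u) (Suc n) = {y. int_point y}"
    proof -
      show "lin_indep (S \<circ> u) (Suc n)" using lin(2) injS u(1) by (rule lin_indep_linear_image)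
      have "zspan (S \<circ> u) (Suc n) = zspan (S \<circ> e) (Suc n)"
        using u(2) lin(2) by (simp add: zspan_linear_image)
      also have "S \<circ> e = b" by (simp add: e_def fun_eq_iff ST)
      finally show "zspan (S \<circ> u) (Suc n) = {y. int_point y}" by (simp only: b(2))
    qed
    have v_int: "int_point (v i)" if "i < Suc d" for i
      using zspan_base[of "g i" "Suc n" "S \<circ> u"] Su(2) ginj(2) that by (auto simp: v_def)
    have v_lin: "lin_indep v (Suc d)" unfolding v_def by (rule lin_indep_subfamily[OF Su(1) ginj])
    have "lattice_basis (span (v ` {..<Suc d})) v (Suc d)"
      unfolding lattice_basis_iff
    proof (intro conjI equalityI subsetI CollectI allI impI)
      fix x assume x: "x \<in> {x \<in> span (v ` {..<Suc d}). int_point x}"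
      then show "x \<in> zspan v (Suc d)"
        unfolding v_def using zspan_subfamily[OF Su(1) ginj, of x] Su(2) by auto
    next
      fix x assume x: "x \<in> zspan v (Suc d)"
      then show "x \<in> span (v ` {..<Suc d})" using zspan_subset_span by blast
      show "int_point x" using x v_int by (rule zspan_int_point[rotated])
    qed (use v_int v_lin in auto)
    moreover have "(\<Prod>i<Suc d. norm (w i)) \<le> max 1 C0"
    proof -
      have "(\<Prod>i<Suc d. norm (w i))\<^sup>2 = (\<Prod>i<Suc d. (norm (u (g i)))\<^sup>2)"
        by (simp add: prod_power_distrib w_def power_mult_distrib)
      also have "\<dots> = (\<Prod>i\<in>J. (norm (u i))\<^sup>2)" using g by (rule prod.reindex_bij_betw)
      also have "\<dots> \<le> max 1 C0" by (rule PJ)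
      also have "\<dots> \<le> (max 1 C0)\<^sup>2" by (rule self_le_power) auto
      finally show ?thesis by (rule power2_le_imp_le) simp
    qed
    moreover have "\<bar>fst (w i)\<bar> * norm (w d) \<le> \<bar>fst (w d)\<bar> * norm (w i)" if "i < Suc d" for i
    proof -
      have "\<bar>fst (w i)\<bar> / norm (w i) \<le> \<bar>fst (w d)\<bar> / norm (w d)"
        using rmax[OF \<tau>[OF that]] unfolding r_def wd wi[of i] .
      then show ?thesis using w0[OF that] w0[of d] by (simp add: field_simps)
    qed
    moreover have "v i = (y ^ n * fst (w i), (1 / y) *\<^sub>R snd (w i) + (y ^ n * fst (w i)) *\<^sub>R \<theta>)" for i
      by (simp add: v_def w_def S_def)
    ultimately show ?thesis using w0 by blast
  qed
  then show ?thesis unfolding n_def by (intro exI[of _ "max 1 C0"]) auto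
qed

text \<open>Once first coordinates are cleared by multiples of \<open>v d\<close>, each of the other
  \<open>d\<close> vectors shrinks by \<open>1 / y\<close>, while \<open>v d\<close> has length at
  most about \<open>y ^ n\<close>; this gives height \<open>y ^ (n - d)\<close>. Scaled to first
  coordinate 1, \<open>v d\<close> is a point of the subspace close to
  \<open>\<theta>\<close>.\<close>

lemma dirichlet_subspace:
  fixes \<theta> :: "real ^ 'n::finite"
  assumes d: "d < CARD('n)"
  shows "\<exists>C\<ge>1. \<forall>y>C. \<exists>L. rat_affine_subspace d L \<and> schmidt_height L \<le> C * y ^ (CARD('n) - d)
    \<and> schmidt_height L * infdist \<theta> L \<le> C / y ^ Suc d"
proof -
  obtain C1 where C1: "C1 \<ge> 1" and vec: "\<And>y. y > 0 \<Longrightarrow> \<exists>v w. lattice_basis (span (v ` {..<Suc d})) v (Suc d)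
    \<and> (\<forall>i<Suc d. w i \<noteq> 0) \<and> (\<Prod>i<Suc d. norm (w i)) \<le> C1
    \<and> (\<forall>i<Suc d. v i = (y ^ CARD('n) * fst (w i), (1 / y) *\<^sub>R snd (w i) + (y ^ CARD('n) * fst (w i)) *\<^sub>R \<theta>))
    \<and> (\<forall>i<Suc d. \<bar>fst (w i)\<bar> * norm (w d) \<le> \<bar>fst (w d)\<bar> * norm (w i))"
    using short_integer_vectors[OF d, of \<theta>] by blast
  define n where "n = CARD('n)"
  \<comment> \<open>The factors come from the length of \<open>v d\<close>, from the
    \<open>d\<close> cleared vectors and from the product of norms. For \<open>y > C\<close> the
    quantity \<open>C / y ^ Suc d\<close> is below 1, the least possible height.\<close>
  define C where "C = (2 + norm \<theta>) * 2 ^ d * C1"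
  have "1 * 1 \<le> (2 + norm \<theta>) * 2 ^ d" by (intro mult_mono) auto
  then have "1 * 1 \<le> ((2 + norm \<theta>) * 2 ^ d) * C1" using C1 by (intro mult_mono) auto
  then have C: "C \<ge> 1" by (simp add: C_def)
  have "\<exists>L. rat_affine_subspace d L \<and> schmidt_height L \<le> C * y ^ (n - d)
    \<and> schmidt_height L * infdist \<theta> L \<le> C / y ^ Suc d" if yC: "y > C" for y
  proof -
    have y: "y > 1" "y > 0" using C yC by auto
    obtain v w where lb: "lattice_basis (span (v ` {..<Suc d})) v (Suc d)"
      and w0: "\<And>i. i < Suc d \<Longrightarrow> w i \<noteq> 0" and P: "(\<Prod>i<Suc d. norm (w i)) \<le> C1"
      and vw: "\<And>i. i < Suc d \<Longrightarrow> v i = (y ^ n * fst (w i), (1 / y) *\<^sub>R snd (w i) + (y ^ n * fst (w i)) *\<^sub>R \<theta>)"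
      and wmax: "\<And>i. i < Suc d \<Longrightarrow> \<bar>fst (w i)\<bar> * norm (w d) \<le> \<bar>fst (w d)\<bar> * norm (w i)"
      using vec[OF y(2)] unfolding n_def by blast
    have v: "\<And>i. i < Suc d \<Longrightarrow> int_point (v i)" "lin_indep v (Suc d)"
      using lb by (auto simp: lattice_basis_iff)
    define h where "h = sqrt (gram_det v (Suc d))"
    have h1: "h \<ge> 1" using gram_det_ge_1[of "Suc d" v] v by (simp add: h_def)
    define t where "t j = fst (w j) / fst (w d)" for j
    have diff: "norm (v j - t j *\<^sub>R v d) \<le> 2 / y * norm (w j)" if j: "j < d" for j
    proof -
      \<comment> \<open>If \<open>fst (w d) = 0\<close>, the maximality of its slope gives
        \<open>fst (w j) = 0\<close>, and \<open>t j = 0\<close> by the division convention.\<close>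
      have fz: "fst (w j) = t j * fst (w d)"
        using wmax[of j] j w0[of d] by (cases "fst (w d) = 0") (auto simp: t_def mult_le_0_iff)
      have "\<bar>t j\<bar> * norm (w d) \<le> norm (w j)"
        using wmax[of j] j by (cases "fst (w d) = 0") (auto simp: t_def abs_divide field_simps)
      then have "norm (snd (w j) - t j *\<^sub>R snd (w d)) \<le> 2 * norm (w j)"
        using norm_triangle_ineq4[of "snd (w j)" "t j *\<^sub>R snd (w d)"]
          norm_snd_le[of "snd (w j)" "fst (w j)"] norm_snd_le[of "snd (w d)" "fst (w d)"]
          mult_left_mono[of "norm (snd (w d))" "norm (w d)" "\<bar>t j\<bar>"] by simp
      then have le: "1 / y * norm (snd (w j) - t j *\<^sub>R snd (w d)) \<le> 1 / y * (2 * norm (w j))"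
        using y by (intro mult_left_mono) auto
      have E: "v j - t j *\<^sub>R v d = (0, (1 / y) *\<^sub>R (snd (w j) - t j *\<^sub>R snd (w d)))"
        using j vw[of j] vw[of d] fz by (simp add: prod_eq_iff algebra_simps)
      show ?thesis unfolding E using y le by (simp add: norm_Pair)
    qed
    define Pd where "Pd = (\<Prod>j<d. norm (w j))"
    have Pd0: "Pd \<ge> 0" unfolding Pd_def by (intro prod_nonneg) auto
    have "h\<^sup>2 \<le> (norm (v d) * ((2 / y) ^ d * Pd))\<^sup>2"
    proof -
      have "h\<^sup>2 = gram_det v (Suc d)" using gram_det_nonneg by (simp add: h_def)
      also have "\<dots> \<le> (norm (v d))\<^sup>2 * (\<Prod>j<d. (norm (v j - t j *\<^sub>R v d))\<^sup>2)" by (rule gram_det_Suc_le)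
      also have "\<dots> \<le> (norm (v d))\<^sup>2 * (\<Prod>j<d. (2 / y * norm (w j))\<^sup>2)"
        using diff by (intro mult_left_mono prod_mono) (auto intro: power_mono)
      also have "(\<Prod>j<d. (2 / y * norm (w j))\<^sup>2) = ((2 / y) ^ d * Pd)\<^sup>2"
        by (simp only: prod_power_distrib[symmetric] prod.distrib prod_constant card_lessThan Pd_def)
      finally show ?thesis by (simp add: power_mult_distrib)
    qed
    then have hle: "h \<le> norm (v d) * ((2 / y) ^ d * Pd)"
      by (rule power2_le_imp_le) (use y Pd0 in auto)
    define K where "K = (2 / y) ^ d * C1"
    have K0: "K \<ge> 0" using C1 y by (simp add: K_def)
    have hK: "h \<le> M * K" if M: "norm (v d) \<le> M * norm (w d)" "0 \<le> M" for M
    proof -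
      have "h \<le> (M * norm (w d)) * ((2 / y) ^ d * Pd)"
        using hle M y Pd0 by (elim order_trans) (intro mult_right_mono, auto)
      also have "\<dots> = M * (2 / y) ^ d * (Pd * norm (w d))" by simp
      also have "\<dots> \<le> M * (2 / y) ^ d * C1"
        using P M y by (intro mult_left_mono) (auto simp: Pd_def)
      finally show ?thesis by (simp add: K_def)
    qed
    define a q where "a = fst (w d)" and "q = snd (w d)"
    have aq: "\<bar>a\<bar> \<le> norm (w d)" "norm q \<le> norm (w d)"
      using norm_fst_le[of a q] norm_snd_le[of q a] by (auto simp: a_def q_def)
    have vd: "v d = (y ^ n * a, (1 / y) *\<^sub>R q + (y ^ n * a) *\<^sub>R \<theta>)" using vw[of d] by (simp add: a_def q_def)
    have nvd: "norm (v d) \<le> y ^ n * \<bar>a\<bar> * (1 + norm \<theta>) + norm q / y"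
    proof -
      have "v d = (y ^ n * a, (y ^ n * a) *\<^sub>R \<theta>) + (0, (1 / y) *\<^sub>R q)" by (simp add: vd)
      also have "norm \<dots> \<le> norm (y ^ n * a, (y ^ n * a) *\<^sub>R \<theta>) + norm (0 :: real, (1 / y) *\<^sub>R q)"
        by (rule norm_triangle_ineq)
      also have "norm (y ^ n * a, (y ^ n * a) *\<^sub>R \<theta>) \<le> norm (y ^ n * a) + norm ((y ^ n * a) *\<^sub>R \<theta>)"
        by (rule norm_Pair_le)
      finally show ?thesis using y by (simp add: norm_Pair abs_mult algebra_simps)
    qed
    have yn1: "1 \<le> y ^ n" using y by simp
    \<comment> \<open>Otherwise \<open>v d\<close> would also be of size about
      \<open>norm (w d) / y\<close> and the height would drop below 1. This is what keeps the
      subspace from lying at infinity.\<close>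
    have big: "norm q / y \<le> y ^ n * \<bar>a\<bar>"
    proof (rule ccontr)
      assume "\<not> norm q / y \<le> y ^ n * \<bar>a\<bar>"
      then have "y ^ n * \<bar>a\<bar> * (1 + norm \<theta>) \<le> norm q / y * (1 + norm \<theta>)" by (intro mult_right_mono) auto
      moreover have "(2 + norm \<theta>) * (norm q / y) = norm q / y * (1 + norm \<theta>) + norm q / y"
        by (metis add.commute add.assoc distrib_left mult.commute mult.right_neutral one_add_one)
      ultimately have "norm (v d) \<le> (2 + norm \<theta>) * (norm q / y)" using nvd by linarith
      also have "\<dots> \<le> (2 + norm \<theta>) * (norm (w d) / y)" using aq y by (intro mult_left_mono divide_right_mono) auto
      finally have "h \<le> (2 + norm \<theta>) / y * K" using y by (intro hK) (auto simp: field_simps)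
      also have "\<dots> = C / y ^ Suc d" by (simp add: K_def C_def power_divide field_simps)
      also have "\<dots> \<le> C / y" using y C by (intro divide_left_mono) (auto simp: self_le_power)
      also have "\<dots> < 1" using y yC by simp
      finally show False using h1 by simp
    qed
    have "y ^ n * \<bar>a\<bar> * (2 + norm \<theta>) = y ^ n * \<bar>a\<bar> * (1 + norm \<theta>) + y ^ n * \<bar>a\<bar>"
      by (simp add: algebra_simps)
    then have nvd2: "norm (v d) \<le> y ^ n * \<bar>a\<bar> * (2 + norm \<theta>)" using nvd big by linarith
    have a0: "a \<noteq> 0"
    proof
      assume "a = 0"
      then have "norm q \<le> 0" using big y by (simp add: field_simps)
      then have "w d = 0" using \<open>a = 0\<close> by (simp add: a_def q_def prod_eq_iff)
      then show False using w0[of d] by simp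
    qed
    define L where "L = slice (span (v ` {..<Suc d}))"
    have L: "rat_affine_subspace d L" "lift_subspace L = span (v ` {..<Suc d})"
      using rat_affine_subspace_slice[of v d d] v vd a0 y by (simp_all add: L_def)
    have "aff_dim L = int d" using L(1) by (simp add: rat_affine_subspace_def)
    then have hL: "schmidt_height L = h"
      unfolding h_def using lb L(2) by (intro schmidt_height_lattice_basis) simp_all
    have "h \<le> C * y ^ (n - d)"
    proof -
      have "norm (v d) \<le> y ^ n * \<bar>a\<bar> * (2 + norm \<theta>)" by (rule nvd2)
      also have "\<dots> \<le> y ^ n * norm (w d) * (2 + norm \<theta>)"
        using aq y by (intro mult_right_mono mult_left_mono) auto
      finally have "h \<le> (y ^ n * (2 + norm \<theta>)) * K" using y by (intro hK) (auto simp: ac_simps)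
      also have "\<dots> = C * (y ^ n / y ^ d)" by (simp add: K_def C_def power_divide)
      also have "y ^ n / y ^ d = y ^ (n - d)" using y d by (simp add: power_diff n_def)
      finally show ?thesis .
    qed
    moreover have "h * infdist \<theta> L \<le> C / y ^ Suc d"
    proof -
      define p where "p = \<theta> + (1 / (y ^ Suc n * a)) *\<^sub>R q"
      have "(1, p) = (1 / (y ^ n * a)) *\<^sub>R v d"
        using y a0 by (simp add: vd p_def prod_eq_iff scaleR_add_right)
      moreover have "v d \<in> span (v ` {..<Suc d})" by (intro span_base) auto
      ultimately have "p \<in> L" by (simp add: L_def slice_def span_scale)
      then have "infdist \<theta> L \<le> dist \<theta> p" by (rule infdist_le)
      also have "\<dots> = norm q / (y ^ Suc n * \<bar>a\<bar>)" using y by (simp add: p_def dist_norm abs_mult)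
      also have "\<dots> \<le> norm (w d) / (y ^ Suc n * \<bar>a\<bar>)" using aq y by (intro divide_right_mono) auto
      finally have id: "infdist \<theta> L \<le> norm (w d) / (y ^ Suc n * \<bar>a\<bar>)" .
      have nw: "norm (w d) > 0" using w0[of d] by simp
      have "norm (v d) \<le> (y ^ n * \<bar>a\<bar> * (2 + norm \<theta>) / norm (w d)) * norm (w d)"
        using nvd2 nw by simp
      then have "h \<le> (y ^ n * \<bar>a\<bar> * (2 + norm \<theta>) / norm (w d)) * K"
        using y by (intro hK) auto
      then have "h * infdist \<theta> L \<le> ((y ^ n * \<bar>a\<bar> * (2 + norm \<theta>) / norm (w d)) * K) * (norm (w d) / (y ^ Suc n * \<bar>a\<bar>))"
        using id h1 K0 y by (intro mult_mono) (auto simp: infdist_nonneg)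
      also have "\<dots> = C / y ^ Suc d"
        using nw a0 y by (simp add: K_def C_def power_divide field_simps)
      finally show ?thesis .
    qed
    ultimately show ?thesis using L(1) hL by auto
  qed
  then show ?thesis using C unfolding n_def by blast
qed

section \<open>The upper bound\<close>

lemma sum_int_powr_bounded:
  assumes "1 < \<sigma>"
  shows "\<exists>M\<ge>0. \<forall>A :: int set. finite A \<longrightarrow> (\<Sum>k\<in>A. (1 + \<bar>real_of_int k\<bar>) powr - \<sigma>) \<le> M"
proof -
  define g where "g m = (1 + real m) powr - \<sigma>" for m
  have "summable (\<lambda>m. real (Suc m) powr - \<sigma>)"
    using assms summable_real_powr_iff[of "- \<sigma>"] by (subst summable_Suc_iff) simp
  then have g: "summable g" by (simp add: g_def[abs_def] add.commute)
  have half: "(\<Sum>k\<in>A. (1 + \<bar>real_of_int k\<bar>) powr - \<sigma>) \<le> suminf g"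
    if A: "finite A" "inj_on (\<lambda>k. nat \<bar>k\<bar>) A" for A :: "int set"
  proof -
    have "(\<Sum>k\<in>A. (1 + \<bar>real_of_int k\<bar>) powr - \<sigma>) = (\<Sum>m\<in>(\<lambda>k. nat \<bar>k\<bar>) ` A. g m)"
      using A(2) by (simp add: sum.reindex g_def)
    also have "\<dots> \<le> suminf g" using A(1) by (intro sum_le_suminf g) (auto simp: g_def)
    finally show ?thesis .
  qed
  show ?thesis
  proof (intro exI[of _ "2 * suminf g"] conjI allI impI)
    show "0 \<le> 2 * suminf g" using g by (auto intro!: suminf_nonneg simp: g_def)
    fix A :: "int set" assume A: "finite A"
    have "(\<Sum>k\<in>A. (1 + \<bar>real_of_int k\<bar>) powr - \<sigma>)
        = (\<Sum>k\<in>A \<inter> {0..}. (1 + \<bar>real_of_int k\<bar>) powr - \<sigma>) + (\<Sum>k\<in>A \<inter> - {0..}. (1 + \<bar>real_of_int k\<bar>) powr - \<sigma>)"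
      using A by (subst sum.union_disjoint[symmetric]) (auto intro!: sum.cong)
    also have "\<dots> \<le> suminf g + suminf g"
      using A by (intro add_mono half) (auto intro!: inj_onI)
    finally show "(\<Sum>k\<in>A. (1 + \<bar>real_of_int k\<bar>) powr - \<sigma>) \<le> 2 * suminf g" by simp
  qed
qed

text \<open>Finitely many tuples lie in a box, over which the sum factorises into one-dimensional
  sums that are bounded independently of the box.\<close>

lemma summable_int_tuples:
  assumes J: "finite J" and \<sigma>: "1 < \<sigma>"
  shows "(\<lambda>k. \<Prod>j\<in>J. (1 + \<bar>real_of_int (k j)\<bar>) powr - \<sigma>) summable_on (PiE J (\<lambda>_. UNIV))"
proof (rule nonneg_bdd_above_summable_on)
  obtain M where M: "M \<ge> 0" "\<And>A :: int set. finite A \<Longrightarrow> (\<Sum>k\<in>A. (1 + \<bar>real_of_int k\<bar>) powr - \<sigma>) \<le> M"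
    using sum_int_powr_bounded[OF \<sigma>] by blast
  let ?f = "\<lambda>k. \<Prod>j\<in>J. (1 + \<bar>real_of_int (k j)\<bar>) powr - \<sigma>"
  show "bdd_above (sum ?f ` {F. F \<subseteq> PiE J (\<lambda>_. UNIV) \<and> finite F})"
  proof (rule bdd_aboveI2[where M = "M ^ card J"])
    fix F assume "F \<in> {F. F \<subseteq> PiE J (\<lambda>_. UNIV :: int set) \<and> finite F}"
    then have F: "F \<subseteq> PiE J (\<lambda>_. UNIV)" "finite F" by auto
    define B where "B = (\<Union>k\<in>F. k ` J)"
    have B: "finite B" using F J by (simp add: B_def)
    have "F \<subseteq> PiE J (\<lambda>_. B)" using F(1) by (auto simp: B_def PiE_iff)
    then have "sum ?f F \<le> sum ?f (PiE J (\<lambda>_. B))"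
      using B J by (intro sum_mono2 finite_PiE) (auto intro!: prod_nonneg)
    also have "\<dots> = (\<Prod>j\<in>J. \<Sum>k\<in>B. (1 + \<bar>real_of_int k\<bar>) powr - \<sigma>)"
      using B J by (intro prod_sum_PiE[symmetric]) auto
    also have "\<dots> \<le> (\<Prod>j\<in>J. M)" using M(2)[OF B] by (intro prod_mono) (auto intro!: sum_nonneg)
    finally show "sum ?f F \<le> M ^ card J" by simp
  qed
qed (auto intro!: prod_nonneg)

section \<open>Covers of tubes around affine subspaces\<close>

lemma hcover_mono: "hcover s A c \<Longrightarrow> c \<le> c' \<Longrightarrow> hcover s A c'"
  unfolding hcover_def by (meson ennreal_leI order_trans)

text \<open>A grid of mesh \<open>r\<close> in orthonormal coordinates of \<open>L\<close> supplies
  the centres. The constant depends on \<open>s\<close>, \<open>d\<close> and \<open>R\<close> but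
  on neither \<open>L\<close> nor \<open>r\<close>, as the later sum over all subspaces
  requires.\<close>

lemma subspace_tube_cover:
  fixes L :: "'a::euclidean_space set"
  assumes s: "0 < s"
  shows "\<exists>K>0. \<forall>L :: 'a set. \<forall>r. affine L \<longrightarrow> closed L \<longrightarrow> L \<noteq> {} \<longrightarrow> aff_dim L = int d \<longrightarrow> 0 < r \<longrightarrow> r \<le> 1 \<longrightarrow>
    hcover s {x \<in> cball 0 R. infdist x L \<le> r} (K * r powr (s - real d))"
proof -
  define T where "T = 2 * \<bar>R\<bar> + 2"
  define K where "K = (2 * T + 5) ^ d * (2 * (real d + 1)) powr s"
  have T: "T > 0" by (simp add: T_def)
  have K: "K > 0" using T by (simp add: K_def)
  have "hcover s {x \<in> cball 0 R. infdist x L \<le> r} (K * r powr (s - real d))"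
    if L: "affine L" "closed L" "L \<noteq> {}" "aff_dim L = int d" and r: "0 < r" "r \<le> 1" for L :: "'a set" and r
  proof (cases "{x \<in> cball 0 R. infdist x L \<le> r} = {}")
    case True
    have "hcover s ({} :: 'a set) (card ({} :: 'a set set) * r powr s)" using s by (intro hcover_finite) auto
    then have "hcover s ({} :: 'a set) 0" by simp
    moreover have "0 \<le> K * r powr (s - real d)" using K by simp
    ultimately show ?thesis unfolding True by (rule hcover_mono)
  next
    case False
    have near: "\<exists>q\<in>L. dist x q \<le> r \<and> norm q \<le> \<bar>R\<bar> + 1" if "x \<in> cball 0 R" "infdist x L \<le> r" for x
    proof -
      obtain q where q: "q \<in> L" "infdist x L = dist x q"
        using infdist_attains_inf[OF L(2,3), of x] by blast
      have "norm q \<le> norm x + dist x q" by (metis dist_norm norm_triangle_sub dist_commute add.commute)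
      then show ?thesis using q that r(2) by (intro bexI[of _ q]) auto
    qed
    then obtain q1 where q1: "q1 \<in> L" "norm q1 \<le> \<bar>R\<bar> + 1" using False by blast
    define V where "V = (\<lambda>x. x - q1) ` L"
    have subV: "subspace V" unfolding V_def using affine_diffs_subspace_subtract[OF L(1) q1(1)] .
    have "V = (+) (- q1) ` L" by (auto simp: V_def)
    then have dimV: "dim V = d" using L(4) aff_dim_eq_dim[of q1 L] q1(1) by (simp add: hull_inc)
    obtain B where B: "B \<subseteq> V" "pairwise orthogonal B" "\<And>e. e \<in> B \<Longrightarrow> norm e = 1" "independent B"
      "card B = dim V" "span B = V"
      using orthonormal_basis_subspace[OF subV] by metis
    have finB: "finite B" using B(4) independent_imp_finite by blast
    define m where "m = \<lceil>T / r\<rceil> + 1"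
    define c where "c k = q1 + (\<Sum>e\<in>B. (r * of_int (k e)) *\<^sub>R e)" for k :: "'a \<Rightarrow> int"
    \<comment> \<open>Rounding the coordinates costs at most \<open>d * r\<close> and the passage
      from the tube to \<open>L\<close> another \<open>r\<close>.\<close>
    define \<C> where "\<C> = (\<lambda>k. cball (c k) ((real d + 1) * r)) ` (PiE B (\<lambda>_. {- m..m}))"
    have fin: "finite \<C>" unfolding \<C>_def using finB by (intro finite_imageI finite_PiE) auto
    have "{x \<in> cball 0 R. infdist x L \<le> r} \<subseteq> \<Union>\<C>"
    proof
      fix x assume "x \<in> {x \<in> cball 0 R. infdist x L \<le> r}"
      then obtain q where q: "q \<in> L" "dist x q \<le> r" "norm q \<le> \<bar>R\<bar> + 1" using near by blast
      define k where "k = restrict (\<lambda>e. \<lfloor>(q - q1) \<bullet> e / r\<rfloor>) B"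
      have qT: "norm (q - q1) \<le> T" using norm_triangle_ineq4[of q q1] q q1 by (simp add: T_def)
      have kB: "k \<in> PiE B (\<lambda>_. {- m..m})"
      proof (rule PiE_I)
        fix e assume e: "e \<in> B"
        have "\<bar>(q - q1) \<bullet> e\<bar> \<le> T" using Cauchy_Schwarz_ineq2[of "q - q1" e] B(3)[OF e] qT by simp
        then have "\<bar>(q - q1) \<bullet> e / r\<bar> \<le> T / r" using r by (simp add: abs_divide divide_right_mono)
        then have "(q - q1) \<bullet> e / r \<le> of_int \<lceil>T / r\<rceil>" "- of_int \<lceil>T / r\<rceil> \<le> (q - q1) \<bullet> e / r"
          using le_of_int_ceiling[of "T / r"] by linarith+
        then show "k e \<in> {- m..m}" using e unfolding k_def m_def by (simp add: floor_le_iff le_floor_iff)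
      qed (simp add: k_def)
      have "q - q1 \<in> span B" using q(1) B(6) by (auto simp: V_def)
      then have "(\<Sum>e\<in>B. ((q - q1) \<bullet> e) *\<^sub>R e) = q - q1"
        using B finB by (intro orthonormal_basis_expand) auto
      then have "q - c k = (\<Sum>e\<in>B. ((q - q1) \<bullet> e - r * of_int (k e)) *\<^sub>R e)"
        by (simp add: c_def scaleR_diff_left sum_subtractf)
      also have "norm \<dots> \<le> (\<Sum>e\<in>B. norm (((q - q1) \<bullet> e - r * of_int (k e)) *\<^sub>R e))" by (rule norm_sum)
      also have "\<dots> \<le> (\<Sum>e\<in>B. r)"
      proof (rule sum_mono)
        fix e assume e: "e \<in> B"
        define z where "z = (q - q1) \<bullet> e / r"
        have "(q - q1) \<bullet> e = r * z" "k e = \<lfloor>z\<rfloor>" using e r by (simp_all add: z_def k_def)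
        then have "(q - q1) \<bullet> e - r * of_int (k e) = r * (z - of_int \<lfloor>z\<rfloor>)"
          by (simp add: right_diff_distrib)
        moreover have "\<bar>z - of_int \<lfloor>z\<rfloor>\<bar> \<le> 1" by linarith
        ultimately show "norm (((q - q1) \<bullet> e - r * of_int (k e)) *\<^sub>R e) \<le> r"
          using B(3)[OF e] r by (simp add: abs_mult mult_left_le)
      qed
      also have "\<dots> = real d * r" using B(5) dimV by simp
      finally have "dist q (c k) \<le> real d * r" by (simp add: dist_norm)
      then have "dist (c k) x \<le> (real d + 1) * r"
        using q(2) dist_triangle[of "c k" x q] by (simp add: algebra_simps dist_commute)
      then show "x \<in> \<Union>\<C>" using kB by (auto simp: \<C>_def)
    qed
    then have "hcover s {x \<in> cball 0 R. infdist x L \<le> r} (card \<C> * (2 * (real d + 1) * r) powr s)"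
      using fin s r by (intro hcover_finite) (auto simp: \<C>_def)
    moreover have "card \<C> * (2 * (real d + 1) * r) powr s \<le> K * r powr (s - real d)"
    proof -
      have "card \<C> \<le> card (PiE B (\<lambda>_. {- m..m}))"
        unfolding \<C>_def using finB by (intro card_image_le finite_PiE) auto
      also have "\<dots> = nat (2 * m + 1) ^ d" using finB B(5) dimV by (simp add: card_PiE ac_simps)
      finally have "real (card \<C>) \<le> real (nat (2 * m + 1)) ^ d" by (metis of_nat_le_iff of_nat_power)
      also have "\<dots> \<le> ((2 * T + 5) / r) ^ d"
      proof (rule power_mono)
        have "0 \<le> T / r" using T r by simp
        then have "real (nat (2 * m + 1)) = 2 * of_int m + 1" unfolding m_def by simp
        also have "of_int m \<le> T / r + 2" unfolding m_def of_int_add of_int_1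
          using of_int_ceiling_le_add_one[of "T / r"] by linarith
        then have "2 * of_int m + 1 \<le> 2 * T / r + 5" by simp
        also have "\<dots> \<le> (2 * T + 5) / r" using r by (simp add: field_simps)
        finally show "real (nat (2 * m + 1)) \<le> (2 * T + 5) / r" by simp
      qed simp
      finally have "card \<C> * (2 * (real d + 1) * r) powr s \<le> ((2 * T + 5) / r) ^ d * (2 * (real d + 1) * r) powr s"
        by (intro mult_right_mono) auto
      also have "\<dots> = K * (r powr s / r powr real d)"
        using r by (simp add: K_def power_divide powr_mult powr_realpow)
      finally show ?thesis by (simp add: powr_diff)
    qed
    ultimately show ?thesis by (rule hcover_mono)
  qed
  then show ?thesis using K by blast
qed

section \<open>Independence over the rationals and infinitely many approximations\<close>

lemma rational_orthogonal_vector: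
  fixes v :: "nat \<Rightarrow> real \<times> (real ^ 'n::finite)"
  defines "rational \<equiv> \<lambda>x :: real \<times> (real ^ 'n). fst x \<in> \<rat> \<and> (\<forall>i. snd x $ i \<in> \<rat>)"
  assumes "\<And>i. i < k \<Longrightarrow> rational (v i)" "rational z" "z \<notin> span (v ` {..<k})"
  shows "\<exists>y. rational y \<and> y \<noteq> 0 \<and> (\<forall>i<k. y \<bullet> v i = 0)"
proof -
  have inner: "x \<bullet> y \<in> \<rat>" if "rational x" "rational y" for x y
    using that by (auto simp: rational_def inner_prod_def inner_vec_def intro!: Rats_add Rats_mult Rats_sum)
  have perp: "rational (perp b x)" if "rational x" "rational b" for x b
    using inner[OF that] inner[OF that(2) that(2)] that
    by (auto simp: rational_def perp_def)
  \<comment> \<open>Gram-Schmidt over the rationals: \<open>perp\<close> preserves rationality. The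
    added membership in the span lets the induction see that a \<open>y\<close> found among the
    projected vectors is orthogonal to \<open>b\<close> as well.\<close>
  have "\<exists>y. rational y \<and> y \<noteq> 0 \<and> (\<forall>i<k. y \<bullet> v i = 0) \<and> y \<in> span (insert z (v ` {..<k}))"
    if "\<And>i. i < k \<Longrightarrow> rational (v i)" "rational z" "z \<notin> span (v ` {..<k})" for v :: "nat \<Rightarrow> real \<times> (real ^ 'n)" and z
    using that
  proof (induction k arbitrary: v z)
    case 0
    then show ?case by (intro exI[of _ z]) (auto intro: span_base)
  next
    case (Suc k)
    define b where "b = v k"
    define v' where "v' i = perp b (v i)" for i
    have vb: "v i \<in> span (v ` {..<Suc k})" "v i \<in> span (insert z (v ` {..<Suc k}))" if "i < Suc k" for i
      using that by (auto intro!: span_base)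
    have zb: "z \<in> span (insert z (v ` {..<Suc k}))" by (auto intro!: span_base)
    have zv: "perp b z \<notin> span (v' ` {..<k})"
    proof
      assume "perp b z \<in> span (v' ` {..<k})"
      moreover have "span (v' ` {..<k}) \<subseteq> span (v ` {..<Suc k})"
        by (intro span_minimal) (auto simp: v'_def perp_def b_def intro!: span_diff span_scale vb zb)
      ultimately have "perp b z + ((z \<bullet> b) / (b \<bullet> b)) *\<^sub>R b \<in> span (v ` {..<Suc k})"
        by (intro span_add span_scale) (auto simp: b_def intro: span_base)
      then show False using Suc.prems(3) by (simp add: perp_def)
    qed
    obtain y where y: "rational y" "y \<noteq> 0" "\<forall>i<k. y \<bullet> v' i = 0" "y \<in> span (insert (perp b z) (v' ` {..<k}))"
      using Suc.IH[of v' "perp b z"] zv Suc.prems perp by (auto simp: v'_def b_def)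
    have "y \<bullet> b = 0"
    proof -
      have "span (insert (perp b z) (v' ` {..<k})) \<subseteq> {x. x \<bullet> b = 0}"
        by (intro span_minimal) (auto simp: v'_def subspace_def inner_add_left)
      then show ?thesis using y(4) by auto
    qed
    moreover from this have "y \<bullet> v i = 0" if "i < k" for i
    proof -
      have "v i = v' i + ((v i \<bullet> b) / (b \<bullet> b)) *\<^sub>R b" by (simp add: v'_def perp_def)
      then have "y \<bullet> v i = y \<bullet> v' i + ((v i \<bullet> b) / (b \<bullet> b)) * (y \<bullet> b)"
        by (metis inner_add_right inner_scaleR_right)
      then show ?thesis using y(3) that \<open>y \<bullet> b = 0\<close> by simp
    qed
    moreover have "y \<in> span (insert z (v ` {..<Suc k}))"
    proof -
      have "span (insert (perp b z) (v' ` {..<k})) \<subseteq> span (insert z (v ` {..<Suc k}))"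
        by (intro span_minimal) (auto simp: v'_def perp_def b_def intro!: span_diff span_scale vb zb)
      then show ?thesis using y(4) by blast
    qed
    ultimately show ?case using y(1,2) by (intro exI[of _ y]) (auto simp: less_Suc_eq b_def)
  qed
  then show ?thesis using assms by blast
qed

text \<open>A rational vector orthogonal to the lift of a proper subspace is the coefficient vector
  of a rational relation satisfied by all its points.\<close>

lemma Q_lin_indep1_notin_rat_affine_subspace:
  fixes \<theta> :: "real ^ 'n::finite"
  assumes L: "rat_affine_subspace d L" and d: "d < CARD('n)" and \<theta>: "Q_lin_indep1 \<theta>"
  shows "\<theta> \<notin> L"
proof
  assume "\<theta> \<in> L"
  obtain v where v: "lattice_basis (lift_subspace L) v (Suc d)"
    using rat_affine_subspace_lattice_basis[OF L] .
  have \<theta>L: "(1, \<theta>) \<in> span (v ` {..<Suc d})"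
    using v \<open>\<theta> \<in> L\<close> by (auto simp: lattice_basis_iff lift_subspace_def intro: span_base)
  have "\<exists>z :: real \<times> (real ^ 'n). int_point z \<and> z \<notin> span (v ` {..<Suc d})"
  proof (rule ccontr)
    assume none: "\<nexists>z :: real \<times> (real ^ 'n). int_point z \<and> z \<notin> span (v ` {..<Suc d})"
    have "(Basis :: (real \<times> (real ^ 'n)) set) \<subseteq> span (v ` {..<Suc d})"
    proof
      fix z :: "real \<times> (real ^ 'n)" assume "z \<in> Basis"
      then have "int_point z" by (auto simp: Basis_prod_def Basis_vec_def int_point_def axis_def)
      then show "z \<in> span (v ` {..<Suc d})" using none by blast
    qed
    then have "dim (Basis :: (real \<times> (real ^ 'n)) set) \<le> dim (v ` {..<Suc d})"
      by (metis dim_span dim_subset)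
    also have "\<dots> \<le> card (v ` {..<Suc d})" by (rule dim_le_card') simp
    also have "\<dots> \<le> Suc d" using card_image_le[of "{..<Suc d}" v] by simp
    finally show False using d dim_eq_card_independent[OF independent_Basis[where 'a = "real \<times> (real ^ 'n)"]]
      by simp
  qed
  then obtain z where z: "int_point z" "z \<notin> span (v ` {..<Suc d})" by blast
  have int_rat: "fst x \<in> \<rat> \<and> (\<forall>i. snd x $ i \<in> \<rat>)" if "int_point x" for x :: "real \<times> (real ^ 'n)"
    using that Ints_subset_Rats by (auto simp: int_point_def)
  have "\<exists>y. (fst y \<in> \<rat> \<and> (\<forall>i. snd y $ i \<in> \<rat>)) \<and> y \<noteq> 0 \<and> (\<forall>i<Suc d. y \<bullet> v i = 0)"
  proof (rule rational_orthogonal_vector[OF _ _ z(2)])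
    show "fst (v i) \<in> \<rat> \<and> (\<forall>j. snd (v i) $ j \<in> \<rat>)" if "i < Suc d" for i
      using v that by (intro int_rat) (simp add: lattice_basis_iff)
  qed (rule int_rat[OF z(1)])
  then obtain y where y: "fst y \<in> \<rat>" "\<And>i. snd y $ i \<in> \<rat>" "y \<noteq> 0" "\<And>i. i < Suc d \<Longrightarrow> y \<bullet> v i = 0"
    by blast
  have "span (v ` {..<Suc d}) \<subseteq> {x. y \<bullet> x = 0}"
    using y(4) by (intro span_minimal) (auto simp: subspace_def inner_add_right)
  then have "y \<bullet> (1, \<theta>) = 0" using \<theta>L by blast
  then have "fst y + (\<Sum>i\<in>UNIV. snd y $ i * \<theta> $ i) = 0"
    by (simp add: inner_prod_def inner_vec_def)
  then have "fst y = 0 \<and> (\<forall>i. snd y $ i = 0)"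
    using \<theta> y(1,2) unfolding Q_lin_indep1_def by blast
  then show False using y(3) by (auto simp: prod_eq_iff Finite_Cartesian_Product.vec_eq_iff)
qed

lemma omega_exp_gt_obtains:
  fixes \<theta> :: "real ^ 'n::finite"
  assumes "ereal w < omega_exp d \<theta>" "1 \<le> H0"
  obtains H L where "H0 \<le> H" "rat_affine_subspace d L" "schmidt_height L \<le> H"
    "schmidt_height L * infdist \<theta> L \<le> H powr (- w)"
proof -
  obtain w' where w': "w < w'" and "\<forall>H0. \<exists>H\<ge>H0. \<exists>L. rat_affine_subspace d L \<and> schmidt_height L \<le> H \<and>
                   schmidt_height L * infdist \<theta> L \<le> H powr (- w')"
    using assms(1) unfolding omega_exp_def less_Sup_iff by auto
  then obtain H L where "H \<ge> H0" "rat_affine_subspace d L" "schmidt_height L \<le> H"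
    "schmidt_height L * infdist \<theta> L \<le> H powr (- w')" by blast
  moreover have "H powr (- w') \<le> H powr (- w)" using w' assms(2) \<open>H \<ge> H0\<close> by (intro powr_mono) auto
  ultimately show thesis by (intro that[of H L]) auto
qed

text \<open>The exponent involves \<open>H\<close> only as a bound on the height, so one subspace
  through \<theta> could serve all large \<open>H\<close>. As \<theta> lies on none, finitely many
  subspaces keep a positive distance, which large \<open>H\<close> contradicts.\<close>

lemma infinite_approximations:
  fixes \<theta> :: "real ^ 'n::finite"
  assumes w: "0 < w" "ereal w < omega_exp d \<theta>" and d: "d < CARD('n)" and \<theta>: "Q_lin_indep1 \<theta>"
  shows "infinite {L. rat_affine_subspace d L \<and> infdist \<theta> L \<le> schmidt_height L powr - (1 + w)}"
proof
  assume fin: "finite {L. rat_affine_subspace d L \<and> infdist \<theta> L \<le> schmidt_height L powr - (1 + w)}" (is "finite ?\<L>")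
  have pos: "0 < infdist \<theta> L" if "L \<in> ?\<L>" for L
    using that Q_lin_indep1_notin_rat_affine_subspace[OF _ d \<theta>] closed_rat_affine_subspace[of d L]
      in_closed_iff_infdist_zero[of L \<theta>] infdist_nonneg[of \<theta> L] by force
  define \<delta> where "\<delta> = Min (insert 1 (infdist \<theta> ` ?\<L>))"
  have \<delta>: "\<delta> > 0" unfolding \<delta>_def using fin pos by (subst Min_gr_iff) auto
  \<comment> \<open>From here on \<open>H powr (- w)\<close> is smaller than
    \<open>\<delta>\<close>.\<close>
  define H0 where "H0 = max 1 (\<delta> powr (- 1 / w) + 1)"
  obtain H L where HL: "H0 \<le> H" "rat_affine_subspace d L" "schmidt_height L \<le> H"
    "schmidt_height L * infdist \<theta> L \<le> H powr (- w)"
    using omega_exp_gt_obtains[OF w(2), of H0] by (auto simp: H0_def)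
  define h where "h = schmidt_height L"
  have h: "1 \<le> h" using schmidt_height_ge_1[OF HL(2)] by (simp add: h_def)
  have "infdist \<theta> L \<le> H powr (- w) / h" using HL(4) h by (simp add: h_def field_simps)
  also have "\<dots> \<le> h powr (- w) / h"
    using HL(3) h w by (intro divide_right_mono powr_mono2') (auto simp: h_def)
  also have "\<dots> = h powr - (1 + w)" using h by (simp add: powr_diff powr_minus_divide powr_add field_simps)
  finally have "L \<in> ?\<L>" using HL(2) by (simp add: h_def)
  then have "\<delta> \<le> infdist \<theta> L" unfolding \<delta>_def using fin by (intro Min_le) auto
  also have "\<dots> \<le> h * infdist \<theta> L" using h infdist_nonneg[of \<theta> L] by (simp add: mult_le_cancel_right1)
  also have "\<dots> \<le> H powr (- w)" using HL(4) by (simp add: h_def)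
  also have "\<dots> < (\<delta> powr (- 1 / w)) powr (- w)"
  proof (rule powr_less_mono2_neg)
    show "\<delta> powr (- 1 / w) < H" using HL(1) by (simp add: H0_def)
  qed (use w \<delta> in auto)
  also have "\<dots> = \<delta>" using w \<delta> by (simp add: powr_powr)
  finally show False by simp
qed

text \<open>The index \<open>None\<close> stands for the additional first coordinate. Keeping all
  coordinates in one function on pairs makes the codes an extensional product, over which sums
  factorise and which is countable.\<close>

definition tuple_vec :: "(nat \<times> 'n option \<Rightarrow> int) \<Rightarrow> nat \<Rightarrow> real \<times> (real ^ 'n::finite)" where
  "tuple_vec k i = (of_int (k (i, None)), \<chi> j. of_int (k (i, Some j)))"

lemma tuple_vec_surj:
  fixes u :: "nat \<Rightarrow> real \<times> (real ^ 'n::finite)"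
  assumes "\<And>i. i < m \<Longrightarrow> int_point (u i)"
  obtains k where "k \<in> PiE ({..<m} \<times> UNIV) (\<lambda>_. UNIV)" "\<And>i. i < m \<Longrightarrow> tuple_vec k i = u i"
proof
  define k where "k = restrict (\<lambda>(i, j). case j of None \<Rightarrow> \<lfloor>fst (u i)\<rfloor> | Some j \<Rightarrow> \<lfloor>snd (u i) $ j\<rfloor>) ({..<m} \<times> UNIV)"
  show "k \<in> PiE ({..<m} \<times> UNIV) (\<lambda>_. UNIV)" by (simp add: k_def)
  fix i assume "i < m"
  with assms[OF this] show "tuple_vec k i = u i"
    by (auto simp: tuple_vec_def k_def int_point_def prod_eq_iff Finite_Cartesian_Product.vec_eq_iff elim!: Ints_cases)
qed

text \<open>A nonzero integer vector has norm at least 1 and at least each coordinate, so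
  \<open>1 + \<bar>k (i, j)\<bar>\<close> is at most twice the norm. Splitting the power evenly over
  the \<open>n + 1\<close> coordinates gives a product.\<close>

lemma int_vector_norm_powr_le:
  fixes k :: "nat \<times> 'n::finite option \<Rightarrow> int"
  assumes nz: "tuple_vec k i \<noteq> 0" and \<tau>: "0 \<le> \<tau>"
  shows "norm (tuple_vec k i) powr - \<tau> \<le>
    2 powr \<tau> * (\<Prod>j\<in>UNIV. (1 + \<bar>real_of_int (k (i, j))\<bar>) powr - (\<tau> / CARD('n option)))"
proof -
  let ?x = "tuple_vec k i" and ?N = "CARD('n option)"
  have coord: "\<bar>real_of_int (k (i, j))\<bar> \<le> norm ?x" for j
  proof (cases j)
    case None
    then show ?thesis using norm_fst_le[of "fst ?x" "snd ?x"] by (simp add: tuple_vec_def)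
  next
    case (Some l)
    have "\<bar>snd ?x $ l\<bar> \<le> norm (snd ?x)" by (rule component_le_norm_cart)
    also have "\<dots> \<le> norm ?x" using norm_snd_le[of "snd ?x" "fst ?x"] by simp
    finally show ?thesis using Some by (simp add: tuple_vec_def)
  qed
  obtain j where "k (i, j) \<noteq> 0"
  proof (rule ccontr)
    assume "\<not> thesis"
    then have "k (i, j) = 0" for j using that by blast
    then show False using nz by (auto simp: tuple_vec_def prod_eq_iff Finite_Cartesian_Product.vec_eq_iff)
  qed
  then have "1 \<le> \<bar>real_of_int (k (i, j))\<bar>" by simp
  also have "\<dots> \<le> norm ?x" by (rule coord)
  finally have n1: "1 \<le> norm ?x" .
  have "(2 * norm ?x) powr - \<tau> = (\<Prod>j\<in>(UNIV :: 'n option set). (2 * norm ?x) powr - (\<tau> / ?N))"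
  proof -
    have "(2 * norm ?x) powr - \<tau> = (2 * norm ?x) powr (real ?N * - (\<tau> / ?N))" by simp
    also have "\<dots> = ((2 * norm ?x) powr - (\<tau> / ?N)) ^ ?N" using n1 by (intro powr_power[symmetric]) auto
    finally show ?thesis by (simp only: prod_constant)
  qed
  also have "\<dots> \<le> (\<Prod>j\<in>UNIV. (1 + \<bar>real_of_int (k (i, j))\<bar>) powr - (\<tau> / ?N))"
  proof (rule prod_mono, intro conjI powr_mono2')
    fix j
    show "1 + \<bar>real_of_int (k (i, j))\<bar> \<le> 2 * norm ?x" using coord[of j] n1 by simp
  qed (use \<tau> in auto)
  finally have "2 powr \<tau> * (2 * norm ?x) powr - \<tau> \<le>
      2 powr \<tau> * (\<Prod>j\<in>UNIV. (1 + \<bar>real_of_int (k (i, j))\<bar>) powr - (\<tau> / ?N))"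
    by (intro mult_left_mono) auto
  moreover have "2 powr \<tau> * (2 * norm ?x) powr - \<tau> = norm ?x powr - \<tau>"
    by (simp add: powr_mult powr_minus)
  ultimately show ?thesis by simp
qed

lemma summable_tuple_vec:
  assumes "real CARD('n::finite) + 1 < \<tau>"
  shows "(\<lambda>k. \<Prod>i<m. norm (tuple_vec k i :: real \<times> (real ^ 'n)) powr - \<tau>) summable_on
    {k \<in> PiE ({..<m} \<times> UNIV) (\<lambda>_. UNIV). \<forall>i<m. tuple_vec k i \<noteq> (0 :: real \<times> (real ^ 'n))}"
    (is "?f summable_on ?I")
proof -
  let ?N = "CARD('n option)"
  let ?J = "{..<m} \<times> (UNIV :: 'n option set)"
  let ?g = "\<lambda>k. \<Prod>j\<in>?J. (1 + \<bar>real_of_int (k j)\<bar>) powr - (\<tau> / ?N)"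
  have N: "real ?N = real CARD('n) + 1" by (simp add: card_UNIV_option)
  have "?g summable_on (PiE ?J (\<lambda>_. UNIV))"
    using assms N by (intro summable_int_tuples) (auto simp: field_simps)
  then have "(\<lambda>k. (2 powr \<tau>) ^ m * ?g k) summable_on (PiE ?J (\<lambda>_. UNIV))"
    by (rule summable_on_cmult_right)
  then have sm: "(\<lambda>k. (2 powr \<tau>) ^ m * ?g k) summable_on ?I"
    by (rule summable_on_subset_banach) auto
  show ?thesis
  proof (rule summable_on_comparison_test[OF sm])
    fix k assume k: "k \<in> ?I"
    have "?f k \<le> (\<Prod>i<m. 2 powr \<tau> * (\<Prod>j\<in>UNIV. (1 + \<bar>real_of_int (k (i, j))\<bar>) powr - (\<tau> / ?N)))"
      using k assms by (intro prod_mono conjI int_vector_norm_powr_le) auto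
    also have "\<dots> = (2 powr \<tau>) ^ m * ?g k"
      by (simp add: prod.distrib prod.cartesian_product)
    finally show "?f k \<le> (2 powr \<tau>) ^ m * ?g k" .
    show "0 \<le> ?f k" by (intro prod_nonneg) auto
  qed
qed

text \<open>A rational subspace is encoded by a reduced integer basis, whose vectors have product of norms
  comparable to the height; the resulting sum over all integer tuples factorises.\<close>
lemma W_set_hnull:
  assumes d: "d < CARD('n::finite)" and w: "0 < w" and s: "real d + (real CARD('n) + 1) / (1 + w) < s"
  shows "hnull s (W_set d (ereal w) :: (real ^ 'n) set)"
proof -
  define n where "n = CARD('n)"
  have sd: "0 < s - real d" "(real n + 1) / (1 + w) < s - real d"
  proof -
    have "0 < (real n + 1) / (1 + w)" using w by simp
    with s show "0 < s - real d" "(real n + 1) / (1 + w) < s - real d" by (simp_all add: n_def)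
  qed
  have "(real n + 1) / (s - real d) < 1 + w" using sd w by (simp add: field_simps)
  \<comment> \<open>An exponent of at least \<open>w\<close> provides approximations only for
    smaller exponents; \<open>w'\<close> is so close to \<open>w\<close> that \<open>\<tau>\<close>
    still exceeds \<open>n + 1\<close>, the threshold of \<open>summable_tuple_vec\<close>.\<close>
  then obtain w' where w': "0 < w'" "w' < w" "(real n + 1) / (s - real d) < 1 + w'"
    using dense[of "max 0 ((real n + 1) / (s - real d) - 1)" w] w by (auto simp: less_diff_eq)
  define \<tau> where "\<tau> = (1 + w') * (s - real d)"
  have \<tau>: "real n + 1 < \<tau>" using w'(3) sd by (simp add: \<tau>_def field_simps)
  obtain C where C: "C > 0" and red: "\<And>v :: nat \<Rightarrow> real \<times> (real ^ 'n). lin_indep v (Suc d) \<Longrightarrow>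
     \<exists>u. lin_indep u (Suc d) \<and> zspan u (Suc d) = zspan v (Suc d) \<and>
       (\<Prod>i<Suc d. (norm (u i))\<^sup>2) \<le> C * gram_det v (Suc d)"
    using reduced_basis[of "Suc d", where 'a = "real \<times> (real ^ 'n)"] by blast
  define I where "I = {k \<in> PiE ({..<Suc d} \<times> UNIV) (\<lambda>_. UNIV). \<forall>i<Suc d. tuple_vec k i \<noteq> (0 :: real \<times> (real ^ 'n))}"
  define Lk where "Lk k = slice (span ((tuple_vec k :: nat \<Rightarrow> real \<times> (real ^ 'n)) ` {..<Suc d}))" for k
  define P where "P k = (\<Prod>i<Suc d. norm (tuple_vec k i :: real \<times> (real ^ 'n)))" for k
  \<comment> \<open>The tube lemma wants radii at most 1. The cap does no harm, since heights are at
    least 1.\<close>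
  define r where "r k = min 1 ((sqrt C / P k) powr (1 + w'))" for k
  have Ppos: "P k > 0" if "k \<in> I" for k using that unfolding P_def by (intro prod_pos) (auto simp: I_def)
  have rpos: "0 < r k" "r k \<le> 1" if "k \<in> I" for k using Ppos[OF that] C by (auto simp: r_def)
  \<comment> \<open>Several tuples may describe the same subspace; surjectivity of the code is all
    that the covering argument uses.\<close>
  have encode: "\<exists>k\<in>I. L = Lk k \<and> schmidt_height L powr - (1 + w') \<le> r k" if L: "rat_affine_subspace d L" for L
  proof -
    obtain v where v: "lattice_basis (lift_subspace L) v (Suc d)" "schmidt_height L = sqrt (gram_det v (Suc d))"
      using rat_affine_subspace_lattice_basis[OF L] .
    define h where "h = schmidt_height L"
    have h: "1 \<le> h" using schmidt_height_ge_1[OF L] by (simp add: h_def)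
    obtain u where u: "lin_indep u (Suc d)" "zspan u (Suc d) = zspan v (Suc d)"
       "(\<Prod>i<Suc d. (norm (u i))\<^sup>2) \<le> C * gram_det v (Suc d)"
      using red[of v] v(1) by (auto simp: lattice_basis_iff)
    have zv: "zspan v (Suc d) = {y \<in> lift_subspace L. int_point y}" using v(1) by (simp add: lattice_basis_iff)
    have uz: "u i \<in> lift_subspace L \<and> int_point (u i)" if "i < Suc d" for i
      using zspan_base[OF that, of u] u(2) zv by auto
    then obtain k where k: "k \<in> PiE ({..<Suc d} \<times> UNIV) (\<lambda>_. UNIV)" "\<And>i. i < Suc d \<Longrightarrow> tuple_vec k i = u i"
      using tuple_vec_surj[of "Suc d" u] by metis
    have kI: "k \<in> I" using k lin_indep_nonzero[OF u(1)] by (auto simp: I_def)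
    have "span (u ` {..<Suc d}) = lift_subspace L"
    proof
      show "span (u ` {..<Suc d}) \<subseteq> lift_subspace L"
        using uz by (intro span_minimal) (auto simp: lift_subspace_def)
      have "v i \<in> span (u ` {..<Suc d})" if "i < Suc d" for i
        using zspan_base[OF that, of v] u(2) zspan_subset_span[of u "Suc d"] by auto
      then have "span (v ` {..<Suc d}) \<subseteq> span (u ` {..<Suc d})" by (intro span_minimal) auto
      then show "lift_subspace L \<subseteq> span (u ` {..<Suc d})" using v(1) by (simp add: lattice_basis_iff)
    qed
    moreover have "tuple_vec k ` {..<Suc d} = u ` {..<Suc d}" using k(2) by (intro image_cong) auto
    moreover have "affine L" using L by (simp add: rat_affine_subspace_def)
    ultimately have LL: "L = Lk k" unfolding Lk_def by (simp only: slice_lift_subspace)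
    have "(P k)\<^sup>2 \<le> (sqrt C * h)\<^sup>2"
    proof -
      have "(P k)\<^sup>2 = (\<Prod>i<Suc d. (norm (u i))\<^sup>2)"
        unfolding P_def prod_power_distrib using k(2) by (intro prod.cong) auto
      also have "\<dots> \<le> C * gram_det v (Suc d)" by (rule u(3))
      also have "\<dots> = (sqrt C * h)\<^sup>2"
        using C gram_det_nonneg[of v "Suc d"] v(2) by (simp add: h_def power_mult_distrib)
      finally show ?thesis .
    qed
    then have "P k \<le> sqrt C * h" by (rule power2_le_imp_le) (use C h in auto)
    then have "1 / h \<le> sqrt C / P k" using Ppos[OF kI] h by (simp add: field_simps)
    then have "(1 / h) powr (1 + w') \<le> (sqrt C / P k) powr (1 + w')" using h w' by (intro powr_mono2) auto
    moreover have "(1 / h) powr (1 + w') = h powr - (1 + w')" using h powr_minus_divide[of h "1 + w'"] by (simp add: powr_divide)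
    moreover have "h powr - (1 + w') \<le> h powr 0" using h w' by (intro powr_mono) auto
    then have "h powr - (1 + w') \<le> 1" using h by simp
    ultimately have "h powr - (1 + w') \<le> r k" by (simp add: r_def)
    then show ?thesis using kI LL by (auto simp: h_def)
  qed
  have ball: "hnull s (W_set d (ereal w) \<inter> cball (0 :: real ^ 'n) R)" for R
  proof -
    obtain K where K: "K > 0" and tube: "\<And>L :: (real ^ 'n) set. \<And>r. affine L \<Longrightarrow> closed L \<Longrightarrow> L \<noteq> {} \<Longrightarrow> aff_dim L = int d \<Longrightarrow>
      0 < r \<Longrightarrow> r \<le> 1 \<Longrightarrow> hcover s {x \<in> cball 0 R. infdist x L \<le> r} (K * r powr (s - real d))"
      using subspace_tube_cover[of s d R, where 'a = "real ^ 'n"] sd by auto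
    define I' where "I' = {k \<in> I. rat_affine_subspace d (Lk k)}"
    define N where "N k = {x \<in> cball 0 R. infdist x (Lk k) \<le> r k}" for k
    define c where "c k = (K * C powr (\<tau> / 2)) * (\<Prod>i<Suc d. norm (tuple_vec k i :: real \<times> (real ^ 'n)) powr - \<tau>)" for k
    show ?thesis
    proof (rule hnull_limsup[where I = I' and N = N and c = c])
      have "countable (PiE ({..<Suc d} \<times> (UNIV :: 'n option set)) (\<lambda>_. UNIV :: int set))"
        by (intro countable_PiE) auto
      then show "countable I'" by (rule countable_subset[rotated]) (auto simp: I'_def I_def)
      fix k assume k: "k \<in> I'"
      show "0 \<le> c k" unfolding c_def using K by (intro mult_nonneg_nonneg prod_nonneg) auto
      have kI: "k \<in> I" and L: "rat_affine_subspace d (Lk k)" using k by (auto simp: I'_def)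
      have "hcover s (N k) (K * r k powr (s - real d))"
        unfolding N_def using L closed_rat_affine_subspace[OF L] rpos[OF kI]
        by (intro tube) (auto simp: rat_affine_subspace_def)
      moreover have "K * r k powr (s - real d) \<le> c k"
      proof -
        have "r k powr (s - real d) \<le> ((sqrt C / P k) powr (1 + w')) powr (s - real d)"
          using rpos[OF kI] sd by (intro powr_mono2) (auto simp: r_def)
        also have "\<dots> = (sqrt C / P k) powr \<tau>" by (simp add: powr_powr \<tau>_def)
        also have "\<dots> = C powr (\<tau> / 2) * P k powr - \<tau>"
          using C Ppos[OF kI] by (simp add: powr_divide powr_minus_divide powr_half_sqrt[symmetric] powr_powr)
        also have "P k powr - \<tau> = (\<Prod>i<Suc d. norm (tuple_vec k i :: real \<times> (real ^ 'n)) powr - \<tau>)"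
          unfolding P_def by (rule prod_powr_distrib)
        finally show ?thesis using K by (simp add: c_def mult_left_mono mult.assoc)
      qed
      ultimately show "hcover s (N k) (c k)" by (rule hcover_mono)
    next
      have "(\<lambda>k. \<Prod>i<Suc d. norm (tuple_vec k i :: real \<times> (real ^ 'n)) powr - \<tau>) summable_on I"
        unfolding I_def using \<tau> by (intro summable_tuple_vec) (simp add: n_def)
      then have "c summable_on I" unfolding c_def by (rule summable_on_cmult_right)
      then show "c summable_on I'" by (rule summable_on_subset_banach) (auto simp: I'_def)
    next
      fix \<theta> :: "real ^ 'n" assume "\<theta> \<in> W_set d (ereal w) \<inter> cball 0 R"
      then have \<theta>: "Q_lin_indep1 \<theta>" "ereal w \<le> omega_exp d \<theta>" "\<theta> \<in> cball 0 R" by (auto simp: W_set_def)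
      have "ereal w' < omega_exp d \<theta>" using w'(2) \<theta>(2) by (simp add: order_less_le_trans[of _ "ereal w"])
      then have inf: "infinite {L. rat_affine_subspace d L \<and> infdist \<theta> L \<le> schmidt_height L powr - (1 + w')}"
        using w'(1) d \<theta>(1) by (intro infinite_approximations)
      show "infinite {k \<in> I'. \<theta> \<in> N k}"
      proof
        assume fin: "finite {k \<in> I'. \<theta> \<in> N k}"
        have "{L. rat_affine_subspace d L \<and> infdist \<theta> L \<le> schmidt_height L powr - (1 + w')} \<subseteq> Lk ` {k \<in> I'. \<theta> \<in> N k}"
        proof
          fix L assume "L \<in> {L. rat_affine_subspace d L \<and> infdist \<theta> L \<le> schmidt_height L powr - (1 + w')}"
          then have L: "rat_affine_subspace d L" "infdist \<theta> L \<le> schmidt_height L powr - (1 + w')" by auto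
          obtain k where "k \<in> I" "L = Lk k" "schmidt_height L powr - (1 + w') \<le> r k" using encode[OF L(1)] by blast
          then have "k \<in> {k \<in> I'. \<theta> \<in> N k}" using L \<theta>(3) by (auto simp: I'_def N_def)
          then show "L \<in> Lk ` {k \<in> I'. \<theta> \<in> N k}" using \<open>L = Lk k\<close> by blast
        qed
        then show False using inf fin finite_surj by blast
      qed
    qed
  qed
  have "hnull s (\<Union>R :: nat. W_set d (ereal w) \<inter> cball (0 :: real ^ 'n) (real R))"
    by (intro hnull_UN ball)
  moreover have "W_set d (ereal w) \<subseteq> (\<Union>R :: nat. W_set d (ereal w) \<inter> cball (0 :: real ^ 'n) (real R))"
    using real_arch_simple by fastforce
  ultimately show ?thesis by (rule hnull_subset)
qed

section \<open>Approximation of almost all points\<close>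

lemma dirichlet_height:
  fixes \<theta> :: "real ^ 'n::finite"
  assumes d: "d < CARD('n)"
  shows "\<exists>C\<ge>1. \<exists>H0\<ge>1. \<forall>H\<ge>H0. \<exists>L. rat_affine_subspace d L \<and> schmidt_height L \<le> H \<and>
    schmidt_height L * infdist \<theta> L \<le> C * H powr - ((real d + 1) / (real CARD('n) - real d))"
proof -
  define m where "m = CARD('n) - d"
  have m: "m > 0" "real m = real CARD('n) - real d" using d by (auto simp: m_def of_nat_diff)
  define w0 where "w0 = (real d + 1) / real m"
  obtain C where C: "C \<ge> 1" and D: "\<And>y. y > C \<Longrightarrow> \<exists>L. rat_affine_subspace d L \<and> schmidt_height L \<le> C * y ^ m
    \<and> schmidt_height L * infdist \<theta> L \<le> C / y ^ Suc d"
    using dirichlet_subspace[OF d, of \<theta>] unfolding m_def by blast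
  have w0: "w0 \<ge> 0" by (simp add: w0_def)
  have "\<exists>L. rat_affine_subspace d L \<and> schmidt_height L \<le> H \<and>
    schmidt_height L * infdist \<theta> L \<le> C * C powr w0 * H powr - w0" if H: "H \<ge> C * (C + 1) ^ m" for H
  proof -
    have HC: "(C + 1) ^ m \<le> H / C" using H C by (simp add: field_simps)
    moreover have "0 < (C + 1) ^ m" using C by simp
    ultimately have pos: "H / C > 0" by linarith
    have Hpos: "H > 0" using pos C by (simp add: zero_less_divide_iff)
    \<comment> \<open>Solution of \<open>C * y ^ m = H\<close>; it turns \<open>y ^ Suc d\<close>
      into \<open>(H / C) powr w0\<close>.\<close>
    define y where "y = (H / C) powr (1 / real m)"
    have "C + 1 = ((C + 1) ^ m) powr (1 / real m)"
      using C m(1) by (simp add: powr_powr flip: powr_realpow)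
    also have "\<dots> \<le> y" unfolding y_def using HC C by (intro powr_mono2) auto
    finally have "y > C" by simp
    from D[OF this] obtain L where L: "rat_affine_subspace d L" "schmidt_height L \<le> C * y ^ m"
      "schmidt_height L * infdist \<theta> L \<le> C / y ^ Suc d" by blast
    have y0: "y > 0" using Hpos C by (simp add: y_def)
    have "y ^ m = H / C" using pos Hpos C m(1) y0 by (simp add: y_def powr_powr flip: powr_realpow)
    moreover have "C / y ^ Suc d = C * C powr w0 * H powr - w0"
    proof -
      have "y ^ Suc d = y powr (real d + 1)" using y0 powr_realpow[of y "Suc d"] by (simp add: add.commute)
      also have "\<dots> = (H / C) powr w0" by (simp add: y_def powr_powr w0_def)
      also have "\<dots> = H powr w0 / C powr w0" using Hpos C by (simp add: powr_divide)
      finally show ?thesis by (simp add: powr_minus_divide)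
    qed
    ultimately show ?thesis using L C by (intro exI[of _ L]) auto
  qed
  moreover have "C * C powr w0 \<ge> 1"
    using mult_mono[of 1 C 1 "C powr w0"] ge_one_powr_ge_zero[of C w0] C w0 by simp
  moreover have "C * (C + 1) ^ m \<ge> 1"
    using mult_mono[of 1 C 1 "(C + 1) ^ m"] one_le_power[of "C + 1" m] C by simp
  ultimately show ?thesis unfolding m(2)[symmetric] w0_def[symmetric] by blast
qed

lemma omega_exp_ge:
  fixes \<theta> :: "real ^ 'n::finite"
  assumes d: "d < CARD('n)"
  shows "ereal ((real d + 1) / (real CARD('n) - real d)) \<le> omega_exp d \<theta>"
proof (rule dense_le)
  define w0 where "w0 = (real d + 1) / (real CARD('n) - real d)"
  have main: "ereal w \<le> omega_exp d \<theta>" if w: "w < w0" for w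
  proof -
  obtain C H0 where C: "C \<ge> 1" "H0 \<ge> 1" and D: "\<And>H. H \<ge> H0 \<Longrightarrow> \<exists>L. rat_affine_subspace d L \<and> schmidt_height L \<le> H \<and>
    schmidt_height L * infdist \<theta> L \<le> C * H powr - w0"
    using dirichlet_height[OF d, of \<theta>] unfolding w0_def by blast
  have "\<exists>H\<ge>K. \<exists>L. rat_affine_subspace d L \<and> schmidt_height L \<le> H \<and>
    schmidt_height L * infdist \<theta> L \<le> H powr - w" for K
  proof -
    define H where "H = max (max K H0) (C powr (1 / (w0 - w)))"
    have H: "H \<ge> K" "H \<ge> H0" "H \<ge> 1" "H \<ge> C powr (1 / (w0 - w))" using C by (auto simp: H_def)
    obtain L where L: "rat_affine_subspace d L" "schmidt_height L \<le> H"
      "schmidt_height L * infdist \<theta> L \<le> C * H powr - w0" using D[OF H(2)] by blast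
    have "C = (C powr (1 / (w0 - w))) powr (w0 - w)" using w C by (simp add: powr_powr)
    also have "\<dots> \<le> H powr (w0 - w)" using H w by (intro powr_mono2) auto
    finally have "C * H powr - w0 \<le> H powr (w0 - w) * H powr - w0" by (intro mult_right_mono) auto
    also have "\<dots> = H powr - w" by (simp flip: powr_add)
    finally show ?thesis using H(1) L by (intro exI[of _ H] conjI exI[of _ L]) auto
  qed
  then show ?thesis unfolding omega_exp_def by (intro Sup_upper) blast
  qed
  fix x assume "x < ereal ((real d + 1) / (real CARD('n) - real d))"
  then show "x \<le> omega_exp d \<theta>" using main by (cases x) (auto simp: w0_def)
qed

text \<open>A subspace from Dirichlet's theorem whose height is much smaller than the parameter \<open>H\<close> would
  approximate \<open>\<theta>\<close> too well for its height, so its height is nearly \<open>H\<close>.\<close>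
lemma generic_approximation:
  fixes \<theta> :: "real ^ 'n::finite"
  assumes d: "d < CARD('n)" and \<theta>: "omega_exp d \<theta> \<le> ereal w0"
    and w0: "w0 = (real d + 1) / (real CARD('n) - real d)" and \<epsilon>: "\<epsilon> > 0"
  shows "\<exists>H0. \<forall>H\<ge>H0. \<exists>L. rat_affine_subspace d L \<and> schmidt_height L \<le> H \<and>
    infdist \<theta> L \<le> H powr (- (1 + w0) + \<epsilon>)"
proof (rule ccontr)
  assume "\<not> ?thesis"
  then have bad: "\<exists>H\<ge>H0. \<forall>L. rat_affine_subspace d L \<longrightarrow> schmidt_height L \<le> H \<longrightarrow>
    H powr (- (1 + w0) + \<epsilon>) < infdist \<theta> L" for H0 by (meson not_le)
  \<comment> \<open>The cap keeps \<open>1 - e\<close> at least \<open>1 / 2\<close>, so the reduced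
    parameter \<open>H'\<close> grows with \<open>H\<close>.\<close>
  define e where "e = min \<epsilon> (1 / 2)"
  have e: "0 < e" "e \<le> 1 / 2" "e \<le> \<epsilon>" using \<epsilon> by (auto simp: e_def)
  have w0pos: "w0 > 0" using d w0 by simp
  have "w0 * (1 - e) < w0" using w0pos e by simp
  then have "w0 < w0 / (1 - e)" using e by (simp add: field_simps)
  \<comment> \<open>A subspace of height at most about \<open>H powr (1 - e)\<close> would raise the
    exponent from \<open>w0\<close> to nearly \<open>w0 / (1 - e)\<close>. The gap left by
    \<open>w\<close> absorbs the constant \<open>C\<close>, and \<open>\<eta>\<close> measures
    it.\<close>
  then obtain w where w: "w0 < w" "w < w0 / (1 - e)" using dense by blast
  define \<eta> where "\<eta> = w0 - w * (1 - e)"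
  have \<eta>: "\<eta> > 0" using w e by (simp add: \<eta>_def field_simps)
  obtain C H0 where C: "C \<ge> 1" "H0 \<ge> 1" and D: "\<And>H. H \<ge> H0 \<Longrightarrow> \<exists>L. rat_affine_subspace d L \<and> schmidt_height L \<le> H \<and>
    schmidt_height L * infdist \<theta> L \<le> C * H powr - w0"
    using dirichlet_height[OF d, of \<theta>] unfolding w0 by blast
  have "\<exists>H\<ge>K. \<exists>L. rat_affine_subspace d L \<and> schmidt_height L \<le> H \<and>
    schmidt_height L * infdist \<theta> L \<le> H powr - w" for K
  proof -
    define M where "M = max (max H0 ((max 1 K)\<^sup>2)) (C powr ((1 + w) / \<eta>))"
    obtain H where HM: "H \<ge> M" and Hbad: "\<And>L. rat_affine_subspace d L \<Longrightarrow> schmidt_height L \<le> H \<Longrightarrow>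
      H powr (- (1 + w0) + \<epsilon>) < infdist \<theta> L" using bad[of M] by blast
    have H: "H \<ge> H0" "H \<ge> (max 1 K)\<^sup>2" "H \<ge> C powr ((1 + w) / \<eta>)" "H \<ge> 1"
      using HM C by (auto simp: M_def)
    obtain L where L: "rat_affine_subspace d L" "schmidt_height L \<le> H"
      "schmidt_height L * infdist \<theta> L \<le> C * H powr - w0" using D[OF H(1)] by blast
    define h where "h = schmidt_height L"
    have h: "h \<ge> 1" using schmidt_height_ge_1[OF L(1)] by (simp add: h_def)
    have "H powr (- (1 + w0) + e) \<le> H powr (- (1 + w0) + \<epsilon>)" using e H by (intro powr_mono) auto
    then have "H powr (- (1 + w0) + e) \<le> infdist \<theta> L" using Hbad[OF L(1,2)] by simp
    then have "h * H powr (- (1 + w0) + e) \<le> h * infdist \<theta> L" using h by (intro mult_left_mono) auto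
    also have "\<dots> \<le> C * H powr - w0" using L(3) by (simp add: h_def)
    finally have "h * H powr (- (1 + w0) + e) * H powr (1 + w0 - e) \<le> C * H powr - w0 * H powr (1 + w0 - e)"
      by (intro mult_right_mono) auto
    then have hle: "h \<le> C * H powr (1 - e)"
      using H(4) by (simp add: mult.assoc flip: powr_add)
    define H' where "H' = C * H powr (1 - e)"
    have "K \<le> H'"
    proof -
      have "K \<le> ((max 1 K)\<^sup>2) powr (1 / 2)" by (simp add: powr_half_sqrt)
      also have "\<dots> \<le> H powr (1 / 2)" using H by (intro powr_mono2) auto
      also have "\<dots> \<le> H powr (1 - e)" using e H by (intro powr_mono) auto
      also have "\<dots> \<le> H'" unfolding H'_def using C by (simp add: mult_le_cancel_right1)
      finally show ?thesis .
    qed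
    moreover have "h * infdist \<theta> L \<le> H' powr - w"
    proof -
      have "C powr (1 + w) = (C powr ((1 + w) / \<eta>)) powr \<eta>" using \<eta> by (simp add: powr_powr)
      also have "\<dots> \<le> H powr \<eta>" using H \<eta> by (intro powr_mono2) auto
      finally have le: "C powr (1 + w) \<le> H powr \<eta>" .
      have "C powr (1 + w) * C powr - w = C" using C by (simp flip: powr_add)
      then have "C * H powr - w0 = C powr (1 + w) * (C powr - w * H powr - w0)" by (metis mult.assoc)
      also have "\<dots> \<le> H powr \<eta> * (C powr - w * H powr - w0)" using le by (intro mult_right_mono) auto
      also have "\<dots> = C powr - w * (H powr \<eta> * H powr - w0)" by simp
      also have "H powr \<eta> * H powr - w0 = (H powr (1 - e)) powr - w"
        by (simp add: powr_powr \<eta>_def algebra_simps flip: powr_add)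
      also have "C powr - w * (H powr (1 - e)) powr - w = H' powr - w"
        using C by (simp add: H'_def powr_mult)
      finally show ?thesis using L(3) by (simp add: h_def)
    qed
    ultimately show ?thesis using L(1) hle by (intro exI[of _ H'] conjI exI[of _ L]) (auto simp: h_def H'_def)
  qed
  then have "ereal w \<le> omega_exp d \<theta>" unfolding omega_exp_def by (intro Sup_upper) blast
  then have "ereal w \<le> ereal w0" using \<theta> by (rule order_trans)
  then show False using w by simp
qed

text \<open>Coefficients of type \<open>rat\<close> make the family countable, and enumerable by
  \<open>from_nat\<close>, through its type. The index 0 gives the whole space.\<close>

definition rat_hyperplane :: "rat \<times> (rat ^ 'n) \<Rightarrow> (real ^ 'n::finite) set" where
  "rat_hyperplane c = {\<theta>. (\<chi> i. of_rat (snd c $ i)) \<bullet> \<theta> = - of_rat (fst c)}"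

lemma closed_rat_hyperplane: "closed (rat_hyperplane c)"
  unfolding rat_hyperplane_def by (rule closed_hyperplane)

lemma negligible_rat_hyperplane:
  assumes "c \<noteq> 0" shows "negligible (rat_hyperplane c)"
proof -
  have "(\<chi> i. of_rat (snd c $ i)) \<noteq> (0 :: real ^ 'a) \<or> - of_rat (fst c) \<noteq> (0 :: real)"
    using assms by (auto simp: Finite_Cartesian_Product.vec_eq_iff prod_eq_iff)
  then show ?thesis unfolding rat_hyperplane_def by (rule negligible_hyperplane)
qed

lemma not_Q_lin_indep1_obtains:
  assumes "\<not> Q_lin_indep1 \<theta>"
  obtains c where "c \<noteq> 0" "\<theta> \<in> rat_hyperplane c"
proof -
  obtain c0 c where c: "c0 \<in> \<rat>" "\<And>i. c i \<in> \<rat>" "c0 + (\<Sum>i\<in>UNIV. c i * \<theta> $ i) = 0"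
    "c0 \<noteq> 0 \<or> (\<exists>i. c i \<noteq> 0)" using assms by (auto simp: Q_lin_indep1_def)
  obtain q0 where q0: "c0 = of_rat q0" using c(1) by (auto elim: Rats_cases)
  have "\<exists>q. c i = of_rat q" for i using c(2)[of i] by (auto elim: Rats_cases)
  then obtain q where q: "\<And>i. c i = of_rat (q i)" by metis
  show thesis
  proof (rule that[of "(q0, \<chi> i. q i)"])
    show "(q0, \<chi> i. q i) \<noteq> 0"
      using c(4) by (auto simp: q q0 Finite_Cartesian_Product.vec_eq_iff prod_eq_iff)
    show "\<theta> \<in> rat_hyperplane (q0, \<chi> i. q i)"
      using c(3) by (simp add: rat_hyperplane_def inner_vec_def q q0)
  qed
qed

lemma negligible_not_Q_lin_indep1:
  "negligible {\<theta> :: real ^ 'n::finite. \<not> Q_lin_indep1 \<theta>}"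
proof -
  have "negligible (\<Union>(rat_hyperplane ` (- {0} :: (rat \<times> (rat ^ 'n)) set)))"
  proof (rule negligible_countable_Union)
    show "countable (rat_hyperplane ` (- {0} :: (rat \<times> (rat ^ 'n)) set))"
      by (intro countable_image countableI_type)
  qed (auto intro: negligible_rat_hyperplane)
  then show ?thesis by (rule negligible_subset) (blast elim: not_Q_lin_indep1_obtains)
qed

text \<open>At the Dirichlet exponent the formula for the dimension gives
  \<open>d + (n - d) = n\<close>.\<close>

lemma critical_exponent:
  fixes n d :: nat
  assumes "d < n" shows "(real n + 1) / (1 + (real d + 1) / (real n - real d)) = real n - real d"
proof -
  have "1 + (real d + 1) / (real n - real d) = (real n + 1) / (real n - real d)"
    using assms by (simp add: field_simps)
  then show ?thesis using assms by simp
qed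

text \<open>For every exponent beyond \<open>w0\<close> the critical dimension is below
  \<open>n\<close>, so the covering bound applies with \<open>s = n\<close> and yields Lebesgue null
  sets; countably many exponents suffice.\<close>

lemma negligible_omega_exp_gt:
  assumes d: "d < CARD('n::finite)" and w0: "w0 = (real d + 1) / (real CARD('n) - real d)"
  shows "negligible {\<theta> :: real ^ 'n. \<not> (Q_lin_indep1 \<theta> \<and> omega_exp d \<theta> \<le> ereal w0)}"
proof -
  have w0pos: "w0 > 0" using d w0 by simp
  have "hnull (real CARD('n)) (W_set d (ereal (w0 + 1 / real (Suc k))) :: (real ^ 'n) set)" for k
  proof (rule W_set_hnull[OF d])
    have "(real CARD('n) + 1) / (1 + (w0 + 1 / real (Suc k))) < (real CARD('n) + 1) / (1 + w0)"
      using w0pos by (intro divide_strict_left_mono) (auto intro!: mult_pos_pos add_pos_pos)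
    then show "real d + (real CARD('n) + 1) / (1 + (w0 + 1 / real (Suc k))) < real CARD('n)"
      using critical_exponent[OF d] by (simp add: w0)
  qed (use w0pos in \<open>simp add: add_pos_pos\<close>)
  then have "negligible (W_set d (ereal (w0 + 1 / real (Suc k))) :: (real ^ 'n) set)" for k
    by (intro hnull_imp_negligible) simp
  then have "negligible (\<Union>k. W_set d (ereal (w0 + 1 / real (Suc k))) :: (real ^ 'n) set)"
    by (intro negligible_countable_Union) auto
  then have "negligible ({\<theta> :: real ^ 'n. \<not> Q_lin_indep1 \<theta>} \<union> (\<Union>k. W_set d (ereal (w0 + 1 / real (Suc k)))))"
    by (intro negligible_Un negligible_not_Q_lin_indep1)
  then show ?thesis
  proof (rule negligible_subset, intro subsetI)
    fix \<theta> :: "real ^ 'n" assume \<theta>: "\<theta> \<in> {\<theta>. \<not> (Q_lin_indep1 \<theta> \<and> omega_exp d \<theta> \<le> ereal w0)}"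
    show "\<theta> \<in> {\<theta>. \<not> Q_lin_indep1 \<theta>} \<union> (\<Union>k. W_set d (ereal (w0 + 1 / real (Suc k))))"
    proof (cases "Q_lin_indep1 \<theta>")
      case True
      then have "ereal w0 < omega_exp d \<theta>" using \<theta> by auto
      then obtain z where z: "ereal w0 < ereal z" "ereal z < omega_exp d \<theta>" using ereal_dense2 by blast
      then obtain k where "inverse (real (Suc k)) < z - w0" using reals_Archimedean[of "z - w0"] by auto
      then have "ereal (w0 + 1 / real (Suc k)) \<le> ereal z" by (simp add: inverse_eq_divide)
      then have "ereal (w0 + 1 / real (Suc k)) \<le> omega_exp d \<theta>" using z(2) by (meson le_less_trans less_imp_le)
      then show ?thesis using True by (auto simp: W_set_def)
    qed auto
  qed
qed

text \<open>Continuity from below along the sets of points that belong to all \<open>E m\<close>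
  from some index on. It trades a threshold depending on the point for one scale that serves half of
  \<open>B\<close>.\<close>

lemma eventually_half_measure:
  fixes E :: "nat \<Rightarrow> 'a::euclidean_space set"
  assumes E: "\<And>m. E m \<in> sets lebesgue" and B: "B \<in> lmeasurable"
    and ae: "negligible {x. \<not> (\<forall>\<^sub>F m in sequentially. x \<in> E m)}" and pos: "0 < measure lebesgue B"
  shows "\<forall>\<^sub>F m in sequentially. measure lebesgue B / 2 \<le> measure lebesgue (B \<inter> E m)"
proof -
  define G where "G k = B \<inter> (\<Inter>m\<in>{k..}. E m)" for k
  have GE: "(\<Inter>m\<in>{k..}. E m) \<in> sets lebesgue" for k using E by (intro sets.countable_INT) auto
  have Gm: "G k \<in> lmeasurable" for k unfolding G_def using B GE by (rule fmeasurable_Int_fmeasurable)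
  have UG: "(\<Union>k. G k) \<in> lmeasurable"
  proof (rule fmeasurableI2[OF B])
    show "(\<Union>k. G k) \<in> sets lebesgue"
      using fmeasurableD[OF Gm] by (intro sets.countable_UN) auto
  qed (auto simp: G_def)
  have "(\<lambda>k. measure lebesgue (G k)) \<longlonglongrightarrow> measure lebesgue (\<Union>k. G k)"
  proof (rule Lim_measure_incseq)
    show "range G \<subseteq> sets lebesgue" using fmeasurableD[OF Gm] by blast
    show "incseq G" by (force simp: incseq_def G_def)
    show "emeasure lebesgue (\<Union>k. G k) \<noteq> \<infinity>" using fmeasurableD2[OF UG] by simp
  qed
  moreover have "measure lebesgue (\<Union>k. G k) = measure lebesgue B"
  proof (rule measure_negligible_symdiff[OF UG, symmetric])
    show "negligible (((\<Union>k. G k) - B) \<union> (B - (\<Union>k. G k)))"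
      using ae by (rule negligible_subset) (auto simp: G_def eventually_sequentially)
  qed
  ultimately have "\<forall>\<^sub>F k in sequentially. measure lebesgue B / 2 < measure lebesgue (G k)"
    using pos by (intro order_tendstoD(1)) auto
  then show ?thesis
  proof (rule eventually_mono)
    fix k assume k: "measure lebesgue B / 2 < measure lebesgue (G k)"
    have "measure lebesgue (G k) \<le> measure lebesgue (B \<inter> E k)"
      using Gm B E[of k] by (intro measure_mono_fmeasurable fmeasurable_Int_fmeasurable) (auto simp: G_def dest: fmeasurableD)
    then show "measure lebesgue B / 2 \<le> measure lebesgue (B \<inter> E k)" using k by simp
  qed
qed

section \<open>Separated points near rational subspaces\<close>

lemma packing_card:
  fixes Z :: "'a::euclidean_space set" and \<delta> D :: real
  assumes "finite Z" "Z \<subseteq> cball y D" "\<And>z z'. z \<in> Z \<Longrightarrow> z' \<in> Z \<Longrightarrow> z \<noteq> z' \<Longrightarrow> 2 * \<delta> < dist z z'"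
    and "0 \<le> D" "0 < \<delta>"
  shows "card Z * \<delta> ^ DIM('a) \<le> (D + \<delta>) ^ DIM('a)"
proof -
  let ?v = "unit_ball_vol (real DIM('a))"
  have v: "?v > 0" by simp
  have cb: "measure lebesgue (cball z \<delta>) = ?v * \<delta> ^ DIM('a)" for z :: 'a
    using content_cball[of \<delta> z] assms(5) by simp
  have disj: "disjoint_family_on (\<lambda>z. cball z \<delta>) Z"
    unfolding disjoint_family_on_def
  proof (intro ballI impI)
    fix z z' assume "z \<in> Z" "z' \<in> Z" "z \<noteq> z'"
    then have "2 * \<delta> < dist z z'" by (rule assms(3))
    moreover have "dist z z' \<le> 2 * \<delta>" if "t \<in> cball z \<delta>" "t \<in> cball z' \<delta>" for t
      using that dist_triangle2[of z z' t] by simp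
    ultimately show "cball z \<delta> \<inter> cball z' \<delta> = {}" by fastforce
  qed
  have "card Z * (?v * \<delta> ^ DIM('a)) = (\<Sum>z\<in>Z. measure lebesgue (cball z \<delta>))" by (simp add: cb)
  also have "\<dots> = measure lebesgue (\<Union>z\<in>Z. cball z \<delta>)"
    using assms(1) disj by (intro measure_finite_Union[symmetric]) (auto simp: emeasure_cball assms(5) less_imp_le)
  also have "\<dots> \<le> measure lebesgue (cball y (D + \<delta>))"
  proof (rule measure_mono_fmeasurable)
    show "(\<Union>z\<in>Z. cball z \<delta>) \<subseteq> cball y (D + \<delta>)"
    proof clarify
      fix z x assume "z \<in> Z" "x \<in> cball z \<delta>"
      then have "dist y z \<le> D" "dist z x \<le> \<delta>" using assms(2) by auto
      then show "x \<in> cball y (D + \<delta>)" using dist_triangle[of y x z] by simp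
    qed
  qed (use assms(1) in auto)
  also have "\<dots> = ?v * (D + \<delta>) ^ DIM('a)" using content_cball[of "D + \<delta>" y] assms(4,5) by simp
  finally have "?v * (card Z * \<delta> ^ DIM('a)) \<le> ?v * (D + \<delta>) ^ DIM('a)" by (simp add: ac_simps)
  then show ?thesis using v by (simp only: mult_le_cancel_left_pos)
qed

text \<open>Comparing volumes bounds the size of separated sets, so a largest one exists; a point
  that it fails to cover could be added to it.\<close>

lemma separated_subset:
  fixes T :: "'a::euclidean_space set"
  assumes T: "T \<subseteq> cball x R" "0 \<le> R" and \<delta>: "0 < \<delta>"
  shows "\<exists>Z. finite Z \<and> Z \<subseteq> T \<and> (\<forall>z\<in>Z. \<forall>z'\<in>Z. z \<noteq> z' \<longrightarrow> \<delta> < dist z z') \<and>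
    T \<subseteq> (\<Union>z\<in>Z. cball z \<delta>)"
proof -
  define sep where "sep Z \<longleftrightarrow> finite Z \<and> Z \<subseteq> T \<and> (\<forall>z\<in>Z. \<forall>z'\<in>Z. z \<noteq> z' \<longrightarrow> \<delta> < dist z z')" for Z
  define b where "b = nat \<lceil>(R + \<delta> / 2) ^ DIM('a) / (\<delta> / 2) ^ DIM('a)\<rceil>"
  have bound: "card Z < Suc b" if "sep Z" for Z
  proof -
    have "card Z * (\<delta> / 2) ^ DIM('a) \<le> (R + \<delta> / 2) ^ DIM('a)"
      using that T \<delta> by (intro packing_card[where y = x]) (auto simp: sep_def)
    then have "real (card Z) \<le> (R + \<delta> / 2) ^ DIM('a) / (\<delta> / 2) ^ DIM('a)" using \<delta> by (simp add: pos_le_divide_eq)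
    then have "real (card Z) \<le> real b" unfolding b_def by linarith
    then show ?thesis by simp
  qed
  have "sep {}" by (simp add: sep_def)
  from ex_has_greatest_nat[of sep, OF this, of card "Suc b"] bound
  obtain Z where Z: "sep Z" and max: "\<And>Y. sep Y \<Longrightarrow> card Y \<le> card Z" by blast
  have "T \<subseteq> (\<Union>z\<in>Z. cball z \<delta>)"
    proof (rule ccontr)
      assume "\<not> T \<subseteq> (\<Union>z\<in>Z. cball z \<delta>)"
      then obtain t where t: "t \<in> T" "t \<notin> (\<Union>z\<in>Z. cball z \<delta>)" by blast
      then have tZ: "\<delta> < dist z t" if "z \<in> Z" for z using that by (force simp: not_le)
      have "t \<notin> Z" using tZ[of t] \<delta> by auto
      moreover have "sep (insert t Z)" using Z t(1) tZ by (auto simp: sep_def dist_commute)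
      ultimately show False using max[of "insert t Z"] Z by (simp add: sep_def)
    qed
  with Z show ?thesis unfolding sep_def by blast
qed

text \<open>An orthonormal grid of mesh \<open>4 * r\<close>, wide enough that a set of diameter
  below \<open>r\<close> meets only one of the balls of radius \<open>r\<close>. The factor
  \<open>d + 1\<close> keeps the sum of the \<open>d\<close> displacements within
  \<open>\<rho>\<close>.\<close>

lemma affine_grid:
  fixes L :: "'a::euclidean_space set"
  assumes L: "affine L" "aff_dim L = int d" "q \<in> L" and r: "0 < r" "4 * (real d + 1) * r \<le> \<rho>"
  shows "\<exists>G. finite G \<and> G \<subseteq> L \<inter> cball q \<rho> \<and> card G = nat \<lfloor>\<rho> / (4 * (real d + 1) * r)\<rfloor> ^ d \<and>
    (\<forall>p\<in>G. \<forall>p'\<in>G. p \<noteq> p' \<longrightarrow> 4 * r \<le> dist p p') \<and>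
    (\<forall>p0\<in>G. \<forall>u\<ge>r. card {p \<in> G. dist p0 p \<le> 3 * u} \<le> (3 * u / r) ^ d)"
proof -
  define N where "N = nat \<lfloor>\<rho> / (4 * (real d + 1) * r)\<rfloor>"
  define V where "V = (\<lambda>x. x - q) ` L"
  have subV: "subspace V" unfolding V_def using affine_diffs_subspace_subtract[OF L(1,3)] .
  have "V = (+) (- q) ` L" by (auto simp: V_def)
  then have dimV: "dim V = d" using L(2,3) aff_dim_eq_dim[of q L] by (simp add: hull_inc)
  obtain B where B: "B \<subseteq> V" "pairwise orthogonal B" "\<And>e. e \<in> B \<Longrightarrow> norm e = 1" "independent B"
    "card B = dim V" "span B = V"
    using orthonormal_basis_subspace[OF subV] by metis
  have finB: "finite B" using B(4) independent_imp_finite by blast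
  define pt where "pt k = q + (\<Sum>e\<in>B. (4 * r * real (k e)) *\<^sub>R e)" for k :: "'a \<Rightarrow> nat"
  define I where "I = PiE B (\<lambda>_. {..<N})"
  have finI: "finite I" unfolding I_def using finB by (intro finite_PiE) auto
  have coord: "(pt k - pt k') \<bullet> e = 4 * r * (real (k e) - real (k' e))" if "e \<in> B" for k k' e
  proof -
    have "pt k - pt k' = (\<Sum>f\<in>B. (4 * r * (real (k f) - real (k' f))) *\<^sub>R f)"
      by (simp add: pt_def sum_subtractf scaleR_diff_left algebra_simps)
    then have "(pt k - pt k') \<bullet> e = (\<Sum>f\<in>B. (4 * r * (real (k f) - real (k' f))) * (f \<bullet> e))"
      by (simp add: inner_sum_left)
    also have "\<dots> = (\<Sum>f\<in>B. if f = e then 4 * r * (real (k f) - real (k' f)) else 0)"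
    proof (rule sum.cong[OF refl])
      fix f assume "f \<in> B"
      then have "f \<bullet> e = (if f = e then 1 else 0)"
        using B(2) B(3)[OF that] that unfolding pairwise_def real_inner_class.orthogonal_def
        by (cases "f = e") (auto simp: norm_eq_1)
      then show "(4 * r * (real (k f) - real (k' f))) * (f \<bullet> e) = (if f = e then 4 * r * (real (k f) - real (k' f)) else 0)"
        by simp
    qed
    also have "\<dots> = 4 * r * (real (k e) - real (k' e))" using finB that by simp
    finally show ?thesis .
  qed
  have dist_ge: "4 * r * \<bar>real (k e) - real (k' e)\<bar> \<le> dist (pt k) (pt k')" if "e \<in> B" for k k' e
  proof -
    have "\<bar>(pt k - pt k') \<bullet> e\<bar> \<le> norm (pt k - pt k')"
      using Cauchy_Schwarz_ineq2[of "pt k - pt k'" e] B(3)[OF that] by simp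
    then show ?thesis using coord[OF that, of k k'] r(1) by (simp add: abs_mult dist_norm)
  qed
  have sep: "4 * r \<le> dist (pt k) (pt k')" if "k \<in> I" "k' \<in> I" "k \<noteq> k'" for k k'
  proof -
    have "\<exists>e\<in>B. k e \<noteq> k' e"
    proof (rule ccontr)
      assume "\<not> (\<exists>e\<in>B. k e \<noteq> k' e)"
      then have "k = k'" using that unfolding I_def by (intro PiE_ext) auto
      then show False using that by simp
    qed
    then obtain e where e: "e \<in> B" "k e \<noteq> k' e" by blast
    then have "1 \<le> \<bar>real (k e) - real (k' e)\<bar>" by linarith
    then have "4 * r * 1 \<le> 4 * r * \<bar>real (k e) - real (k' e)\<bar>" using r(1) by (intro mult_left_mono) auto
    then show ?thesis using dist_ge[OF e(1), of k k'] by simp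
  qed
  have inj: "inj_on pt I"
  proof (rule inj_onI, rule ccontr)
    fix k k' assume "k \<in> I" "k' \<in> I" "pt k = pt k'" "k \<noteq> k'"
    then show False using sep[of k k'] r(1) by simp
  qed
  show ?thesis
  proof (intro exI[of _ "pt ` I"] conjI ballI allI impI)
    show "finite (pt ` I)" using finI by simp
    show "card (pt ` I) = nat \<lfloor>\<rho> / (4 * (real d + 1) * r)\<rfloor> ^ d"
      using inj finB B(5) dimV by (simp add: card_image I_def card_PiE N_def)
    show "4 * r \<le> dist p p'" if "p \<in> pt ` I" "p' \<in> pt ` I" "p \<noteq> p'" for p p' using that sep by blast
    show "pt ` I \<subseteq> L \<inter> cball q \<rho>"
    proof clarify
      fix k assume k: "k \<in> I"
      have "(\<Sum>e\<in>B. (4 * r * real (k e)) *\<^sub>R e) \<in> V"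
        using B(1) subV by (intro subspace_sum subspace_scale) auto
      then have "pt k \<in> L" by (auto simp: pt_def V_def)
      moreover have "norm (\<Sum>e\<in>B. (4 * r * real (k e)) *\<^sub>R e) \<le> \<rho>"
      proof -
        have "norm (\<Sum>e\<in>B. (4 * r * real (k e)) *\<^sub>R e) \<le> (\<Sum>e\<in>B. 4 * r * real N)"
        proof (rule order_trans[OF norm_sum], rule sum_mono)
          fix e assume e: "e \<in> B"
          then have "k e < N" using k by (auto simp: I_def)
          then show "norm ((4 * r * real (k e)) *\<^sub>R e) \<le> 4 * r * real N" using B(3)[OF e] r(1) by simp
        qed
        also have "\<dots> = real d * (4 * r * real N)" using B(5) dimV by simp
        also have "\<dots> \<le> (real d + 1) * (4 * r * (\<rho> / (4 * (real d + 1) * r)))"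
        proof -
          have "0 < 4 * (real d + 1) * r" using r(1) by simp
          then have "0 \<le> \<rho> / (4 * (real d + 1) * r)" using r(2) by (intro divide_nonneg_pos) linarith+
          then have "real N \<le> \<rho> / (4 * (real d + 1) * r)" unfolding N_def by (rule of_nat_floor)
          then have le: "4 * r * real N \<le> 4 * r * (\<rho> / (4 * (real d + 1) * r))" using r(1) by (intro mult_left_mono) auto
          then show ?thesis using r(1) by (intro mult_mono[OF _ le]) auto
        qed
        also have "\<dots> = (4 * (real d + 1) * r) * (\<rho> / (4 * (real d + 1) * r))" by (simp only: ac_simps)
        also have "\<dots> = \<rho>"
        proof -
          have *: "D * (\<rho> / D) = \<rho>" if "0 < D" for D :: real using that by simp
          show ?thesis by (rule *) (use r(1) in simp)
        qed
        finally show ?thesis .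
      qed
      ultimately show "pt k \<in> L \<inter> cball q \<rho>" by (simp add: pt_def dist_norm)
    qed
    show "card {p \<in> pt ` I. dist p0 p \<le> 3 * u} \<le> (3 * u / r) ^ d" if p0: "p0 \<in> pt ` I" and u: "r \<le> u" for p0 u
    proof -
      obtain k0 where k0: "k0 \<in> I" "p0 = pt k0" using p0 by blast
      \<comment> \<open>A distance of at most \<open>3 * u\<close> at mesh \<open>4 * r\<close>
        means at most \<open>u / r\<close> steps in each direction, and
        \<open>2 * m + 1 \<le> 3 * u / r\<close> because \<open>r \<le> u\<close>.\<close>
      define m where "m = nat \<lfloor>u / r\<rfloor>"
      have m: "real m \<le> u / r" using r u by (simp add: m_def)
      define K where "K = PiE B (\<lambda>e. {k0 e - m..k0 e + m})"
      have finK: "finite K" unfolding K_def using finB by (intro finite_PiE) auto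
      have "{p \<in> pt ` I. dist p0 p \<le> 3 * u} \<subseteq> pt ` K"
      proof clarify
        fix k assume k: "k \<in> I" "dist p0 (pt k) \<le> 3 * u"
        have "k \<in> K" unfolding K_def
        proof (rule PiE_I)
          fix e assume e: "e \<in> B"
          have "4 * r * \<bar>real (k0 e) - real (k e)\<bar> \<le> 3 * u" using dist_ge[OF e, of k0 k] k(2) k0(2) by simp
          then have "\<bar>real (k0 e) - real (k e)\<bar> \<le> u / r" using r u by (simp add: field_simps)
          then have "\<bar>int (k0 e) - int (k e)\<bar> \<le> \<lfloor>u / r\<rfloor>" by (simp add: le_floor_iff)
          then have "\<bar>int (k0 e) - int (k e)\<bar> \<le> int m" using r u by (simp add: m_def)
          then show "k e \<in> {k0 e - m..k0 e + m}" by auto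
        qed (use k in \<open>auto simp: I_def\<close>)
        then show "pt k \<in> pt ` K" by blast
      qed
      then have "card {p \<in> pt ` I. dist p0 p \<le> 3 * u} \<le> card K"
        using finK by (meson card_image_le card_mono finite_imageI order_trans)
      also have "card K = (\<Prod>e\<in>B. card {k0 e - m..k0 e + m})" using finB by (simp add: K_def card_PiE)
      also have "\<dots> \<le> (\<Prod>e\<in>B. 2 * m + 1)" by (intro prod_mono) auto
      also have "\<dots> = (2 * m + 1) ^ d" using B(5) dimV by simp
      finally have "real (card {p \<in> pt ` I. dist p0 p \<le> 3 * u}) \<le> real (2 * m + 1) ^ d"
        by (metis of_nat_le_iff of_nat_power)
      also have "\<dots> \<le> (3 * u / r) ^ d"
      proof (rule power_mono)
        have "1 \<le> u / r" using r u by simp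
        then show "real (2 * m + 1) \<le> 3 * u / r" using m by simp
      qed simp
      finally show ?thesis .
    qed
  qed
qed

lemma eventually_powr_ge:
  assumes "0 < c" shows "\<forall>\<^sub>F m in sequentially. K \<le> real m powr c"
proof -
  have "\<forall>\<^sub>F m in sequentially. max 1 \<bar>K\<bar> powr (1 / c) \<le> real m"
    using filterlim_real_sequentially by (simp add: filterlim_at_top)
  then show ?thesis
  proof (rule eventually_mono)
    fix m assume "max 1 \<bar>K\<bar> powr (1 / c) \<le> real m"
    then have "(max 1 \<bar>K\<bar> powr (1 / c)) powr c \<le> real m powr c" using assms by (intro powr_mono2) auto
    then show "K \<le> real m powr c" using assms abs_ge_self[of K] by (simp add: powr_powr)
  qed
qed

lemma eventually_near_subspace:
  assumes d: "d < CARD('n::finite)" and w0: "w0 = (real d + 1) / (real CARD('n) - real d)"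
    and \<epsilon>: "0 < \<epsilon>" "\<epsilon> < 1 + w0" and P: "closed P" "negligible P" "P \<noteq> {}"
    and B: "B \<in> lmeasurable" "0 < measure lebesgue B"
  shows "\<forall>\<^sub>F m in sequentially. measure lebesgue B / 2 \<le> measure lebesgue
     {\<theta> :: real ^ 'n. \<theta> \<in> B \<and> 4 * real m powr (- (1 + w0) + \<epsilon>) < infdist \<theta> P \<and>
       (\<exists>L. rat_affine_subspace d L \<and> schmidt_height L \<le> real m \<and> infdist \<theta> L < real m powr (- (1 + w0) + \<epsilon>))}"
proof -
  define \<rho> where "\<rho> m = real m powr (- (1 + w0) + \<epsilon>)" for m
  \<comment> \<open>Strict inequalities make these sets open and therefore measurable.\<close>
  define E where "E m = {\<theta> :: real ^ 'n. 4 * \<rho> m < infdist \<theta> P} \<inter>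
    (\<Union>L\<in>{L. rat_affine_subspace d L \<and> schmidt_height L \<le> real m}. {\<theta>. infdist \<theta> L < \<rho> m})" for m
  have "open {\<theta> :: real ^ 'n. infdist \<theta> L < c}" "open {\<theta> :: real ^ 'n. c < infdist \<theta> L}" for L c
    by (intro open_Collect_less continuous_intros)+
  then have "open (E m)" for m unfolding E_def by (intro open_Int open_UN) auto
  then have Em: "E m \<in> sets lebesgue" for m by (intro sets_completionI_sets) (simp add: borel_open)
  have "negligible ({\<theta> :: real ^ 'n. \<not> (Q_lin_indep1 \<theta> \<and> omega_exp d \<theta> \<le> ereal w0)} \<union> P)"
    using negligible_omega_exp_gt[OF d w0] P(2) by (intro negligible_Un)
  then have "negligible {x. \<not> (\<forall>\<^sub>F m in sequentially. x \<in> E m)}"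
  proof (rule negligible_subset, intro subsetI)
    fix \<theta> :: "real ^ 'n" assume bad: "\<theta> \<in> {x. \<not> (\<forall>\<^sub>F m in sequentially. x \<in> E m)}"
    show "\<theta> \<in> {\<theta>. \<not> (Q_lin_indep1 \<theta> \<and> omega_exp d \<theta> \<le> ereal w0)} \<union> P"
    proof (rule ccontr)
      assume "\<not> ?thesis"
      then have \<theta>: "omega_exp d \<theta> \<le> ereal w0" "\<theta> \<notin> P" by auto
      then have dP: "0 < infdist \<theta> P"
        using in_closed_iff_infdist_zero[OF P(1,3), of \<theta>] infdist_nonneg[of \<theta> P] by linarith
      \<comment> \<open>Asking for half of \<open>\<epsilon>\<close> turns the weak inequality into
        a strict one at the scale \<open>\<rho> m\<close>, as soon as \<open>m\<close> is at least
        2.\<close>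
      obtain H0 where H0: "\<And>H. H \<ge> H0 \<Longrightarrow> \<exists>L. rat_affine_subspace d L \<and> schmidt_height L \<le> H \<and>
        infdist \<theta> L \<le> H powr (- (1 + w0) + \<epsilon> / 2)"
        using generic_approximation[OF d \<theta>(1) w0, of "\<epsilon> / 2"] \<epsilon> by auto
      have "\<forall>\<^sub>F m in sequentially. max 2 H0 \<le> real m"
        using filterlim_real_sequentially unfolding filterlim_at_top by blast
      moreover have "\<forall>\<^sub>F m in sequentially. 5 / infdist \<theta> P \<le> real m powr (1 + w0 - \<epsilon>)"
        using \<epsilon> by (intro eventually_powr_ge) simp
      ultimately have "\<forall>\<^sub>F m in sequentially. \<theta> \<in> E m"
      proof eventually_elim
        case (elim m)
        have "real m powr (- (1 + w0) + \<epsilon> / 2) < \<rho> m" unfolding \<rho>_def using elim \<epsilon> by (intro powr_less_mono) auto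
        moreover obtain L where "rat_affine_subspace d L" "schmidt_height L \<le> real m"
          "infdist \<theta> L \<le> real m powr (- (1 + w0) + \<epsilon> / 2)" using H0[of "real m"] elim by auto
        moreover have "4 * \<rho> m < infdist \<theta> P"
        proof -
          have "\<rho> m = 1 / real m powr (1 + w0 - \<epsilon>)"
            using powr_minus_divide[of "real m" "1 + w0 - \<epsilon>"] by (simp add: \<rho>_def algebra_simps)
          moreover have X: "0 < real m powr (1 + w0 - \<epsilon>)" using elim by simp
          moreover have "5 / real m powr (1 + w0 - \<epsilon>) \<le> infdist \<theta> P" using elim dP X by (simp add: field_simps)
          moreover have "4 / real m powr (1 + w0 - \<epsilon>) < 5 / real m powr (1 + w0 - \<epsilon>)"
            using X by (intro divide_strict_right_mono) auto
          ultimately show ?thesis by linarith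
        qed
        ultimately show ?case unfolding E_def by force
      qed
      then show False using bad by simp
    qed
  qed
  from eventually_half_measure[OF Em B(1) this B(2)]
  show ?thesis
  proof (rule eventually_mono)
    fix m assume "measure lebesgue B / 2 \<le> measure lebesgue (B \<inter> E m)"
    also have "B \<inter> E m = {\<theta> :: real ^ 'n. \<theta> \<in> B \<and> 4 * \<rho> m < infdist \<theta> P \<and>
       (\<exists>L. rat_affine_subspace d L \<and> schmidt_height L \<le> real m \<and> infdist \<theta> L < \<rho> m)}"
      by (auto simp: E_def)
    finally show "measure lebesgue B / 2 \<le> measure lebesgue
     {\<theta> :: real ^ 'n. \<theta> \<in> B \<and> 4 * real m powr (- (1 + w0) + \<epsilon>) < infdist \<theta> P \<and>
       (\<exists>L. rat_affine_subspace d L \<and> schmidt_height L \<le> real m \<and> infdist \<theta> L < real m powr (- (1 + w0) + \<epsilon>))}"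
      unfolding \<rho>_def .
  qed
qed

text \<open>Almost every point of the ball lies within \<open>\<rho>\<close> of a rational subspace of height at most \<open>m\<close>.
  A \<open>8 * \<rho>\<close>-separated family of such points, replaced by \<open>r\<close>-grids of diameter \<open>\<rho>\<close> inside the
  respective subspaces, is as well spread as the Hausdorff dimension \<open>s\<close> permits.\<close>
lemma well_spread_points:
  fixes x :: "real ^ 'n::finite"
  assumes d: "d < CARD('n)" and w0: "w0 = (real d + 1) / (real CARD('n) - real d)"
    and s: "real d \<le> s" "s \<le> real CARD('n)"
    and a: "1 + w0 < a" "(s - real d) * a < real CARD('n) + 1"
    and P: "closed P" "negligible P" "P \<noteq> {}" and R: "0 < R" "R \<le> 1"
  shows "\<exists>m\<ge>M. \<exists>r S. r = real m powr - a \<and> 0 < r \<and> r \<le> R / 2 \<and> finite S \<and>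
      (\<forall>p\<in>S. cball p r \<subseteq> cball x R - P \<and> (\<exists>L. rat_affine_subspace d L \<and> schmidt_height L \<le> real m \<and> p \<in> L)) \<and>
      (\<forall>U u. bounded U \<longrightarrow> diameter U \<le> u \<longrightarrow> u < r \<longrightarrow> card {p\<in>S. cball p r \<inter> U \<noteq> {}} \<le> 1) \<and>
      (\<forall>U u. bounded U \<longrightarrow> diameter U \<le> u \<longrightarrow> r \<le> u \<longrightarrow> u \<le> R \<longrightarrow>
         card {p\<in>S. cball p r \<inter> U \<noteq> {}} \<le> (2 * 32 ^ CARD('n) :: real) * card S * (u / R) powr s) \<and>
      4 * (R / r) powr s \<le> card S"
proof -
  define n where "n = CARD('n)"
  have nd: "0 < real n - real d" using d by (simp add: n_def)
  have w0pos: "0 < w0" using d w0 by simp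
  \<comment> \<open>This identity makes the count in the lower bound match the threshold
    \<open>n + 1\<close> of the covering sum.\<close>
  have w0n: "(1 + w0) * (real n - real d) = real n + 1"
  proof -
    have "w0 * (real n - real d) = real d + 1" using nd by (simp add: w0 n_def)
    then show ?thesis by (simp add: distrib_right)
  qed
  define \<epsilon> where "\<epsilon> = min (1 / 2) ((real n + 1 - (s - real d) * a) / (2 * (real n - real d)))"
  have \<epsilon>: "0 < \<epsilon>" "\<epsilon> < 1 + w0" using a(2) nd w0pos by (auto simp: \<epsilon>_def n_def)
  have "\<epsilon> * (real n - real d) \<le> ((real n + 1 - (s - real d) * a) / (2 * (real n - real d))) * (real n - real d)"
    using nd by (intro mult_right_mono) (auto simp: \<epsilon>_def)
  also have "\<dots> = (real n + 1 - (s - real d) * a) / 2"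
  proof -
    have "X / (2 * D) * D = X / 2" if "0 < D" for X D :: real using that by simp
    from this[OF nd] show ?thesis .
  qed
  finally have \<epsilon>n: "\<epsilon> * (real n - real d) < real n + 1 - (s - real d) * a" using a(2) by (simp add: n_def)
  define b where "b = 1 + w0 - \<epsilon>"
  have b: "0 < b" "b < a" using \<epsilon> a by (auto simp: b_def)
  \<comment> \<open>The surplus exponent in the comparison of the number of grid points with
    \<open>r powr - s\<close>. It is positive because \<open>\<epsilon>\<close> uses only half of
    the slack in the bound on \<open>(s - d) * a\<close>.\<close>
  define \<gamma> where "\<gamma> = b * (real n - real d) - a * (s - real d)"
  have \<gamma>: "0 < \<gamma>"
  proof -
    have "b * (real n - real d) = real n + 1 - \<epsilon> * (real n - real d)"
      unfolding b_def w0n[symmetric] by (simp add: algebra_simps)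
    then show ?thesis using \<epsilon>n by (simp add: \<gamma>_def mult.commute)
  qed
  \<comment> \<open>The losses are \<open>1 / (2 * 16 ^ n)\<close> in the number of separated points
    and \<open>1 / (8 * (d + 1))\<close> for each of the \<open>d\<close> directions of a
    grid.\<close>
  define c1 where "c1 = 1 / (2 * 16 ^ n * (8 * (real d + 1)) ^ d)"
  have c1: "0 < c1" unfolding c1_def by simp
  define K where "K = 4 * 3 ^ d / (c1 * R powr (real n - s))"
  define B where "B = cball x (R / 2)"
  have mB: "measure lebesgue B = unit_ball_vol (real n) * (R / 2) ^ n"
    using content_cball[of "R / 2" x] R by (simp add: B_def n_def)
  have B: "B \<in> lmeasurable" "0 < measure lebesgue B" using R mB by (auto simp: B_def)
  define near where "near m = {\<theta>. \<theta> \<in> B \<and> 4 * real m powr (- (1 + w0) + \<epsilon>) < infdist \<theta> P \<and>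
       (\<exists>L. rat_affine_subspace d L \<and> schmidt_height L \<le> real m \<and> infdist \<theta> L < real m powr (- (1 + w0) + \<epsilon>))}" for m
  have "\<forall>\<^sub>F m in sequentially. measure lebesgue B / 2 \<le> measure lebesgue (near m)"
    unfolding near_def by (rule eventually_near_subspace[OF d w0 \<epsilon> P B])
  moreover have "\<forall>\<^sub>F m in sequentially. 4 * (real d + 1) \<le> real m powr (a - b)" using b by (intro eventually_powr_ge) simp
  moreover have "\<forall>\<^sub>F m in sequentially. 6 / R \<le> real m powr b" using b by (intro eventually_powr_ge) simp
  moreover have "\<forall>\<^sub>F m in sequentially. K \<le> real m powr \<gamma>" using \<gamma> by (intro eventually_powr_ge)
  moreover have "\<forall>\<^sub>F m in sequentially. M \<le> m" "\<forall>\<^sub>F m in sequentially. 1 \<le> m"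
    by (rule eventually_ge_at_top)+
  ultimately have "\<forall>\<^sub>F m in sequentially. measure lebesgue B / 2 \<le> measure lebesgue (near m) \<and>
     4 * (real d + 1) \<le> real m powr (a - b) \<and> 6 / R \<le> real m powr b \<and> K \<le> real m powr \<gamma> \<and> M \<le> m \<and> 1 \<le> m"
    by (intro eventually_conj)
  then obtain m where m: "measure lebesgue B / 2 \<le> measure lebesgue (near m)"
    "4 * (real d + 1) \<le> real m powr (a - b)" "6 / R \<le> real m powr b" "K \<le> real m powr \<gamma>" "M \<le> m" "1 \<le> m"
    using eventually_happens'[OF sequentially_bot] by blast
  define \<rho> where "\<rho> = real m powr - b"
  define r where "r = real m powr - a"
  have \<rho>: "0 < \<rho>" and r: "0 < r" using m(6) by (auto simp: \<rho>_def r_def)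
  have r\<rho>: "4 * (real d + 1) * r \<le> \<rho>"
  proof -
    have "4 * (real d + 1) * r \<le> real m powr (a - b) * r" using m(2) r by (intro mult_right_mono) auto
    also have "\<dots> = \<rho>" by (simp add: r_def \<rho>_def flip: powr_add)
    finally show ?thesis .
  qed
  have r4: "4 * r \<le> \<rho>"
  proof -
    have "4 * r \<le> 4 * (real d + 1) * r" using r by simp
    with r\<rho> show ?thesis by linarith
  qed
  have \<rho>R: "6 * \<rho> \<le> R"
  proof -
    have "6 / R * \<rho> \<le> real m powr b * \<rho>" using m(3) \<rho> by (intro mult_right_mono) auto
    also have "\<dots> = 1" using m(6) by (simp add: \<rho>_def flip: powr_add)
    finally show ?thesis using R by (simp add: field_simps)
  qed
  define T where "T = {\<theta>. \<theta> \<in> B \<and> 4 * \<rho> < infdist \<theta> P \<and>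
       (\<exists>L. rat_affine_subspace d L \<and> schmidt_height L \<le> real m \<and> infdist \<theta> L < \<rho>)}"
  have "- (1 + w0) + \<epsilon> = - b" by (simp add: b_def)
  then have mT: "measure lebesgue B / 2 \<le> measure lebesgue T" using m(1) by (simp only: T_def \<rho>_def near_def)
  have TB: "T \<subseteq> cball x (R / 2)" by (auto simp: T_def B_def)
  have R2: "0 \<le> R / 2" and \<rho>8: "0 < 8 * \<rho>" using R \<rho> by simp_all
  \<comment> \<open>Each grid stays within \<open>2 * \<rho>\<close> of its point of
    \<open>Z\<close>, so separation \<open>8 * \<rho>\<close> leaves a gap of more than
    \<open>4 * \<rho>\<close> between different grids.\<close>
  obtain Z where Z: "finite Z" "Z \<subseteq> T" and Zsep: "\<forall>z\<in>Z. \<forall>z'\<in>Z. z \<noteq> z' \<longrightarrow> 8 * \<rho> < dist z z'"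
    and Zcov: "T \<subseteq> (\<Union>z\<in>Z. cball z (8 * \<rho>))"
    using separated_subset[OF TB R2 \<rho>8] by (elim exE conjE)
  have cardZ: "(R / (16 * \<rho>)) ^ n / 2 \<le> card Z"
  proof -
    let ?v = "unit_ball_vol (real n)"
    have v: "?v > 0" by simp
    have meas: "(\<Union>z\<in>Z. cball z (8 * \<rho>)) \<in> lmeasurable" using Z(1) by (intro fmeasurable.finite_UN) auto
    have "?v * (R / 2) ^ n / 2 \<le> measure lebesgue T" using mT mB by simp
    also have "\<dots> \<le> measure lebesgue (\<Union>z\<in>Z. cball z (8 * \<rho>))"
    proof (cases "T \<in> sets lebesgue")
      case True
      then show ?thesis using Zcov meas by (intro measure_mono_fmeasurable)
    next
      \<comment> \<open>\<open>measure\<close> is 0 on sets that are not measurable, so the bound is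
        trivial here.\<close>
      case False
      then show ?thesis by (simp add: measure_notin_sets)
    qed
    also have "\<dots> \<le> (\<Sum>z\<in>Z. measure lebesgue (cball z (8 * \<rho>)))"
      using Z(1) by (intro measure_UNION_le) auto
    also have "\<dots> = card Z * (?v * (8 * \<rho>) ^ n)"
      using \<rho> content_cball[of "8 * \<rho>", where 'a = "real ^ 'n"] by (simp add: n_def)
    finally have "?v * ((R / 2) ^ n / 2) \<le> ?v * (card Z * (8 * \<rho>) ^ n)" by (simp add: ac_simps)
    then have "(R / 2) ^ n / 2 \<le> card Z * (8 * \<rho>) ^ n" using v by (simp only: mult_le_cancel_left_pos)
    then have "(R / 2) ^ n / (8 * \<rho>) ^ n / 2 \<le> card Z" using \<rho> by (simp add: field_simps)
    moreover have "(R / 2) ^ n / (8 * \<rho>) ^ n = (R / (16 * \<rho>)) ^ n"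
    proof -
      have "(R / 2) ^ n / (8 * \<rho>) ^ n = (R / 2 / (8 * \<rho>)) ^ n" by (rule power_divide[symmetric])
      also have "R / 2 / (8 * \<rho>) = R / (16 * \<rho>)" by simp
      finally show ?thesis .
    qed
    ultimately show ?thesis by simp
  qed
  define N where "N = nat \<lfloor>\<rho> / (4 * (real d + 1) * r)\<rfloor>"
  have grid: "\<exists>G. finite G \<and> G \<subseteq> cball z (2 * \<rho>) \<and> card G = N ^ d \<and>
      (\<forall>p\<in>G. \<forall>p'\<in>G. p \<noteq> p' \<longrightarrow> 4 * r \<le> dist p p') \<and>
      (\<forall>p0\<in>G. \<forall>u\<ge>r. card {p \<in> G. dist p0 p \<le> 3 * u} \<le> (3 * u / r) ^ d) \<and>
      (\<exists>L. rat_affine_subspace d L \<and> schmidt_height L \<le> real m \<and> G \<subseteq> L)" if z: "z \<in> Z" for z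
  proof -
    obtain L where L: "rat_affine_subspace d L" "schmidt_height L \<le> real m" "infdist z L < \<rho>"
      using z Z(2) by (auto simp: T_def)
    obtain q where q: "q \<in> L" "infdist z L = dist z q"
      using infdist_attains_inf[OF closed_rat_affine_subspace[OF L(1)], of z] by blast
    have aff: "affine L" "aff_dim L = int d" using L(1) by (simp_all add: rat_affine_subspace_def)
    obtain G where G: "finite G" "G \<subseteq> L \<inter> cball q \<rho>" "card G = N ^ d"
      "\<forall>p\<in>G. \<forall>p'\<in>G. p \<noteq> p' \<longrightarrow> 4 * r \<le> dist p p'"
      "\<forall>p0\<in>G. \<forall>u\<ge>r. card {p \<in> G. dist p0 p \<le> 3 * u} \<le> (3 * u / r) ^ d"
      using affine_grid[OF aff q(1) r r\<rho>] unfolding N_def[symmetric] by (elim exE conjE)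
    have "G \<subseteq> cball z (2 * \<rho>)"
    proof
      fix p assume "p \<in> G"
      then have "dist q p \<le> \<rho>" using G(2) by auto
      then show "p \<in> cball z (2 * \<rho>)" using q(2) L(3) dist_triangle[of z p q] by simp
    qed
    moreover have "\<exists>L. rat_affine_subspace d L \<and> schmidt_height L \<le> real m \<and> G \<subseteq> L"
      using G(2) L(1,2) by blast
    ultimately show ?thesis using G(1,3-5) by - (rule exI[of _ G], intro conjI, assumption+)
  qed
  have "\<exists>G. \<forall>z\<in>Z. finite (G z) \<and> G z \<subseteq> cball z (2 * \<rho>) \<and> card (G z) = N ^ d \<and>
      (\<forall>p\<in>G z. \<forall>p'\<in>G z. p \<noteq> p' \<longrightarrow> 4 * r \<le> dist p p') \<and>
      (\<forall>p0\<in>G z. \<forall>u\<ge>r. card {p \<in> G z. dist p0 p \<le> 3 * u} \<le> (3 * u / r) ^ d) \<and>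
      (\<exists>L. rat_affine_subspace d L \<and> schmidt_height L \<le> real m \<and> G z \<subseteq> L)"
    by (intro bchoice ballI grid)
  then obtain G where G0: "\<forall>z\<in>Z. finite (G z) \<and> G z \<subseteq> cball z (2 * \<rho>) \<and> card (G z) = N ^ d \<and>
      (\<forall>p\<in>G z. \<forall>p'\<in>G z. p \<noteq> p' \<longrightarrow> 4 * r \<le> dist p p') \<and>
      (\<forall>p0\<in>G z. \<forall>u\<ge>r. card {p \<in> G z. dist p0 p \<le> 3 * u} \<le> (3 * u / r) ^ d) \<and>
      (\<exists>L. rat_affine_subspace d L \<and> schmidt_height L \<le> real m \<and> G z \<subseteq> L)" ..
  note G = bspec[OF G0, THEN conjunct1]
    bspec[OF G0, THEN conjunct2, THEN conjunct1]
    bspec[OF G0, THEN conjunct2, THEN conjunct2, THEN conjunct1]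
    bspec[OF G0, THEN conjunct2, THEN conjunct2, THEN conjunct2, THEN conjunct1]
    bspec[OF G0, THEN conjunct2, THEN conjunct2, THEN conjunct2, THEN conjunct2, THEN conjunct1]
    bspec[OF G0, THEN conjunct2, THEN conjunct2, THEN conjunct2, THEN conjunct2, THEN conjunct2]
  define S where "S = (\<Union>z\<in>Z. G z)"
  have gap: "4 * \<rho> < dist p p'" if "z \<in> Z" "z' \<in> Z" "z \<noteq> z'" "p \<in> G z" "p' \<in> G z'" for z z' p p'
  proof -
    have "dist z p \<le> 2 * \<rho>" "dist z' p' \<le> 2 * \<rho>"
      using G(2)[OF that(1)] G(2)[OF that(2)] that(4,5) by auto
    then show ?thesis using Zsep[rule_format, OF that(1-3)] dist_triangle[of z z' p] dist_triangle[of p z' p']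
      by (simp add: dist_commute)
  qed
  have sepS: "4 * r \<le> dist p p'" if p: "p \<in> S" "p' \<in> S" "p \<noteq> p'" for p p'
  proof -
    obtain z z' where z: "z \<in> Z" "p \<in> G z" "z' \<in> Z" "p' \<in> G z'" using p(1,2) unfolding S_def by blast
    show ?thesis
    proof (cases "z = z'")
      case True
      then show ?thesis using G(4) z p(3) by blast
    next
      case False
      then have "4 * \<rho> < dist p p'" using gap z by blast
      then show ?thesis using r4 \<rho> by linarith
    qed
  qed
  have finS: "finite S" using Z(1) G(1) by (auto simp: S_def)
  have cardS: "card S = card Z * N ^ d"
  proof -
    have "card S = (\<Sum>z\<in>Z. card (G z))"
      unfolding S_def
    proof (rule card_UN_disjoint[OF Z(1)])
      show "\<forall>z\<in>Z. finite (G z)" using G(1) by blast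
      show "\<forall>z\<in>Z. \<forall>z'\<in>Z. z \<noteq> z' \<longrightarrow> G z \<inter> G z' = {}"
      proof (intro ballI impI)
        fix z z' assume zz: "z \<in> Z" "z' \<in> Z" "z \<noteq> z'"
        show "G z \<inter> G z' = {}"
        proof (rule ccontr)
          assume "G z \<inter> G z' \<noteq> {}"
          then obtain p where "p \<in> G z" "p \<in> G z'" by blast
          then show False using gap[OF zz, of p p] \<rho> by simp
        qed
      qed
    qed
    then show ?thesis using G(3) by simp
  qed
  \<comment> \<open>The quotient is at least 1, so rounding down loses at most a factor 2: hence 8
    in place of 4.\<close>
  have Nlow: "\<rho> / (8 * (real d + 1) * r) \<le> real N"
  proof -
    define X where "X = \<rho> / (4 * (real d + 1) * r)"
    have "0 < 4 * (real d + 1) * r" using r by simp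
    then have X: "1 \<le> X" unfolding X_def using r\<rho> by (simp only: le_divide_eq_1_pos)
    have NX: "int N = \<lfloor>X\<rfloor>" using X unfolding N_def X_def[symmetric] by simp
    have "1 \<le> \<lfloor>X\<rfloor>" using X by simp
    then have "1 \<le> real N" using NX by linarith
    moreover have "X < real N + 1" using NX by linarith
    ultimately have le: "X / 2 \<le> real N" by linarith
    have eq: "\<rho> / (8 * (real d + 1) * r) = X / 2" unfolding X_def using r by (simp add: field_simps)
    show ?thesis unfolding eq by (rule le)
  qed
  \<comment> \<open>The extra \<open>3 ^ d\<close> pays for the count \<open>(3 * u / r) ^ d\<close>
    inside a single grid.\<close>
  have many: "4 * 3 ^ d * (R / r) powr s \<le> card S"
  proof -
    define Q where "Q = c1 * R powr real n * \<rho> powr - (real n - real d) * r powr - real d"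
    have "4 * 3 ^ d * \<rho> powr (real n - real d) \<le> c1 * R powr (real n - s) * r powr (s - real d)"
    proof -
      have "K * \<rho> powr (real n - real d) \<le> real m powr \<gamma> * \<rho> powr (real n - real d)"
        using m(4) by (intro mult_right_mono) auto
      also have "\<dots> = r powr (s - real d)"
        by (simp add: \<rho>_def r_def powr_powr \<gamma>_def algebra_simps flip: powr_add)
      finally have "c1 * R powr (real n - s) * (K * \<rho> powr (real n - real d)) \<le> c1 * R powr (real n - s) * r powr (s - real d)"
        using c1 by (intro mult_left_mono) auto
      moreover have "c1 * R powr (real n - s) * K = 4 * 3 ^ d"
        using c1 R by (simp add: K_def)
      ultimately show ?thesis by (simp add: mult.assoc[symmetric])
    qed
    then have "4 * 3 ^ d * \<rho> powr (real n - real d) * (R powr s * r powr - s * \<rho> powr - (real n - real d))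
        \<le> c1 * R powr (real n - s) * r powr (s - real d) * (R powr s * r powr - s * \<rho> powr - (real n - real d))"
      by (intro mult_right_mono) auto
    also have "\<dots> = c1 * (R powr (real n - s) * R powr s) * (r powr (s - real d) * r powr - s) * \<rho> powr - (real n - real d)"
      by (simp add: ac_simps)
    also have "\<dots> = Q" by (simp add: Q_def flip: powr_add)
    also have "4 * 3 ^ d * \<rho> powr (real n - real d) * (R powr s * r powr - s * \<rho> powr - (real n - real d))
        = 4 * 3 ^ d * (R powr s * r powr - s) * (\<rho> powr (real n - real d) * \<rho> powr - (real n - real d))"
      by (simp add: ac_simps)
    also have "\<rho> powr (real n - real d) * \<rho> powr - (real n - real d) = 1" using \<rho> by (simp flip: powr_add)
    also have "R powr s * r powr - s = (R / r) powr s" using R r by (simp add: powr_divide powr_minus_divide)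
    finally have "4 * 3 ^ d * (R / r) powr s \<le> Q" by simp
    also have "Q = ((R / (16 * \<rho>)) ^ n / 2) * (\<rho> / (8 * (real d + 1) * r)) ^ d"
    proof -
      have "\<rho> powr - (real n - real d) = \<rho> ^ d / \<rho> ^ n"
        using \<rho> powr_diff[of \<rho> "real d" "real n"] by (simp add: powr_realpow)
      moreover have "r powr - real d = 1 / r ^ d" using r by (simp add: powr_minus_divide powr_realpow)
      moreover have "R powr real n = R ^ n" using R by (simp add: powr_realpow)
      ultimately show ?thesis by (simp add: Q_def c1_def power_divide power_mult_distrib)
    qed
    also have "\<dots> \<le> card Z * real N ^ d"
      using cardZ Nlow \<rho> r R by (intro mult_mono power_mono) auto
    finally show ?thesis by (simp add: cardS)
  qed
  have hit: "dist p p' \<le> 2 * r + u"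
    if U: "bounded U" "diameter U \<le> u" "cball p r \<inter> U \<noteq> {}" "cball p' r \<inter> U \<noteq> {}" for U u and p p' :: "real ^ 'n"
  proof -
    obtain t t' where t: "t \<in> U" "dist p t \<le> r" "t' \<in> U" "dist p' t' \<le> r" using U(3,4) by auto
    have "dist t t' \<le> u" using diameter_bounded_bound[OF U(1) t(1,3)] U(2) by simp
    then show ?thesis using t dist_triangle[of p p' t] dist_triangle[of t p' t'] by (simp add: dist_commute)
  qed
  have c_small: "card {p\<in>S. cball p r \<inter> U \<noteq> {}} \<le> 1" if U: "bounded U" "diameter U \<le> u" "u < r" for U u
  proof -
    have "p = p'" if "p \<in> S" "cball p r \<inter> U \<noteq> {}" "p' \<in> S" "cball p' r \<inter> U \<noteq> {}" for p p'
    proof (rule ccontr)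
      assume "p \<noteq> p'"
      then have "4 * r \<le> dist p p'" using sepS that by blast
      then show False using hit[OF U(1,2) that(2,4)] U(3) r by linarith
    qed
    then have "card {p\<in>S. cball p r \<inter> U \<noteq> {}} \<le> Suc 0"
      using finS by (subst card_le_Suc0_iff_eq) auto
    then show ?thesis by simp
  qed
  have c_big: "card {p\<in>S. cball p r \<inter> U \<noteq> {}} \<le> (2 * 32 ^ n :: real) * card S * (u / R) powr s"
    if U: "bounded U" "diameter U \<le> u" and u: "r \<le> u" "u \<le> R" for U u
  proof (cases "{p\<in>S. cball p r \<inter> U \<noteq> {}} = {}")
    case True
    then show ?thesis by (simp only: True card.empty) simp
  next
    case False
    then obtain p0 where p0: "p0 \<in> S" "cball p0 r \<inter> U \<noteq> {}" by blast
    then obtain z0 where z0: "z0 \<in> Z" "p0 \<in> G z0" by (auto simp: S_def)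
    have close: "dist p0 p \<le> 2 * r + u" if "cball p r \<inter> U \<noteq> {}" for p
      using hit[OF U p0(2) that] .
    show ?thesis
    proof (cases "u \<le> \<rho>")
      \<comment> \<open>At this size \<open>U\<close> reaches only one grid, because
        \<open>3 * u\<close> is less than the gap between grids. The grid count has exponent
        \<open>d \<le> s\<close>, and \<open>many\<close> relates it to
        \<open>card S\<close>.\<close>
      case True
      have "{p\<in>S. cball p r \<inter> U \<noteq> {}} \<subseteq> {p \<in> G z0. dist p0 p \<le> 3 * u}"
      proof clarify
        fix p assume p: "p \<in> S" "cball p r \<inter> U \<noteq> {}"
        obtain z where z: "z \<in> Z" "p \<in> G z" using p(1) unfolding S_def by blast
        have dp: "dist p0 p \<le> 3 * u" using close[OF p(2)] u by simp
        have "z = z0"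
        proof (rule ccontr)
          assume "z \<noteq> z0"
          then have "4 * \<rho> < dist p0 p" using gap z z0 by blast
          then show False using dp True \<rho> by linarith
        qed
        then show "p \<in> G z0 \<and> dist p0 p \<le> 3 * u" using z dp by simp
      qed
      then have "card {p\<in>S. cball p r \<inter> U \<noteq> {}} \<le> card {p \<in> G z0. dist p0 p \<le> 3 * u}"
        using G(1)[OF z0(1)] by (intro card_mono) auto
      also have "real \<dots> \<le> (3 * u / r) ^ d" using G(5)[OF z0(1)] z0(2) u(1) by blast
      also have "(3 * u / r) ^ d = 3 ^ d * (u / r) powr real d"
        using u r by (simp add: power_mult_distrib power_divide powr_realpow)
      also have "\<dots> \<le> 4 * 3 ^ d * (u / r) powr s"
        using u r s by (intro mult_mono powr_mono) auto
      also have "(u / r) powr s = (R / r) powr s * (u / R) powr s"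
        using u r R by (simp add: powr_mult[symmetric])
      also have "4 * 3 ^ d * ((R / r) powr s * (u / R) powr s) \<le> card S * (u / R) powr s"
        using many by (simp only: mult.assoc[symmetric]) (intro mult_right_mono, auto)
      also have "\<dots> \<le> 2 * 32 ^ n * (card S * (u / R) powr s)"
      proof -
        have "1 \<le> (32 :: real) ^ n" by simp
        then have "1 \<le> 2 * (32 :: real) ^ n" by linarith
        then have "1 * (card S * (u / R) powr s) \<le> 2 * 32 ^ n * (card S * (u / R) powr s)"
          by (intro mult_right_mono) auto
        then show ?thesis by simp
      qed
      finally show ?thesis by (simp add: mult.assoc)
    next
      case False
      \<comment> \<open>A larger \<open>U\<close> may meet many grids. Volume bounds their number by
        about \<open>(u / \<rho>) ^ n\<close>, and \<open>s \<le> n\<close> with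
        \<open>u \<le> R\<close> weakens the exponent to \<open>s\<close>.\<close>
      define Z' where "Z' = {z \<in> Z. \<exists>p\<in>G z. cball p r \<inter> U \<noteq> {}}"
      have finZ': "finite Z'" using Z(1) by (simp add: Z'_def)
      have "Z' \<subseteq> cball p0 (4 * u)"
      proof
        fix z assume "z \<in> Z'"
        then obtain p where p: "z \<in> Z" "p \<in> G z" "cball p r \<inter> U \<noteq> {}" by (auto simp: Z'_def)
        have "dist z p \<le> 2 * \<rho>" using G(2)[OF p(1)] p(2) by auto
        then have "dist p0 z \<le> 2 * r + u + 2 * \<rho>"
          using close[OF p(3)] dist_triangle[of p0 z p] by (simp add: dist_commute)
        then have "dist p0 z \<le> 4 * u" using r4 False \<rho> by linarith
        then show "z \<in> cball p0 (4 * u)" by simp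
      qed
      then have "card Z' * (4 * \<rho>) ^ n \<le> (4 * u + 4 * \<rho>) ^ n"
        using packing_card[OF finZ', of p0 "4 * u" "4 * \<rho>"] Zsep \<rho> u r by (simp add: Z'_def n_def)
      also have "\<dots> \<le> (8 * u) ^ n" using False \<rho> by (intro power_mono) auto
      finally have "card Z' \<le> (8 * u) ^ n / (4 * \<rho>) ^ n" using \<rho> by (simp add: pos_le_divide_eq)
      also have "\<dots> = 32 ^ n * (u / R) ^ n * (R / (16 * \<rho>)) ^ n"
      proof -
        \<comment> \<open>This is the origin of 32 in the constant; the additional 2 comes from the
          half in \<open>cardZ\<close>.\<close>
        have "8 * u / (4 * \<rho>) = 32 * (u / R) * (R / (16 * \<rho>))" using R by simp
        then show ?thesis by (metis power_divide power_mult_distrib)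
      qed
      also have "\<dots> \<le> 32 ^ n * (u / R) ^ n * (2 * card Z)"
        using cardZ u r R by (intro mult_left_mono) auto
      also have "(u / R) ^ n \<le> (u / R) powr s"
      proof -
        have "(u / R) ^ n = (u / R) powr real n" using u r R by (simp add: powr_realpow)
        also have "\<dots> \<le> (u / R) powr s" using u r R s by (intro powr_mono') (auto simp: n_def)
        finally show ?thesis .
      qed
      finally have Z'le: "card Z' \<le> 32 ^ n * (u / R) powr s * (2 * card Z)"
        by (simp add: mult_left_mono mult_right_mono)
      have "{p\<in>S. cball p r \<inter> U \<noteq> {}} \<subseteq> (\<Union>z\<in>Z'. G z)" by (auto simp: S_def Z'_def)
      then have "card {p\<in>S. cball p r \<inter> U \<noteq> {}} \<le> card (\<Union>z\<in>Z'. G z)"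
        using finZ' G(1) by (intro card_mono) (auto simp: Z'_def)
      also have "\<dots> \<le> (\<Sum>z\<in>Z'. card (G z))" by (rule card_UN_le[OF finZ'])
      also have "\<dots> = card Z' * N ^ d" using G(3) by (simp add: Z'_def)
      finally have "real (card {p\<in>S. cball p r \<inter> U \<noteq> {}}) \<le> real (card Z' * N ^ d)" by (rule of_nat_mono)
      also have "\<dots> = real (card Z') * real (N ^ d)" by (rule of_nat_mult)
      also have "\<dots> \<le> (32 ^ n * (u / R) powr s * (2 * card Z)) * real (N ^ d)"
        using Z'le by (intro mult_right_mono) auto
      also have "\<dots> = (2 * 32 ^ n :: real) * card S * (u / R) powr s" by (simp add: cardS)
      finally show ?thesis .
    qed
  qed
  have inside: "cball p r \<subseteq> cball x R - P \<and> (\<exists>L. rat_affine_subspace d L \<and> schmidt_height L \<le> real m \<and> p \<in> L)"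
    if p: "p \<in> S" for p
  proof -
    obtain z where z: "z \<in> Z" "p \<in> G z" using p unfolding S_def by blast
    have zp: "dist z p \<le> 2 * \<rho>" using G(2)[OF z(1)] z(2) by auto
    have zT: "dist x z \<le> R / 2" "4 * \<rho> < infdist z P" using z(1) Z(2) by (auto simp: T_def B_def)
    have "cball p r \<subseteq> cball x R - P"
    proof
      fix t assume "t \<in> cball p r"
      then have zt: "dist z t \<le> 3 * \<rho>" using zp r4 \<rho> dist_triangle[of z t p] by simp
      then have "t \<in> cball x R" using zT(1) \<rho>R dist_triangle[of x t z] by simp
      moreover have "t \<notin> P"
      proof
        assume "t \<in> P"
        then have "infdist z P \<le> dist z t" by (rule infdist_le)
        then show False using zt zT(2) \<rho> by linarith
      qed
      ultimately show "t \<in> cball x R - P" by blast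
    qed
    moreover have "\<exists>L. rat_affine_subspace d L \<and> schmidt_height L \<le> real m \<and> p \<in> L" using G(6)[OF z(1)] z(2) by blast
    ultimately show ?thesis by blast
  qed
  have "1 \<le> (3 :: real) ^ d" by simp
  then have "4 * (R / r) powr s \<le> 4 * 3 ^ d * (R / r) powr s" by (intro mult_right_mono) auto
  with many have many': "4 * (R / r) powr s \<le> card S" by linarith
  have rR: "r \<le> R / 2" using r4 \<rho>R \<rho> by linarith
  show ?thesis
  proof (rule exI[of _ m], rule conjI[OF m(5)], rule exI[of _ r], rule exI[of _ S], intro conjI)
    show "r = real m powr - a" by (rule r_def)
    show "\<forall>p\<in>S. cball p r \<subseteq> cball x R - P \<and> (\<exists>L. rat_affine_subspace d L \<and> schmidt_height L \<le> real m \<and> p \<in> L)"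
      using inside by (intro ballI)
    show "\<forall>U u. bounded U \<longrightarrow> diameter U \<le> u \<longrightarrow> u < r \<longrightarrow> card {p\<in>S. cball p r \<inter> U \<noteq> {}} \<le> 1"
      using c_small by (intro allI impI)
    show "\<forall>U u. bounded U \<longrightarrow> diameter U \<le> u \<longrightarrow> r \<le> u \<longrightarrow> u \<le> R \<longrightarrow>
         card {p\<in>S. cball p r \<inter> U \<noteq> {}} \<le> (2 * 32 ^ CARD('n) :: real) * card S * (u / R) powr s"
      using c_big unfolding n_def by (intro allI impI)
  qed (rule r rR finS many')+
qed

section \<open>The Hausdorff dimension\<close>

text \<open>Stage \<open>j\<close> has two tasks: an approximation with exponent \<open>a j\<close>
  at a parameter of at least \<open>j\<close>, and avoidance of the \<open>j\<close>-th rational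
  hyperplane, which secures \<open>Q_lin_indep1\<close>. Letting \<open>a\<close> vary with
  \<open>j\<close> covers exponents approached from below as well as infinity.\<close>

lemma W_set_not_hnull:
  fixes a :: "nat \<Rightarrow> real"
  assumes d: "d < CARD('n::finite)" and w0: "w0 = (real d + 1) / (real CARD('n) - real d)"
    and s: "0 < s" "real d \<le> s" "s \<le> real CARD('n)"
    and a: "\<And>j. 1 + w0 < a j" "\<And>j. (s - real d) * a j < real CARD('n) + 1"
    and lim: "\<And>v. ereal v < w \<Longrightarrow> \<forall>\<^sub>F j in sequentially. 1 + v < a j"
  shows "\<not> hnull s (W_set d w :: (real ^ 'n) set)"
proof -
  define c where "c j = (from_nat j :: rat \<times> (rat ^ 'n))" for j
  \<comment> \<open>Where the equation describes everything or nothing, \<open>{0}\<close> takes its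
    place, since \<open>well_spread_points\<close> expects a nonempty closed null set.\<close>
  define P where "P j = (if c j = 0 \<or> rat_hyperplane (c j) = {} then {0} else rat_hyperplane (c j))" for j
  have P: "closed (P j)" "negligible (P j)" "P j \<noteq> {}" for j
    using negligible_rat_hyperplane[of "c j"] closed_rat_hyperplane[of "c j"] by (simp_all add: P_def)
  define F where "F j = {\<theta> :: real ^ 'n. \<exists>m\<ge>j. \<exists>L. rat_affine_subspace d L \<and> schmidt_height L \<le> real m \<and>
    infdist \<theta> L \<le> real m powr - a j} - P j" for j
  define C :: real where "C = 2 * 32 ^ CARD('n)"
  have "1 \<le> (32 :: real) ^ CARD('n)" by simp
  then have C: "1 \<le> C" unfolding C_def by linarith
  have "\<not> hnull s (\<Inter>j. F j)"
  proof (rule Inter_not_hnull[OF s(1) C])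
    fix j and x :: "real ^ 'n" and R :: real assume R: "0 < R" "R \<le> 1"
    obtain m r S where *: "m \<ge> j" "r = real m powr - a j" "0 < r" "r \<le> R / 2" "finite S"
      "\<forall>p\<in>S. cball p r \<subseteq> cball x R - P j \<and> (\<exists>L. rat_affine_subspace d L \<and> schmidt_height L \<le> real m \<and> p \<in> L)"
      "\<forall>U u. bounded U \<longrightarrow> diameter U \<le> u \<longrightarrow> u < r \<longrightarrow> card {p\<in>S. cball p r \<inter> U \<noteq> {}} \<le> 1"
      "\<forall>U u. bounded U \<longrightarrow> diameter U \<le> u \<longrightarrow> r \<le> u \<longrightarrow> u \<le> R \<longrightarrow>
         card {p\<in>S. cball p r \<inter> U \<noteq> {}} \<le> C * card S * (u / R) powr s"
      "4 * (R / r) powr s \<le> card S"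
      using well_spread_points[OF d w0 s(2,3) a(1)[of j] a(2)[of j] P(1)[of j] P(2)[of j] P(3)[of j] R, of j x] unfolding C_def by (elim exE conjE)
    have "\<forall>p\<in>S. cball p r \<subseteq> cball x R \<inter> F j"
    proof
      fix p assume p: "p \<in> S"
      obtain L where L: "rat_affine_subspace d L" "schmidt_height L \<le> real m" "p \<in> L" using *(6) p by blast
      have "t \<in> F j" if t: "t \<in> cball p r" for t
      proof -
        have "infdist t L \<le> dist t p" using L(3) by (rule infdist_le)
        also have "\<dots> \<le> real m powr - a j" using t *(2) by (simp add: dist_commute)
        finally show ?thesis using *(1,6) p t L(1,2) unfolding F_def by blast
      qed
      then show "cball p r \<subseteq> cball x R \<inter> F j" using *(6) p by blast
    qed
    then show "\<exists>r S. 0 < r \<and> r \<le> R / 2 \<and> finite S \<and>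
      (\<forall>p\<in>S. cball p r \<subseteq> cball x R \<inter> F j) \<and>
      (\<forall>U u. bounded U \<longrightarrow> diameter U \<le> u \<longrightarrow> u < r \<longrightarrow> card {p\<in>S. cball p r \<inter> U \<noteq> {}} \<le> 1) \<and>
      (\<forall>U u. bounded U \<longrightarrow> diameter U \<le> u \<longrightarrow> r \<le> u \<longrightarrow> u \<le> R \<longrightarrow>
         card {p\<in>S. cball p r \<inter> U \<noteq> {}} \<le> C * card S * (u / R) powr s) \<and>
      4 * (R / r) powr s \<le> card S"
      using *(3,4,5,7,8,9) by (intro exI[of _ r] exI[of _ S] conjI)
  qed
  moreover have "(\<Inter>j. F j) \<subseteq> W_set d w"
  proof
    fix \<theta> assume \<theta>: "\<theta> \<in> (\<Inter>j. F j)"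
    have "Q_lin_indep1 \<theta>"
    proof (rule ccontr)
      assume "\<not> Q_lin_indep1 \<theta>"
      then obtain q where "q \<noteq> 0" "\<theta> \<in> rat_hyperplane q" by (rule not_Q_lin_indep1_obtains)
      then have "\<theta> \<in> P (to_nat q)" by (auto simp: P_def c_def)
      moreover have "\<theta> \<in> F (to_nat q)" using \<theta> by blast
      ultimately show False by (simp add: F_def)
    qed
    moreover have "w \<le> omega_exp d \<theta>"
    proof (rule dense_le)
      fix v assume v: "v < w"
      have "ereal v' \<le> omega_exp d \<theta>" if v': "ereal v' < w" for v'
      proof -
        have "\<exists>H\<ge>H0. \<exists>L. rat_affine_subspace d L \<and> schmidt_height L \<le> H \<and>
            schmidt_height L * infdist \<theta> L \<le> H powr (- v')" for H0
        proof -
          obtain j0 where j0: "\<And>j. j \<ge> j0 \<Longrightarrow> 1 + v' < a j"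
            using lim[OF v'] by (auto simp: eventually_sequentially)
          obtain k where k: "H0 \<le> real k" using real_arch_simple by blast
          define j where "j = max (max j0 k) 1"
          have j: "j0 \<le> j" "k \<le> j" "1 \<le> j" by (auto simp: j_def)
          have "\<theta> \<in> F j" using \<theta> by blast
          then obtain m L where mL: "m \<ge> j" "rat_affine_subspace d L" "schmidt_height L \<le> real m"
            "infdist \<theta> L \<le> real m powr - a j" unfolding F_def by blast
          have m: "1 \<le> real m" "H0 \<le> real m" using mL(1) j k by linarith+
          have "schmidt_height L * infdist \<theta> L \<le> real m * real m powr - a j"
            using mL(3,4) by (intro mult_mono) (auto simp: infdist_nonneg)
          also have "\<dots> = real m powr (1 - a j)"
            using m by (simp add: powr_diff powr_minus_divide)
          also have "\<dots> \<le> real m powr - v'" using j0[OF j(1)] m by (intro powr_mono) auto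
          finally show ?thesis using mL m by blast
        qed
        then show ?thesis unfolding omega_exp_def by (intro Sup_upper) blast
      qed
      then show "v \<le> omega_exp d \<theta>" using v by (cases v) auto
    qed
    ultimately show "\<theta> \<in> W_set d w" by (simp add: W_set_def)
  qed
  ultimately show ?thesis using hnull_subset by blast
qed

lemma W_set_mono: "v \<le> w \<Longrightarrow> W_set d w \<subseteq> W_set d v"
  by (auto simp: W_set_def)

lemma W_set_exact_subset: "W_set_exact d w \<subseteq> W_set d w"
  by (auto simp: W_set_def W_set_exact_def)

text \<open>From above, compare with finite exponents so large that their dimension drops below any
  \<open>t > d\<close>. From below, take \<open>s = d\<close>.\<close>

lemma hausdorff_dim_W_set_infinity:
  assumes d: "d < CARD('n::finite)"
  shows "hausdorff_dim (W_set d \<infinity> :: (real ^ 'n) set) = ereal (real d)"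
proof (rule antisym)
  show "hausdorff_dim (W_set d \<infinity> :: (real ^ 'n) set) \<le> ereal (real d)"
  proof (rule hausdorff_dim_le)
    fix t assume t: "real d < t"
    define v where "v = (real CARD('n) + 1) / (t - real d)"
    have v: "0 < v" using t by (auto simp: v_def intro!: divide_pos_pos add_pos_pos)
    have "(real CARD('n) + 1) / (1 + v) < (real CARD('n) + 1) / v"
      using v by (intro divide_strict_left_mono) auto
    also have "\<dots> = t - real d" using t by (simp add: v_def)
    finally have "hnull t (W_set d (ereal v) :: (real ^ 'n) set)" using d v by (intro W_set_hnull) auto
    then show "hnull t (W_set d \<infinity> :: (real ^ 'n) set)" by (rule hnull_subset) (rule W_set_mono, simp)
  qed simp
  show "ereal (real d) \<le> hausdorff_dim (W_set d \<infinity> :: (real ^ 'n) set)"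
  \<comment> \<open>\<open>hausdorff_dim_ge\<close> works with positive exponents; at
    \<open>d = 0\<close> the claim is nonnegativity of the dimension.\<close>
  proof (cases "d = 0")
    case True
    then show ?thesis using hausdorff_dim_nonneg by (simp add: zero_ereal_def)
  next
    case False
    define w0 where "w0 = (real d + 1) / (real CARD('n) - real d)"
    have "\<not> hnull (real d) (W_set d \<infinity> :: (real ^ 'n) set)"
    \<comment> \<open>At \<open>s = d\<close> the condition on \<open>(s - d) * a j\<close> reads
      \<open>0 < n + 1\<close>, so the \<open>a j\<close> may tend to infinity.\<close>
    proof (rule W_set_not_hnull[OF d w0_def, where a = "\<lambda>j. 2 + w0 + real j"])
      fix v :: real
      have "\<forall>\<^sub>F j in sequentially. v \<le> real j"
        using filterlim_real_sequentially unfolding filterlim_at_top by blast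
      then show "\<forall>\<^sub>F j in sequentially. 1 + v < 2 + w0 + real j"
      proof (rule eventually_mono)
        fix j assume "v \<le> real j"
        moreover have "0 \<le> w0" using d by (simp add: w0_def)
        ultimately show "1 + v < 2 + w0 + real j" by linarith
      qed
    qed (use False d in auto)
    then show ?thesis using False by (intro hausdorff_dim_ge) auto
  qed
qed

text \<open>Larger exponents form countably many sets that are null at this very dimension, so a
  null exact set would make all of \<open>W_set d w\<close> null.\<close>

lemma W_set_exact_not_hnull:
  assumes d: "d < CARD('n::finite)" and w: "(real d + 1) / (real CARD('n) - real d) \<le> w"
  shows "\<not> hnull (real d + (real CARD('n) + 1) / (1 + w)) (W_set_exact d (ereal w) :: (real ^ 'n) set)"
proof
  define w0 where "w0 = (real d + 1) / (real CARD('n) - real d)"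
  define s where "s = real d + (real CARD('n) + 1) / (1 + w)"
  assume "hnull (real d + (real CARD('n) + 1) / (1 + w)) (W_set_exact d (ereal w) :: (real ^ 'n) set)"
  then have null: "hnull s (W_set_exact d (ereal w) :: (real ^ 'n) set)" by (simp only: s_def)
  have w0: "0 < w0" using d by (simp add: w0_def)
  have w0s: "(real CARD('n) + 1) / (1 + w0) = real CARD('n) - real d"
    unfolding w0_def by (rule critical_exponent[OF d])
  show False
  \<comment> \<open>At \<open>w = w0\<close> the dimension is \<open>n\<close>, and the conditions
    \<open>1 + w0 < a j\<close> and \<open>(n - d) * a j < n + 1\<close> exclude each other. There
    the exact set has full Lebesgue measure, because every exponent is at least
    \<open>w0\<close>.\<close>
  proof (cases "w = w0")
    case True
    have "negligible (W_set_exact d (ereal w) :: (real ^ 'n) set)"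
      using null w0s True by (intro hnull_imp_negligible) (simp add: s_def)
    then have neg: "negligible (W_set_exact d (ereal w) \<union> {\<theta> :: real ^ 'n. \<not> (Q_lin_indep1 \<theta> \<and> omega_exp d \<theta> \<le> ereal w0)})"
      using negligible_omega_exp_gt[OF d w0_def] by (rule negligible_Un)
    have "W_set_exact d (ereal w) \<union> {\<theta> :: real ^ 'n. \<not> (Q_lin_indep1 \<theta> \<and> omega_exp d \<theta> \<le> ereal w0)} = UNIV"
      using omega_exp_ge[OF d] True by (auto simp: W_set_exact_def w0_def intro: antisym)
    with neg have "negligible (UNIV :: (real ^ 'n) set)" by (simp only:)
    then show False using non_negligible_UNIV by blast
  next
    case False
    then have ww: "w0 < w" using w by (simp add: w0_def)
    then have w_pos: "0 < w" using w0 by simp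
    define \<eta> where "\<eta> = (w - w0) / 2"
    have s_le: "s \<le> real CARD('n)"
    proof -
      have "(real CARD('n) + 1) / (1 + w) \<le> (real CARD('n) + 1) / (1 + w0)"
        using ww w0 by (intro divide_left_mono) auto
      then show ?thesis using w0s by (simp add: s_def)
    qed
    have sd: "0 < s - real d" using w_pos by (simp add: s_def)
    have "\<not> hnull s (W_set d (ereal w) :: (real ^ 'n) set)"
    \<comment> \<open>The \<open>a j\<close> approach \<open>1 + w\<close> strictly from below, as
      the strict bound \<open>(s - d) * a j < n + 1\<close> demands; \<open>\<eta>\<close> is half
      the distance to \<open>w0\<close>, which keeps them above \<open>1 + w0\<close>.\<close>
    proof (rule W_set_not_hnull[OF d w0_def _ _ s_le, where a = "\<lambda>j. 1 + w - \<eta> / real (Suc j)"])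
      show "0 < s" "real d \<le> s" using sd by linarith+
      fix j
      have "0 < \<eta>" "\<eta> < w - w0" using ww by (simp_all add: \<eta>_def)
      moreover from this have "\<eta> / real (Suc j) \<le> \<eta> / 1" by (intro divide_left_mono) auto
      ultimately show "1 + w0 < 1 + w - \<eta> / real (Suc j)" by linarith
      have "(s - real d) * (1 + w - \<eta> / real (Suc j)) < (s - real d) * (1 + w)"
        using sd ww by (intro mult_strict_left_mono) (auto simp: \<eta>_def)
      also have "\<dots> = real CARD('n) + 1" using w_pos by (simp add: s_def)
      finally show "(s - real d) * (1 + w - \<eta> / real (Suc j)) < real CARD('n) + 1" .
    next
      fix v assume "ereal v < ereal w"
      then have v: "0 < w - v" by simp
      have "(\<lambda>j. \<eta> / real (Suc j)) \<longlonglongrightarrow> 0"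
        using LIMSEQ_inverse_real_of_nat tendsto_mult_right_zero[of "\<lambda>j. inverse (real (Suc j))" sequentially \<eta>]
        by (simp add: divide_inverse)
      from order_tendstoD(2)[OF this v]
      show "\<forall>\<^sub>F j in sequentially. 1 + v < 1 + w - \<eta> / real (Suc j)" by (rule eventually_mono) simp
    qed
    moreover have "hnull s (W_set d (ereal (w + 1 / real (Suc k))) :: (real ^ 'n) set)" for k
    proof (rule W_set_hnull[OF d])
      have "(real CARD('n) + 1) / (1 + (w + 1 / real (Suc k))) < (real CARD('n) + 1) / (1 + w)"
        using w_pos by (intro divide_strict_left_mono) (auto intro!: mult_pos_pos add_pos_pos)
      then show "real d + (real CARD('n) + 1) / (1 + (w + 1 / real (Suc k))) < s" by (simp add: s_def)
    qed (use w_pos in \<open>simp add: add_pos_pos\<close>)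
    then have "hnull s (W_set_exact d (ereal w) \<union> (\<Union>k. W_set d (ereal (w + 1 / real (Suc k))) :: (real ^ 'n) set))"
      using null by (intro hnull_Un hnull_UN)
    moreover have "W_set d (ereal w) \<subseteq> W_set_exact d (ereal w) \<union> (\<Union>k. W_set d (ereal (w + 1 / real (Suc k))) :: (real ^ 'n) set)"
    proof
      fix \<theta> :: "real ^ 'n" assume \<theta>: "\<theta> \<in> W_set d (ereal w)"
      show "\<theta> \<in> W_set_exact d (ereal w) \<union> (\<Union>k. W_set d (ereal (w + 1 / real (Suc k))))"
      proof (cases "omega_exp d \<theta> = ereal w")
        case True
        then show ?thesis using \<theta> by (simp add: W_set_def W_set_exact_def)
      next
        case False
        then have "ereal w < omega_exp d \<theta>" using \<theta> by (simp add: W_set_def order_less_le)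
        then obtain z where z: "ereal w < ereal z" "ereal z < omega_exp d \<theta>" using ereal_dense2 by blast
        then obtain k where "inverse (real (Suc k)) < z - w" using reals_Archimedean[of "z - w"] by auto
        then have "ereal (w + 1 / real (Suc k)) \<le> ereal z" by (simp add: inverse_eq_divide)
        also have "\<dots> \<le> omega_exp d \<theta>" using z(2) by (rule less_imp_le)
        finally show ?thesis using \<theta> by (auto simp: W_set_def)
      qed
    qed
    ultimately show False using hnull_subset by blast
  qed
qed

theorem theorem3:
  fixes d :: nat and w :: ereal
  assumes "CARD('n::finite) \<ge> 2"
    and "d \<le> CARD('n) - 1"
    and "ereal ((real d + 1) / (real CARD('n) - real d)) \<le> w"
  shows "hausdorff_dim (W_set_exact d w :: (real ^ 'n) set) =
           ereal (real d) + (if w = \<infinity> then 0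
                             else ereal ((real CARD('n) + 1) / (1 + real_of_ereal w)))
       \<and> hausdorff_dim (W_set d w :: (real ^ 'n) set) =
           ereal (real d) + (if w = \<infinity> then 0
                             else ereal ((real CARD('n) + 1) / (1 + real_of_ereal w)))
       \<and> (hausdorff_dim (W_set d w :: (real ^ 'n) set) = ereal (real CARD('n))
            \<longleftrightarrow> w = ereal ((real d + 1) / (real CARD('n) - real d)))"
proof -
  define w0 where "w0 = (real d + 1) / (real CARD('n) - real d)"
  have d: "d < CARD('n)" using assms(1,2) by linarith
  have w0: "0 < w0" using d by (simp add: w0_def)
  show ?thesis
  proof (cases w)
    case PInf
    have "W_set_exact d \<infinity> = (W_set d \<infinity> :: (real ^ 'n) set)"
      by (auto simp: W_set_def W_set_exact_def)
    then show ?thesis using hausdorff_dim_W_set_infinity[OF d] PInf d by simp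
  next
    case MInf
    then show ?thesis using assms(3) by simp
  next
    case (real v)
    then have v: "w0 \<le> v" using assms(3) by (simp add: w0_def)
    define s where "s = real d + (real CARD('n) + 1) / (1 + v)"
    have "0 < (real CARD('n) + 1) / (1 + v)" using v w0 by (intro divide_pos_pos) auto
    then have s: "0 < s" by (simp add: s_def)
    have up: "hausdorff_dim (W_set d w :: (real ^ 'n) set) \<le> ereal s"
    proof (rule hausdorff_dim_le)
      fix t assume "s < t"
      then show "hnull t (W_set d w :: (real ^ 'n) set)"
        unfolding real using d v w0 by (intro W_set_hnull) (auto simp: s_def)
    qed (use s in simp)
    have low: "ereal s \<le> hausdorff_dim (W_set_exact d w :: (real ^ 'n) set)"
      using s W_set_exact_not_hnull[OF d, of v] v unfolding real s_def w0_def by (intro hausdorff_dim_ge)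
    have "hausdorff_dim (W_set_exact d w :: (real ^ 'n) set) \<le> hausdorff_dim (W_set d w :: (real ^ 'n) set)"
      by (rule hausdorff_dim_mono) (rule W_set_exact_subset)
    \<comment> \<open>The lower bound for the smaller set and the upper bound for the larger one
      coincide, so both dimensions are settled together.\<close>
    with up low have dims: "hausdorff_dim (W_set_exact d w :: (real ^ 'n) set) = ereal s"
      "hausdorff_dim (W_set d w :: (real ^ 'n) set) = ereal s" by (auto intro: antisym order_trans)
    have "s = real CARD('n) \<longleftrightarrow> v = w0"
    proof
      assume "s = real CARD('n)"
      then have "(real CARD('n) + 1) / (1 + v) = (real CARD('n) + 1) / (1 + w0)"
        using critical_exponent[OF d] by (simp add: s_def w0_def)
      then show "v = w0" using v w0 by (simp add: frac_eq_eq)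
    next
      assume "v = w0"
      then show "s = real CARD('n)" using critical_exponent[OF d] by (simp add: s_def w0_def)
    qed
    then show ?thesis using dims by (simp add: real s_def w0_def)
  qed
qed

end
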